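(* Let $a>0$, $\alpha>-1$, and $t\in(0,1)$ with $t>t^*:=a/(a+1)$, and let $K_n$ be the kernel defined in the context. Then for some constant $c>0$ and for all $x,y>0$, $$\lim_{n\to\infty}\frac1{cn^2}K_n\left(\frac{x}{cn^2},\frac{y}{cn^2}\right)=\left(\frac yx\right)^{\alpha/2}\frac{J_\alpha(\sqrt x)\sqrt y\,J_\alpha'(\sqrt y)-\sqrt x\,J_\alpha'(\sqrt x)J_\alpha(\sqrt y)}{2(x-y)}$$ (for $x=y$ the right-hand side is understood by continuity).
   Context: $J_\alpha$ is the Bessel function of the first kind of order $\alpha$. Kernel. Fix $a>0$, $\alpha>-1$, $t\in(0,1)$. For $n\in\mathbb N$ let $n_1=\lceil n/2\rceil$, $n_2=n-n_1$, and for $x>0$ let $w_1(x)=x^{\alpha/2}e^{-nx/(t(1-t))}I_\alpha(2n\sqrt{ax}/t)$ and $w_2(x)=x^{(\alpha+1)/2}e^{-nx/(t(1-t))}I_{\alpha+1}(2n\sqrt{ax}/t)$, where $I_\nu$ is the modified Bessel function of the first kind. Let $Y$ be the unique $3\times3$ matrix-valued function such that: (1) $Y$ is analytic in $\mathbb C\setminus[0,\infty)$; (2) $Y$ has continuous boundary values $Y_+$ (from the upper half-plane) and $Y_-$ (from the lower half-plane) on $(0,\infty)$ with $Y_+(x)=Y_-(x)\begin{pmatrix}1&w_1(x)&w_2(x)\\0&1&0\\0&0&1\end{pmatrix}$; (3) $Y(z)=(I+O(1/z))\operatorname{diag}(z^n,z^{-n_1},z^{-n_2})$ as $z\to\infty$;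 (4) as $z\to0$, the entries in columns 1 and 3 of $Y(z)$ are $O(1)$ and those in column 2 are $O(h(z))$, where $h(z)=|z|^\alpha$ if $-1<\alpha<0$, $h(z)=\log|z|$ if $\alpha=0$, $h(z)=1$ if $\alpha>0$. Then, for $x,y>0$, $$K_n(x,y)=\frac1{2\pi i(x-y)}\begin{pmatrix}0&w_1(y)&w_2(y)\end{pmatrix}Y_+^{-1}(y)Y_+(x)\begin{pmatrix}1\\0\\0\end{pmatrix}$$ (extended by continuity to $x=y$). This is a correlation kernel of the determinantal point process formed by the positions at (rescaled) time $t$ of $n$ non-intersecting squared Bessel paths with parameter $\alpha$ starting at $a$ and ending at $0$. *)

theory Defs
  imports "HOL-Analysis.Analysis" "HOL-Library.Landau_Symbols"
begin

text \<open>
  Bessel functions by their power series. They are only used for real order \<open>\<nu> > -1\<close> and at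
  positive real arguments, where \<open>powr\<close> is the usual real power; \<open>rGamma\<close> is \<open>1 / \<Gamma>\<close>.
\<close>

definition bessel_J :: "real \<Rightarrow> real \<Rightarrow> real" where
  "bessel_J \<nu> x =
     (\<Sum>k. (- 1) ^ k * rGamma (real k + \<nu> + 1) / fact k * (x / 2) powr (2 * real k + \<nu>))"

definition bessel_I :: "real \<Rightarrow> real \<Rightarrow> real" where
  "bessel_I \<nu> x =
     (\<Sum>k. rGamma (real k + \<nu> + 1) / fact k * (x / 2) powr (2 * real k + \<nu>))"

definition weight1 :: "real \<Rightarrow> real \<Rightarrow> real \<Rightarrow> nat \<Rightarrow> real \<Rightarrow> real" where
  "weight1 a \<alpha> t n x =
     x powr (\<alpha> / 2) * exp (- (real n * x) / (t * (1 - t)))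
       * bessel_I \<alpha> (2 * real n * sqrt (a * x) / t)"

definition weight2 :: "real \<Rightarrow> real \<Rightarrow> real \<Rightarrow> nat \<Rightarrow> real \<Rightarrow> real" where
  "weight2 a \<alpha> t n x =
     x powr ((\<alpha> + 1) / 2) * exp (- (real n * x) / (t * (1 - t)))
       * bessel_I (\<alpha> + 1) (2 * real n * sqrt (a * x) / t)"

definition jump :: "real \<Rightarrow> real \<Rightarrow> real \<Rightarrow> nat \<Rightarrow> real \<Rightarrow> complex^3^3" where
  "jump a \<alpha> t n x = vector
     [vector [1, of_real (weight1 a \<alpha> t n x), of_real (weight2 a \<alpha> t n x)],
      vector [0, 1, 0],
      vector [0, 0, 1]]"

text \<open>
  Boundary values on the real line from the upper and the lower half-plane, with unrestricted
  approach inside the open half-plane.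
\<close>

definition bdry_plus :: "(complex \<Rightarrow> complex^3^3) \<Rightarrow> real \<Rightarrow> complex^3^3" where
  "bdry_plus Y x = Lim (at (complex_of_real x) within {z. Im z > 0}) Y"

definition bdry_minus :: "(complex \<Rightarrow> complex^3^3) \<Rightarrow> real \<Rightarrow> complex^3^3" where
  "bdry_minus Y x = Lim (at (complex_of_real x) within {z. Im z < 0}) Y"

definition origin_growth :: "real \<Rightarrow> complex \<Rightarrow> real" where
  "origin_growth \<alpha> z =
     (if \<alpha> < 0 then cmod z powr \<alpha> else if \<alpha> = 0 then ln (cmod z) else 1)"

text \<open>
  The Riemann--Hilbert problem. A solution is a function on \<open>\<complex> \<setminus> [0,\<infinity>)\<close>: the values that the
  total function \<open>Y\<close> takes on \<open>[0,\<infinity>)\<close> are unconstrained and never used, so the limits at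
  infinity and at the origin are restricted to the slit plane.
\<close>

definition rhp_solution ::
  "real \<Rightarrow> real \<Rightarrow> real \<Rightarrow> nat \<Rightarrow> (complex \<Rightarrow> complex^3^3) \<Rightarrow> bool" where
  "rhp_solution a \<alpha> t n Y \<longleftrightarrow>
     (let D = - (\<real>\<^sub>\<ge>\<^sub>0 :: complex set); n1 = nat \<lceil>real n / 2\<rceil>; n2 = n - n1 in
       (\<forall>i j. (\<lambda>z. Y z $ i $ j) analytic_on D) \<and>
       (\<forall>x>0. (Y \<longlongrightarrow> bdry_plus Y x) (at (complex_of_real x) within {z. Im z > 0})) \<and>
       (\<forall>x>0. (Y \<longlongrightarrow> bdry_minus Y x) (at (complex_of_real x) within {z. Im z < 0})) \<and>
       continuous_on {0<..} (bdry_plus Y) \<and>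
       continuous_on {0<..} (bdry_minus Y) \<and>
       (\<forall>x>0. bdry_plus Y x = bdry_minus Y x ** jump a \<alpha> t n x) \<and>
       (\<exists>E :: complex \<Rightarrow> complex^3^3.
          (\<forall>z\<in>D. Y z = (mat 1 + E z) **
             vector [vector [z powi int n, 0, 0],
                     vector [0, z powi (- int n1), 0],
                     vector [0, 0, z powi (- int n2)]]) \<and>
          (\<forall>i j. (\<lambda>z. E z $ i $ j) \<in> O[inf at_infinity (principal D)](\<lambda>z. 1 / z))) \<and>
       (\<forall>i. (\<lambda>z. cmod (Y z $ i $ 1)) \<in> O[at 0 within D](\<lambda>z. 1)) \<and>
       (\<forall>i. (\<lambda>z. cmod (Y z $ i $ 2)) \<in> O[at 0 within D](origin_growth \<alpha>)) \<and>
       (\<forall>i. (\<lambda>z. cmod (Y z $ i $ 3)) \<in> O[at 0 within D](\<lambda>z. 1)))"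

text \<open>
  Extension of a function on \<open>(0,\<infinity>)\<^sup>2\<close> minus the diagonal to the diagonal by (joint) continuity.
\<close>

definition diag_extend :: "(real \<Rightarrow> real \<Rightarrow> 'a::t2_space) \<Rightarrow> real \<Rightarrow> real \<Rightarrow> 'a" where
  "diag_extend F x y =
     (if x = y then Lim (at (x, x) within {(u, v). 0 < u \<and> 0 < v \<and> u \<noteq> v}) (\<lambda>(u, v). F u v)
      else F x y)"

definition corr_kernel ::
  "real \<Rightarrow> real \<Rightarrow> real \<Rightarrow> nat \<Rightarrow> (complex \<Rightarrow> complex^3^3) \<Rightarrow> real \<Rightarrow> real \<Rightarrow> complex" where
  "corr_kernel a \<alpha> t n Y = diag_extend (\<lambda>x y.
     1 / (2 * of_real pi * \<i> * of_real (x - y)) *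
     (\<Sum>k\<in>UNIV.
        (vector [0, of_real (weight1 a \<alpha> t n y), of_real (weight2 a \<alpha> t n y)]
           v* (matrix_inv (bdry_plus Y y) ** bdry_plus Y x)) $ k
        * (vector [1, 0, 0] :: complex^3) $ k))"

definition bessel_limit_kernel :: "real \<Rightarrow> real \<Rightarrow> real \<Rightarrow> real" where
  "bessel_limit_kernel \<alpha> = diag_extend (\<lambda>x y.
     (y / x) powr (\<alpha> / 2) *
     ((bessel_J \<alpha> (sqrt x) * sqrt y * deriv (bessel_J \<alpha>) (sqrt y)
        - sqrt x * deriv (bessel_J \<alpha>) (sqrt x) * bessel_J \<alpha> (sqrt y))
      / (2 * (x - y))))"

end

theory Submission
  imports Defs "HOL-Complex_Analysis.Complex_Analysis" "HOL-Real_Asymp.Real_Asymp"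
begin

text \<open>
  No steepest descent is needed. The determinant of a solution \<open>Y\<close> is \<open>1\<close>, the first column of
  \<open>Y\<close> and the last two rows of \<open>Y\<^sup>-\<^sup>1\<close> are polynomial, and the jump of the first row of \<open>Y\<^sup>-\<^sup>1\<close>,
  integrated along the cut, shows that the kernel reproduces polynomials of degree below \<open>n\<close>.
  Together with its membership in the span of the weights this determines the kernel. After the
  scaling \<open>x \<mapsto> b x\<close> with \<open>b = n / (t (1 - t))\<close> and with \<open>A = n \<tau>\<close>, \<open>\<tau> = a (1 - t) / t\<close>, it is the
  finite sum \<open>\<Sum>\<^sub>k\<^sub><\<^sub>n P\<^sub>k(x) Q\<^sub>k(y)\<close>, where
  \<open>P\<^sub>k(x) = e\<^sup>x \<integral> u\<^sup>\<alpha> e\<^sup>-\<^sup>u (u + A)\<^sup>k F(- x u) du\<close> over the positive axis, \<open>F(z) = \<Sum>\<^sub>i z\<^sup>i / (i! \<Gamma>(i + \<alpha> + 1))\<close>, and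
  \<open>Q\<^sub>k(y)\<close> is the coefficient of \<open>w\<^sup>k\<close> in \<open>y\<^sup>\<alpha> e\<^sup>-\<^sup>y e\<^sup>w\<^sup>-\<^sup>A F(y (A - w))\<close>.

  Substituting \<open>u = n s\<close>, the sum over \<open>k\<close> becomes a combination of Poisson distribution functions with
  parameter \<open>n (s + \<tau>)\<close> evaluated near \<open>n\<close>. These tend to \<open>1\<close> for \<open>s + \<tau> < 1\<close> and to \<open>0\<close> for
  \<open>s + \<tau> > 1\<close>, so dominated convergence turns the kernel into an integral of
  \<open>s\<^sup>\<alpha> F(- \<xi> s) F(- \<eta> s)\<close> over \<open>(0, 1 - \<tau>)\<close>, which is the Bessel kernel. The condition
  \<open>t > a / (a + 1)\<close> says that \<open>\<tau> < 1\<close>.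
\<close>

section \<open>Entire Bessel functions\<close>

text \<open>The near-even split of \<open>n\<close> into \<open>n1\<close> and \<open>n2\<close> is
  what keeps everything in dimension \<open>n\<close>. By Bessel's equation, multiplying
  \<open>Z ^ j * bessel_F \<alpha> j (A * Z)\<close> by \<open>Z\<close> raises \<open>j\<close> by
  at most 2, so both weights, multiplied by the polynomials that occur, stay in the span of the
  functions with \<open>j < n\<close>. Paired with \<open>dual_P \<alpha> A k\<close> these
  functions give \<open>j choose k\<close>, up to a nonzero factor depending only on
  \<open>k\<close> and \<open>A\<close>. This is a triangular matrix with an explicit inverse, so
  \<open>n\<close> reproducing identities fix the \<open>n\<close> coefficients.

  The identities are proved at points \<open>x < 0\<close>, where \<open>Y\<close> takes a genuine
  value and not a boundary value. They reach \<open>x > 0\<close> because for fixed \<open>y\<close>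
  both sides are polynomials in \<open>x\<close>. Only the defining conditions of a solution enter,
  so every solution leads to the same finite sum.

  In the limit, the Taylor index \<open>j\<close> shifts the Poisson cutoff only from
  \<open>n\<close> to \<open>n - j\<close>. A fixed shift does not move the threshold, which is why
  a truncated Taylor series around \<open>\<tau> * \<eta>\<close> resums to one value of
  \<open>bessel_F\<close>.\<close>

abbreviation bessel_bound :: "real \<Rightarrow> real" where
  "bessel_bound \<alpha> \<equiv> rGamma (\<alpha> + 1) + rGamma (\<alpha> + 2)"

text \<open>From \<open>m = 1\<close> on the sequence decreases, since consecutive values differ by
  a factor \<open>m + \<alpha> + 1\<close>, which is at least 1. The first factor
  \<open>\<alpha> + 1\<close> may be below 1, so the value at \<open>m = 0\<close> enters the bound
  separately.\<close>

lemma rGamma_shift_bounds: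
  fixes \<alpha> :: real
  assumes "\<alpha> > -1"
  shows "0 < rGamma (real m + \<alpha> + 1)"
    and "rGamma (real m + \<alpha> + 1) \<le> bessel_bound \<alpha>"
proof -
  have pos: "0 < rGamma (real k + \<alpha> + 1)" for k
    using assms by (simp add: rGamma_inverse_Gamma Gamma_real_pos)
  show "0 < rGamma (real m + \<alpha> + 1)" by (rule pos)
  show "rGamma (real m + \<alpha> + 1) \<le> bessel_bound \<alpha>"
  proof (cases m)
    case 0
    then show ?thesis using pos[of 1] by (simp add: add.commute add.left_commute)
  next
    case (Suc k)
    have "rGamma (real (Suc k) + \<alpha> + 1) \<le> rGamma (\<alpha> + 2)"
    proof (induction k)
      case (Suc k)
      have "rGamma (real (Suc k) + \<alpha> + 1) = (real (Suc k) + \<alpha> + 1) * rGamma (real (Suc (Suc k)) + \<alpha> + 1)"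
        using rGamma_plus1[of "real (Suc k) + \<alpha> + 1"] by (simp add: algebra_simps)
      moreover have "1 * rGamma (real (Suc (Suc k)) + \<alpha> + 1)
          \<le> (real (Suc k) + \<alpha> + 1) * rGamma (real (Suc (Suc k)) + \<alpha> + 1)"
        using assms pos[of "Suc (Suc k)"] by (intro mult_right_mono) auto
      ultimately show ?case using Suc by linarith
    qed (simp add: add.commute add.left_commute)
    then show ?thesis using pos[of 0] Suc by simp
  qed
qed

lemma rGamma_shift_rec:
  "rGamma (real m + \<alpha> + 1) = (real m + \<alpha> + 1) * rGamma (real (Suc m) + \<alpha> + 1)"
  using rGamma_plus1[of "real m + \<alpha> + 1"] by (simp add: algebra_simps)

text \<open>
  \<open>bessel_F \<alpha> j\<close> is the \<open>j\<close>-th derivative of the entire function \<open>bessel_F \<alpha> 0\<close>, for which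
  \<open>I\<^sub>\<alpha>(x) = (x/2)\<^sup>\<alpha> bessel_F \<alpha> 0 (x\<^sup>2/4)\<close>.
\<close>

definition bessel_F :: "real \<Rightarrow> nat \<Rightarrow> real \<Rightarrow> real" where
  "bessel_F \<alpha> j z = (\<Sum>i. rGamma (real (i + j) + \<alpha> + 1) / fact i * z ^ i)"

lemma summable_bessel_F_abs:
  assumes "\<alpha> > -1"
  shows "summable (\<lambda>i. \<bar>rGamma (real (i + j) + \<alpha> + 1) / fact i * z ^ i\<bar>)"
proof (rule summable_comparison_test')
  show "summable (\<lambda>i. bessel_bound \<alpha> * (inverse (fact i) * \<bar>z\<bar> ^ i))"
    using summable_exp[of "\<bar>z\<bar>"] by (intro summable_mult) 
  show "norm \<bar>rGamma (real (n + j) + \<alpha> + 1) / fact n * z ^ n\<bar>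
      \<le> bessel_bound \<alpha> * (inverse (fact n) * \<bar>z\<bar> ^ n)" for n
    using rGamma_shift_bounds[OF assms, of "n + j"]
    by (auto simp: abs_mult power_abs divide_inverse intro!: mult_right_mono)
qed

lemma summable_bessel_F:
  assumes "\<alpha> > -1"
  shows "summable (\<lambda>i. rGamma (real (i + j) + \<alpha> + 1) / fact i * z ^ i)"
  using summable_bessel_F_abs[OF assms, of j z] by (simp add: summable_rabs_cancel)

lemma bessel_F_sums:
  assumes "\<alpha> > -1"
  shows "(\<lambda>i. rGamma (real (i + j) + \<alpha> + 1) / fact i * z ^ i) sums bessel_F \<alpha> j z"
  unfolding bessel_F_def by (rule summable_sums[OF summable_bessel_F[OF assms]])

text \<open>The bound is the same for all derivatives \<open>j\<close>. This makes Taylor remainders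
  vanish and later supplies dominating functions.\<close>

lemma bessel_F_bound:
  assumes "\<alpha> > -1"
  shows "\<bar>bessel_F \<alpha> j z\<bar> \<le> bessel_bound \<alpha> * exp \<bar>z\<bar>"
proof -
  have "\<bar>bessel_F \<alpha> j z\<bar> \<le> (\<Sum>i. \<bar>rGamma (real (i + j) + \<alpha> + 1) / fact i * z ^ i\<bar>)"
    unfolding bessel_F_def by (rule summable_rabs[OF summable_bessel_F_abs[OF assms]])
  also have "\<dots> \<le> (\<Sum>i. bessel_bound \<alpha> * (inverse (fact i) * \<bar>z\<bar> ^ i))"
  proof (rule suminf_le[OF _ summable_bessel_F_abs[OF assms]])
    show "summable (\<lambda>i. bessel_bound \<alpha> * (inverse (fact i) * \<bar>z\<bar> ^ i))"
      using summable_exp[of "\<bar>z\<bar>"] by (intro summable_mult) 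
    show "\<bar>rGamma (real (n + j) + \<alpha> + 1) / fact n * z ^ n\<bar>
        \<le> bessel_bound \<alpha> * (inverse (fact n) * \<bar>z\<bar> ^ n)" for n
      using rGamma_shift_bounds[OF assms, of "n + j"]
      by (auto simp: abs_mult power_abs divide_inverse intro!: mult_right_mono)
  qed
  also have "\<dots> = bessel_bound \<alpha> * exp \<bar>z\<bar>"
    using summable_exp[of "\<bar>z\<bar>"] by (subst suminf_mult) (auto simp: exp_def scaleR_conv_of_real divide_inverse mult_ac)
  finally show ?thesis .
qed

lemma bessel_F_deriv:
  assumes "\<alpha> > -1"
  shows "(bessel_F \<alpha> j has_real_derivative bessel_F \<alpha> (Suc j) z) (at z)"
proof -
  let ?c = "\<lambda>i. rGamma (real (i + j) + \<alpha> + 1) / fact i :: real"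
  have "((\<lambda>z. \<Sum>i. ?c i * z ^ i) has_real_derivative (\<Sum>i. diffs ?c i * z ^ i)) (at z)"
    by (rule termdiffs_strong_converges_everywhere) (rule summable_bessel_F[OF assms])
  moreover have "diffs ?c = (\<lambda>i. rGamma (real (i + Suc j) + \<alpha> + 1) / fact i)"
  proof
    fix i
    have "Suc i + j = i + Suc j" by simp
    then show "diffs ?c i = rGamma (real (i + Suc j) + \<alpha> + 1) / fact i"
      unfolding diffs_def fact_Suc by (simp only: of_nat_fact of_nat_mult) (simp del: of_nat_Suc of_nat_add)
  qed
  ultimately show ?thesis by (simp only: bessel_F_def[abs_def])
qed

lemma bessel_F_continuous [continuous_intros]:
  assumes "\<alpha> > -1" "continuous_on S f"
  shows "continuous_on S (\<lambda>x. bessel_F \<alpha> j (f x))"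
proof -
  have "continuous_on UNIV (bessel_F \<alpha> j)"
    by (rule DERIV_continuous_on) (rule has_field_derivative_at_within[OF bessel_F_deriv[OF assms(1)]])
  from continuous_on_compose2[OF this assms(2)] show ?thesis by simp
qed

lemma bessel_F_measurable [measurable]:
  assumes "\<alpha> > -1"
  shows "bessel_F \<alpha> j \<in> borel_measurable borel"
  using bessel_F_continuous[OF assms continuous_on_id] by (intro borel_measurable_continuous_onI) simp

text \<open>Bessel's equation for the entire part, differentiated \<open>j\<close> times. On
  coefficients it is \<open>rGamma_shift_rec\<close>. It serves twice: as the differential equation
  behind the limit kernel, and to raise \<open>j\<close> when a weight is multiplied by its
  variable.\<close>

lemma bessel_F_rec:
  assumes "\<alpha> > -1"
  shows "z * bessel_F \<alpha> (j + 2) z + (\<alpha> + real j + 1) * bessel_F \<alpha> (j + 1) z = bessel_F \<alpha> j z"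
proof -
  let ?d = "\<lambda>m. rGamma (real m + \<alpha> + 1) :: real"
  have "(\<lambda>i. (?d (i + (j + 2)) / fact i * z ^ i) * z) sums (bessel_F \<alpha> (j + 2) z * z)"
    by (intro sums_mult2 bessel_F_sums assms)
  also have "(\<lambda>i. (?d (i + (j + 2)) / fact i * z ^ i) * z) = (\<lambda>i. real (Suc i) * ?d (Suc i + (j + 1)) / fact (Suc i) * z ^ (Suc i))"
  proof
    fix i
    have *: "i + (j + 2) = Suc i + (j + 1)" by simp
    have "real (Suc i) / fact (Suc i) = (1 / fact i :: real)"
      using fact_Suc[of i, where ?'a = real] by (simp del: of_nat_Suc)
    then show "?d (i + (j + 2)) / fact i * z ^ i * z = real (Suc i) * ?d (Suc i + (j + 1)) / fact (Suc i) * z ^ Suc i"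
    proof -
      assume h: "real (Suc i) / fact (Suc i) = (1 / fact i :: real)"
      have "real (Suc i) * D / fact (Suc i) * z ^ Suc i = (real (Suc i) / fact (Suc i)) * (D * z ^ i * z)" for D
        by (simp del: of_nat_Suc fact_Suc)
      then show ?thesis unfolding * h by simp
    qed
  qed
  \<comment> \<open>The factor \<open>real i\<close> kills the new term at \<open>i = 0\<close>, so
    the index shift leaves the sum unchanged.\<close>
  finally have 1: "(\<lambda>i. real i * ?d (i + (j + 1)) / fact i * z ^ i) sums (bessel_F \<alpha> (j + 2) z * z)"
    by (subst (asm) sums_Suc_iff) simp
  have "(\<lambda>i. real i * ?d (i + (j + 1)) / fact i * z ^ i + (\<alpha> + real j + 1) * (?d (i + (j + 1)) / fact i * z ^ i))
     sums (bessel_F \<alpha> (j + 2) z * z + (\<alpha> + real j + 1) * bessel_F \<alpha> (j + 1) z)"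
    by (intro sums_add 1 sums_mult bessel_F_sums assms)
  also have "(\<lambda>i. real i * ?d (i + (j + 1)) / fact i * z ^ i + (\<alpha> + real j + 1) * (?d (i + (j + 1)) / fact i * z ^ i))
    = (\<lambda>i. ?d (i + j) / fact i * z ^ i)"
  proof
    fix i
    have "?d (i + j) = (real (i + j) + \<alpha> + 1) * ?d (i + (j + 1))"
      using rGamma_shift_rec[of "i + j" \<alpha>] by simp
    then show "real i * ?d (i + (j + 1)) / fact i * z ^ i + (\<alpha> + real j + 1) * (?d (i + (j + 1)) / fact i * z ^ i) = ?d (i + j) / fact i * z ^ i"
      by (simp add: field_simps)
  qed
  finally show ?thesis
    using bessel_F_sums[OF assms, of j z] by (simp add: sums_iff mult.commute)
qed

text \<open>In the Lagrange remainder the derivative is bounded independently of its order, so the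
  factor \<open>h ^ n / fact n\<close> sends the remainder to 0 for every \<open>h\<close>.\<close>

lemma bessel_F_taylor:
  assumes "\<alpha> > -1"
  shows "(\<lambda>j. bessel_F \<alpha> j z / fact j * h ^ j) sums bessel_F \<alpha> 0 (z + h)"
proof -
  define C where "C = bessel_bound \<alpha> * exp (\<bar>z\<bar> + \<bar>h\<bar>)"
  have C0: "bessel_bound \<alpha> \<ge> 0"
    using rGamma_shift_bounds[OF assms, of 0] by simp
  have *: "\<bar>bessel_F \<alpha> 0 (z + h) - (\<Sum>m<n. bessel_F \<alpha> m z / fact m * h ^ m)\<bar> \<le> C * (inverse (fact n) * \<bar>h\<bar> ^ n)" for n
  proof -
    have "\<exists>t. \<bar>t\<bar> \<le> \<bar>h\<bar> \<and> bessel_F \<alpha> 0 (z + h) = (\<Sum>m<n. bessel_F \<alpha> m (z + 0) / fact m * h ^ m) + bessel_F \<alpha> n (z + t) / fact n * h ^ n"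
      by (rule Maclaurin_all_le[where diff = "\<lambda>m h. bessel_F \<alpha> m (z + h)"])
        (use bessel_F_deriv[OF assms] in \<open>simp_all add: DERIV_shift[symmetric] add.commute[of z]\<close>)
    then obtain t where t: "\<bar>t\<bar> \<le> \<bar>h\<bar>"
      "bessel_F \<alpha> 0 (z + h) = (\<Sum>m<n. bessel_F \<alpha> m z / fact m * h ^ m) + bessel_F \<alpha> n (z + t) / fact n * h ^ n"
      by auto
    have "\<bar>bessel_F \<alpha> n (z + t)\<bar> \<le> bessel_bound \<alpha> * exp \<bar>z + t\<bar>"
      by (rule bessel_F_bound[OF assms])
    also have "\<dots> \<le> C" unfolding C_def using t(1) C0 by (intro mult_left_mono) auto
    finally have "\<bar>bessel_F \<alpha> n (z + t)\<bar> * (inverse (fact n) * \<bar>h\<bar> ^ n) \<le> C * (inverse (fact n) * \<bar>h\<bar> ^ n)"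
      by (intro mult_right_mono) auto
    then show ?thesis using t(2) by (simp add: abs_mult power_abs divide_inverse mult_ac)
  qed
  have "(\<lambda>n. C * (inverse (fact n) * \<bar>h\<bar> ^ n)) \<longlonglongrightarrow> 0"
    using summable_LIMSEQ_zero[OF summable_exp[of "\<bar>h\<bar>"]] by (intro tendsto_mult_right_zero) 
  then have "(\<lambda>n. bessel_F \<alpha> 0 (z + h) - (\<Sum>m<n. bessel_F \<alpha> m z / fact m * h ^ m)) \<longlonglongrightarrow> 0"
    by (rule Lim_null_comparison[OF always_eventually, rotated]) (use * in simp)
  from tendsto_diff[OF tendsto_const[of "bessel_F \<alpha> 0 (z+h)"] this] show ?thesis
    by (simp add: sums_def)
qed

lemma bessel_J_eq:
  assumes "\<alpha> > -1" "x > 0"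
  shows "bessel_J \<alpha> x = (x / 2) powr \<alpha> * bessel_F \<alpha> 0 (- (x\<^sup>2 / 4))"
proof -
  have "(- 1) ^ k * rGamma (real k + \<alpha> + 1) / fact k * (x / 2) powr (2 * real k + \<alpha>)
     = (x / 2) powr \<alpha> * (rGamma (real (k + 0) + \<alpha> + 1) / fact k * (- (x\<^sup>2 / 4)) ^ k)" for k
  proof -
    have "(x / 2) powr (2 * real k + \<alpha>) = (x / 2) powr \<alpha> * ((x / 2)\<^sup>2) ^ k"
      using assms(2) powr_realpow[of "x/2" "2*k"] by (simp add: powr_add power_mult del: power_divide)
    moreover have "(- (x\<^sup>2 / 4)) ^ k = (-1) ^ k * ((x / 2)\<^sup>2) ^ k"
      unfolding power_mult_distrib[symmetric] by (simp add: power2_eq_square)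
    ultimately show ?thesis by simp
  qed
  then show ?thesis
    unfolding bessel_J_def bessel_F_def
    using summable_bessel_F[OF assms(1), of 0 "- (x\<^sup>2 / 4)"] by (simp only: suminf_mult)
qed

text \<open>Raising the order by \<open>j\<close> only shifts the index of \<open>rGamma\<close>,
  just as differentiating \<open>bessel_F\<close> does. Hence both weights come from one entire
  function and its derivative.\<close>

lemma bessel_I_eq:
  assumes "\<alpha> > -1" "x > 0"
  shows "bessel_I (\<alpha> + real j) x = (x / 2) powr (\<alpha> + real j) * bessel_F \<alpha> j (x\<^sup>2 / 4)"
proof -
  have "rGamma (real k + (\<alpha> + real j) + 1) / fact k * (x / 2) powr (2 * real k + (\<alpha> + real j))
     = (x / 2) powr (\<alpha> + real j) * (rGamma (real (k + j) + \<alpha> + 1) / fact k * (x\<^sup>2 / 4) ^ k)" for k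
  proof -
    have "(x / 2) powr (2 * real k + (\<alpha> + real j)) = (x / 2) powr (\<alpha> + real j) * ((x / 2)\<^sup>2) ^ k"
      using assms(2) powr_realpow[of "x/2" "2*k"] by (simp add: powr_add power_mult del: power_divide)
    moreover have "(x\<^sup>2 / 4) ^ k = ((x / 2)\<^sup>2) ^ k"
      by (simp add: power2_eq_square)
    moreover have "real k + (\<alpha> + real j) + 1 = real (k + j) + \<alpha> + 1" by simp
    ultimately show ?thesis by (simp only: mult_ac)
  qed
  then show ?thesis
    unfolding bessel_I_def bessel_F_def
    using summable_bessel_F[OF assms(1), of j "x\<^sup>2 / 4"] by (simp only: suminf_mult)
qed

section \<open>The biorthogonal system\<close>

abbreviation pos_lborel :: "real measure" where
  "pos_lborel \<equiv> restrict_space lborel {0<..}"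

abbreviation has_pos_integral :: "(real \<Rightarrow> 'a :: {banach, second_countable_topology}) \<Rightarrow> 'a \<Rightarrow> bool" where
  "has_pos_integral \<equiv> has_bochner_integral pos_lborel"

section \<open>Integrals over the positive half-line and Bessel moments\<close>

lemma has_bochner_integral_pos_lborelI:
  fixes f :: "real \<Rightarrow> real"
  assumes [measurable]: "f \<in> borel_measurable borel"
    and "\<And>x. x > 0 \<Longrightarrow> f x \<ge> 0" and "(f has_integral I) {0<..}"
  shows "has_pos_integral f I"
proof -
  have "f absolutely_integrable_on {0<..}"
    using assms by (intro nonnegative_absolutely_integrable_1) (auto simp: integrable_on_def)
  then have *: "set_integrable lborel {0<..} f"
    unfolding set_integrable_def by (subst (asm) integrable_completion) auto
  have "(LINT x:{0<..}|lborel. f x) = I"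
    using set_borel_integral_eq_integral(2)[OF *] assms(3) by (simp add: integral_unique)
  then show ?thesis
    using * unfolding set_integrable_def set_lebesgue_integral_def
    by (subst has_bochner_integral_restrict_space) (auto simp: has_bochner_integral_iff)
qed

lemma has_bochner_integral_Gamma:
  assumes "\<beta> > -1"
  shows "has_pos_integral (\<lambda>y. y powr \<beta> * exp (- y)) (Gamma (\<beta> + 1))"
proof (rule has_bochner_integral_pos_lborelI)
  have "((\<lambda>t. t powr \<beta> * exp (- t)) has_integral Gamma (\<beta> + 1)) {0..}"
    using Gamma_integral_real[of "\<beta> + 1"] assms by (simp add: exp_minus field_simps)
  then show "((\<lambda>t. t powr \<beta> * exp (- t)) has_integral Gamma (\<beta> + 1)) {0<..}"
    by (rule has_integral_spike_set_eq[THEN iffD1, rotated -1])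
      (auto intro!: negligible_subset[OF negligible_sing[of 0]])
qed auto

text \<open>Raising \<open>i\<close> by one multiplies the Pochhammer factor by at most
  \<open>1 + m / \<gamma>\<close>. The starting index of the ratio test is the one from which
  \<open>\<bar>s\<bar> * (1 + m / \<gamma>)\<close> is at most half of \<open>Suc i\<close>.\<close>

lemma summable_pochhammer_exp:
  assumes "\<gamma> > 0"
  shows "summable (\<lambda>i. s ^ i / fact i * pochhammer (real i + \<gamma>) m)"
proof -
  have "summable (\<lambda>i. \<bar>s\<bar> ^ i / fact i * pochhammer (real i + \<gamma>) m)"
  proof (rule summable_ratio_test[where c = "1/2" and N = "nat \<lceil>2 * \<bar>s\<bar> * (1 + real m / \<gamma>)\<rceil>"])
    fix i assume "i \<ge> nat \<lceil>2 * \<bar>s\<bar> * (1 + real m / \<gamma>)\<rceil>"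
    then have i: "2 * \<bar>s\<bar> * (1 + real m / \<gamma>) \<le> real i" by linarith
    have *: "pochhammer (real i + \<gamma>) m \<ge> 0" for i using assms by (intro pochhammer_nonneg) auto
    have a0: "real i + \<gamma> > 0" using assms by simp
    have "(real i + \<gamma>) * pochhammer (real i + \<gamma> + 1) m = (real i + \<gamma> + real m) * pochhammer (real i + \<gamma>) m"
      by (rule trans[OF pochhammer_rec[symmetric] pochhammer_rec'])
    also have "\<dots> \<le> ((real i + \<gamma>) * (1 + real m / \<gamma>)) * pochhammer (real i + \<gamma>) m"
    proof (intro mult_right_mono *)
      have "\<gamma> * (real m / \<gamma>) \<le> (real i + \<gamma>) * (real m / \<gamma>)"
        using assms by (intro mult_right_mono) auto
      then show "real i + \<gamma> + real m \<le> (real i + \<gamma>) * (1 + real m / \<gamma>)"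
        using assms by (simp add: distrib_left)
    qed
    finally have "(real i + \<gamma>) * pochhammer (real i + \<gamma> + 1) m \<le> (real i + \<gamma>) * ((1 + real m / \<gamma>) * pochhammer (real i + \<gamma>) m)"
      by (simp only: mult.assoc)
    then have 1: "pochhammer (real (Suc i) + \<gamma>) m \<le> (1 + real m / \<gamma>) * pochhammer (real i + \<gamma>) m"
      using a0 mult_le_cancel_left_pos[OF a0] by (simp only: of_nat_Suc add_ac)
    have "\<bar>s\<bar> * pochhammer (real (Suc i) + \<gamma>) m \<le> \<bar>s\<bar> * ((1 + real m / \<gamma>) * pochhammer (real i + \<gamma>) m)"
      by (intro mult_left_mono 1) auto
    also have "\<dots> \<le> (real (Suc i) / 2) * pochhammer (real i + \<gamma>) m"
    proof -
      have "\<bar>s\<bar> * (1 + real m / \<gamma>) \<le> real (Suc i) / 2" using i by (simp add: mult_ac)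
      then show ?thesis unfolding mult.assoc[symmetric] by (intro mult_right_mono *)
    qed
    finally have 2: "\<bar>s\<bar> * pochhammer (real (Suc i) + \<gamma>) m \<le> (real (Suc i) / 2) * pochhammer (real i + \<gamma>) m" .
    have "\<bar>s\<bar> ^ Suc i / fact (Suc i) * pochhammer (real (Suc i) + \<gamma>) m
       = (\<bar>s\<bar> ^ i / fact (Suc i)) * (\<bar>s\<bar> * pochhammer (real (Suc i) + \<gamma>) m)" by simp
    also have "\<dots> \<le> (\<bar>s\<bar> ^ i / fact (Suc i)) * ((real (Suc i) / 2) * pochhammer (real i + \<gamma>) m)"
      by (intro mult_left_mono 2) auto
    also have "\<dots> = 1 / 2 * (\<bar>s\<bar> ^ i / fact i * pochhammer (real i + \<gamma>) m)"
      unfolding fact_Suc by (simp del: of_nat_Suc)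
    finally show "norm (\<bar>s\<bar> ^ Suc i / fact (Suc i) * pochhammer (real (Suc i) + \<gamma>) m)
        \<le> 1 / 2 * norm (\<bar>s\<bar> ^ i / fact i * pochhammer (real i + \<gamma>) m)"
      using *[of "Suc i"] *[of i] by (simp add: abs_mult)
  qed auto
  moreover have "norm (s ^ i / fact i * pochhammer (real i + \<gamma>) m) = \<bar>s\<bar> ^ i / fact i * pochhammer (real i + \<gamma>) m" for i
    using pochhammer_nonneg[of "real i + \<gamma>" m] assms by (simp add: abs_mult power_abs)
  ultimately show ?thesis by (simp add: summable_norm_cancel)
qed

text \<open>Termwise integration: each power gives a Gamma value, which cancels the
  \<open>rGamma\<close> of its coefficient up to a Pochhammer symbol. The integrals of the norms
  form the same series at \<open>\<bar>s\<bar>\<close>, which justifies the interchange.\<close>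

lemma bessel_F_moment:
  assumes "\<alpha> > -1"
  shows "has_pos_integral
           (\<lambda>y. y powr \<alpha> * exp (- y) * (y ^ j * bessel_F \<alpha> j (s * y)) * y ^ m)
           (\<Sum>i. s ^ i / fact i * pochhammer (real (i + j) + \<alpha> + 1) m)"
proof -
  let ?d = "\<lambda>m. rGamma (real m + \<alpha> + 1) :: real"
  define f where "f = (\<lambda>i y. ?d (i + j) / fact i * s ^ i * (y powr (\<alpha> + real (i + j + m)) * exp (- y)))"
  have ev: "f i y = y powr \<alpha> * exp (- y) * y ^ j * y ^ m * (?d (i + j) / fact i * (s * y) ^ i)" if "y > 0" for i y
    unfolding f_def using that
    by (simp only: powr_add powr_realpow power_add power_mult_distrib) (simp add: mult_ac)
  have "has_pos_integral (f i) (?d (i + j) / fact i * s ^ i * Gamma (\<alpha> + real (i + j + m) + 1))" for i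
    unfolding f_def using assms by (intro has_bochner_integral_mult_right has_bochner_integral_Gamma) auto
  moreover have G: "?d (i + j) * Gamma (\<alpha> + real (i + j + m) + 1) = pochhammer (real (i + j) + \<alpha> + 1) m" for i
  proof -
    have "real (i + j) + \<alpha> + 1 > 0" using assms by auto
    then have "real (i + j) + \<alpha> + 1 \<notin> \<int>\<^sub>\<le>\<^sub>0" by (auto elim!: nonpos_Ints_cases)
    from pochhammer_Gamma[OF this, of m] show ?thesis
      by (simp add: rGamma_inverse_Gamma divide_inverse add_ac)
  qed
  ultimately have I: "has_pos_integral (f i) (s ^ i / fact i * pochhammer (real (i + j) + \<alpha> + 1) m)" for i
    by (simp add: mult_ac divide_inverse)
  have norm_f: "norm (f i y) = ?d (i + j) / fact i * \<bar>s\<bar> ^ i * (y powr (\<alpha> + real (i + j + m)) * exp (- y))" for i y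
    using rGamma_shift_bounds(1)[OF assms, of "i + j"] by (simp add: f_def abs_mult power_abs)
  have "has_pos_integral (\<lambda>y. norm (f i y)) (?d (i + j) / fact i * \<bar>s\<bar> ^ i * Gamma (\<alpha> + real (i + j + m) + 1))" for i
    unfolding norm_f using assms by (intro has_bochner_integral_mult_right has_bochner_integral_Gamma) auto
  then have IN: "has_pos_integral (\<lambda>y. norm (f i y)) (\<bar>s\<bar> ^ i / fact i * pochhammer (real (i + j) + \<alpha> + 1) m)" for i
    by (simp only: mult.assoc[symmetric] flip: G) (simp only: mult_ac divide_inverse)
  have sm: "summable (\<lambda>i. s ^ i / fact i * pochhammer (real (i + j) + \<alpha> + 1) m)" for s
    using summable_pochhammer_exp[of "real j + \<alpha> + 1" s m] assms by (simp add: add_ac)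
  have S: "(\<lambda>i. f i y) sums (y powr \<alpha> * exp (- y) * (y ^ j * bessel_F \<alpha> j (s * y)) * y ^ m)"
    and A: "summable (\<lambda>i. norm (f i y))" if "y > 0" for y
  proof -
    have "(\<lambda>i. f i y) sums (y powr \<alpha> * exp (- y) * y ^ j * y ^ m * bessel_F \<alpha> j (s * y))"
      unfolding ev[OF that] by (intro sums_mult bessel_F_sums assms)
    then show "(\<lambda>i. f i y) sums (y powr \<alpha> * exp (- y) * (y ^ j * bessel_F \<alpha> j (s * y)) * y ^ m)"
      by (simp add: mult_ac)
    show "summable (\<lambda>i. norm (f i y))"
      using summable_mult[OF summable_bessel_F_abs[OF assms, of j "s * y"], of "y powr \<alpha> * exp (- y) * y ^ j * y ^ m"] that
      unfolding ev[OF that] real_norm_def abs_mult[of "y powr \<alpha> * exp (- y) * y ^ j * y ^ m"]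
      by (simp add: abs_mult)
  qed
  have int: "\<And>i. integrable pos_lborel (f i)" using I by (simp add: has_bochner_integral_iff)
  have ae: "AE y in pos_lborel. summable (\<lambda>i. norm (f i y))"
    by (rule AE_I2) (simp add: A space_restrict_space del: real_norm_def)
  have su: "summable (\<lambda>i. \<integral>y. norm (f i y) \<partial>pos_lborel)"
    unfolding has_bochner_integral_integral_eq[OF IN] by (rule sm)
  have "has_pos_integral (\<lambda>y. \<Sum>i. f i y) (\<Sum>i. s ^ i / fact i * pochhammer (real (i + j) + \<alpha> + 1) m)"
    unfolding has_bochner_integral_iff
    by (intro conjI integrable_suminf[OF int ae su])
      (simp only: integral_suminf[OF int ae su] has_bochner_integral_integral_eq[OF I])
  then show ?thesis
  proof (rule has_bochner_integral_cong[THEN iffD1, rotated -1])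
    fix y assume "y \<in> space pos_lborel"
    then have "y > 0" by (simp add: space_restrict_space)
    from S[OF this] show "(\<Sum>i. f i y) = y powr \<alpha> * exp (- y) * (y ^ j * bessel_F \<alpha> j (s * y)) * y ^ m"
      by (rule sums_unique[symmetric])
  qed simp_all
qed

section \<open>Laguerre and Charlier identities\<close>

text \<open>The Chu-Vandermonde identity: reversing the order of the factors in
  \<open>pochhammer (c + real m) (l - m)\<close> turns it into a signed Pochhammer symbol with base
  \<open>1 - c - real l\<close>, independent of \<open>m\<close>.\<close>

lemma pochhammer_alternating_sum:
  fixes c x :: real
  shows "(\<Sum>m\<le>l. real (l choose m) * (- 1) ^ m * pochhammer (c + real m) (l - m) * pochhammer x m) = pochhammer (c - x) l"
proof -
  have "real (l choose m) * (- 1) ^ m * pochhammer (c + real m) (l - m) * pochhammer x m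
     = (-1) ^ l * (real (l choose m) * pochhammer x m * pochhammer (1 - c - real l) (l - m))" if "m \<le> l" for m
  proof -
    have "pochhammer (c + real m) (l - m) = (- 1) ^ (l - m) * pochhammer (1 - c - real l) (l - m)"
      using pochhammer_minus'[of "c + real l - 1" "l - m"] that by (simp add: of_nat_diff algebra_simps)
    moreover have "(- 1) ^ l = ((- 1) ^ m * (- 1) ^ (l - m) :: real)"
      using that by (simp flip: power_add)
    ultimately show ?thesis by simp
  qed
  then have "(\<Sum>m\<le>l. real (l choose m) * (- 1) ^ m * pochhammer (c + real m) (l - m) * pochhammer x m)
     = (-1) ^ l * pochhammer (x + (1 - c - real l)) l"
    unfolding pochhammer_binomial_sum sum_distrib_left by (intro sum.cong) auto
  also have "\<dots> = pochhammer (c - x) l"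
    using pochhammer_minus'[of "c + real l - 1 - x" "l"] by (simp add: algebra_simps)
  finally show ?thesis .
qed

lemma pochhammer_neg_of_nat:
  "pochhammer (- real i) m = (- 1) ^ m * (fact m * real (i choose m))"
  using gbinomial_pochhammer[of "real i" m] by (simp add: binomial_gbinomial field_simps)

text \<open>The terms with \<open>i < m\<close> vanish, and the rest is the exponential series
  shifted by \<open>m\<close>.\<close>

lemma falling_factorial_exp_sums:
  "(\<lambda>i. s ^ i / fact i * (fact m * real (i choose m))) sums (s ^ m * exp s :: real)"
proof -
  have "(\<lambda>i. s ^ m * (s ^ i /\<^sub>R fact i)) sums (s ^ m * exp s)"
    by (intro sums_mult exp_converges)
  also have "(\<lambda>i. s ^ m * (s ^ i /\<^sub>R fact i)) = (\<lambda>i. s ^ (i + m) / fact (i + m) * (fact m * real (i + m choose m)))"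
  proof
    fix i
    have "real (i + m choose m) = fact (i + m) / (fact m * fact i)"
      using binomial_fact[of m "i + m", where ?'a = real] by simp
    then show "s ^ m * (s ^ i /\<^sub>R fact i) = s ^ (i + m) / fact (i + m) * (fact m * real (i + m choose m))"
      by (simp add: power_add field_simps)
  qed
  finally show ?thesis
    by (subst (asm) sums_zero_iff_shift) (simp_all add: binomial_eq_0)
qed

text \<open>
  \<open>P\<^sub>k = \<Sum>\<^sub>l (k choose l) A\<^sup>k\<^sup>-\<^sup>l l! L\<^sub>l\<close> with the Laguerre polynomials \<open>L\<^sub>l\<close> of parameter \<open>\<alpha>\<close>.
\<close>

definition laguerre_q :: "real \<Rightarrow> nat \<Rightarrow> real \<Rightarrow> real" where
  "laguerre_q \<alpha> l s = (\<Sum>m\<le>l. real (l choose m) * pochhammer (\<alpha> + 1 + real m) (l - m) * s ^ m)"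

definition dual_P :: "real \<Rightarrow> real \<Rightarrow> nat \<Rightarrow> real \<Rightarrow> real" where
  "dual_P \<alpha> A k x = (\<Sum>l\<le>k. real (k choose l) * A ^ (k - l) * laguerre_q \<alpha> l (- x))"

text \<open>The rising factorial is expanded in falling factorials of \<open>i\<close>, whose
  exponential sums are known. The expansion coefficients are those of
  \<open>laguerre_q\<close>.\<close>

lemma pochhammer_exp_sums:
  "(\<lambda>i. s ^ i / fact i * pochhammer (real i + \<alpha> + 1) l) sums (exp s * laguerre_q \<alpha> l s)"
proof -
  have "(\<lambda>i. \<Sum>m\<le>l. real (l choose m) * pochhammer (\<alpha> + 1 + real m) (l - m) * (s ^ i / fact i * (fact m * real (i choose m))))
     sums (\<Sum>m\<le>l. real (l choose m) * pochhammer (\<alpha> + 1 + real m) (l - m) * (s ^ m * exp s))"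
    by (intro sums_sum sums_mult falling_factorial_exp_sums)
  also have "(\<lambda>i. \<Sum>m\<le>l. real (l choose m) * pochhammer (\<alpha> + 1 + real m) (l - m) * (s ^ i / fact i * (fact m * real (i choose m))))
    = (\<lambda>i. s ^ i / fact i * pochhammer (real i + \<alpha> + 1) l)"
  proof
    fix i
    have "pochhammer (real i + \<alpha> + 1) l = pochhammer (\<alpha> + 1 - (- real i)) l" by (simp add: algebra_simps)
    also have "\<dots> = (\<Sum>m\<le>l. real (l choose m) * (- 1) ^ m * pochhammer (\<alpha> + 1 + real m) (l - m) * pochhammer (- real i) m)"
      by (rule pochhammer_alternating_sum[symmetric])
    also have "\<dots> = (\<Sum>m\<le>l. real (l choose m) * pochhammer (\<alpha> + 1 + real m) (l - m) * (fact m * real (i choose m)))"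
      by (simp add: pochhammer_neg_of_nat mult_ac flip: power_mult_distrib power_add)
    finally show "(\<Sum>m\<le>l. real (l choose m) * pochhammer (\<alpha> + 1 + real m) (l - m) * (s ^ i / fact i * (fact m * real (i choose m))))
       = s ^ i / fact i * pochhammer (real i + \<alpha> + 1) l"
      by (simp add: sum_distrib_left mult_ac)
  qed
  finally show ?thesis by (simp add: laguerre_q_def sum_distrib_left mult_ac)
qed

text \<open>The binomial theorem splits \<open>(u + A) ^ k\<close> into moments of
  \<open>bessel_F\<close>. In this form \<open>k\<close> occurs only as an exponent, so that the
  kernel sum over \<open>k\<close> can be carried out under the integral.\<close>

lemma dual_P_integral:
  assumes "\<alpha> > -1"
  shows "has_pos_integral
           (\<lambda>u. u powr \<alpha> * exp (- u) * (u + A) ^ k * bessel_F \<alpha> 0 (- x * u)) (exp (- x) * dual_P \<alpha> A k x)"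
proof -
  have "has_pos_integral
     (\<lambda>u. \<Sum>l\<le>k. real (k choose l) * A ^ (k - l) * (u powr \<alpha> * exp (- u) * (u ^ 0 * bessel_F \<alpha> 0 (- x * u)) * u ^ l))
     (\<Sum>l\<le>k. real (k choose l) * A ^ (k - l) * (exp (- x) * laguerre_q \<alpha> l (- x)))"
  proof (intro has_bochner_integral_sum has_bochner_integral_mult_right)
    fix l
    have "(\<Sum>i. (- x) ^ i / fact i * pochhammer (real (i + 0) + \<alpha> + 1) l) = exp (- x) * laguerre_q \<alpha> l (- x)"
      using pochhammer_exp_sums[of "- x" \<alpha> l] by (simp add: sums_iff)
    then show "has_pos_integral (\<lambda>u. u powr \<alpha> * exp (- u) * (u ^ 0 * bessel_F \<alpha> 0 (- x * u)) * u ^ l)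
       (exp (- x) * laguerre_q \<alpha> l (- x))"
      using bessel_F_moment[OF assms, of 0 "- x" l] by (simp only:)
  qed
  also have "(\<lambda>u. \<Sum>l\<le>k. real (k choose l) * A ^ (k - l) * (u powr \<alpha> * exp (- u) * (u ^ 0 * bessel_F \<alpha> 0 (- x * u)) * u ^ l))
     = (\<lambda>u. u powr \<alpha> * exp (- u) * (u + A) ^ k * bessel_F \<alpha> 0 (- x * u))"
    by (simp add: binomial_ring sum_distrib_left sum_distrib_right mult_ac fun_eq_iff)
  finally show ?thesis by (simp add: dual_P_def sum_distrib_left mult_ac)
qed

text \<open>For nonzero \<open>A\<close> this is \<open>A ^ k\<close> times the classical Charlier
  polynomial of degree \<open>k\<close> with parameter \<open>A\<close> at the point
  \<open>i\<close>, orthogonal for Poisson weights.\<close>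

definition charlier :: "real \<Rightarrow> nat \<Rightarrow> nat \<Rightarrow> real" where
  "charlier A k i = (\<Sum>l\<le>k. real (k choose l) * A ^ (k - l) * ((- 1) ^ l * (fact l * real (i choose l))))"

text \<open>Pascal's rule splits the sum, and a falling factorial of \<open>i\<close> of length
  \<open>Suc l\<close> is \<open>i\<close> times one of \<open>i - 1\<close>. At
  \<open>i = 0\<close> the truncated \<open>i - 1\<close> is harmless because of the factor
  \<open>i\<close>.\<close>

lemma charlier_Suc: "charlier A (Suc k) i = A * charlier A k i - real i * charlier A k (i - 1)"
proof -
  let ?a = "\<lambda>l i. (- 1) ^ l * (fact l * real (i choose l)) :: real"
  have a: "?a (Suc l) i = - real i * ?a l (i - 1)" for l
  proof (cases i)
    case (Suc i')
    have r: "real (Suc l) * real (Suc i' choose Suc l) = real (Suc i') * real (i' choose l)"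
      unfolding of_nat_mult[symmetric] Suc_times_binomial ..
    have "?a (Suc l) i = - ((- 1) ^ l * fact l * (real (Suc l) * real (Suc i' choose Suc l)))"
      unfolding Suc fact_Suc by (simp del: of_nat_Suc binomial_Suc_Suc)
    also have "\<dots> = - real i * ?a l (i - 1)"
      unfolding r unfolding Suc by (simp del: of_nat_Suc)
    finally show ?thesis .
  qed simp
  have "charlier A (Suc k) i = A ^ Suc k + (\<Sum>l\<le>k. real (Suc k choose Suc l) * A ^ (k - l) * ?a (Suc l) i)"
    unfolding charlier_def by (subst sum.atMost_Suc_shift) simp
  also have "(\<Sum>l\<le>k. real (Suc k choose Suc l) * A ^ (k - l) * ?a (Suc l) i)
     = (\<Sum>l\<le>k. real (k choose Suc l) * A ^ (k - l) * ?a (Suc l) i) + (\<Sum>l\<le>k. real (k choose l) * A ^ (k - l) * ?a (Suc l) i)"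
    by (simp only: binomial_Suc_Suc of_nat_add distrib_right sum.distrib)
  also have "(\<Sum>l\<le>k. real (k choose l) * A ^ (k - l) * ?a (Suc l) i) = - real i * charlier A k (i - 1)"
    unfolding a charlier_def sum_distrib_left by (intro sum.cong) auto
  also have "(\<Sum>l\<le>k. real (k choose Suc l) * A ^ (k - l) * ?a (Suc l) i) + A ^ Suc k
     = (\<Sum>l\<le>Suc k. real (k choose l) * A ^ (Suc k - l) * ?a l i)"
    by (subst sum.atMost_Suc_shift) simp
  moreover have "(\<Sum>l\<le>Suc k. real (k choose l) * A ^ (Suc k - l) * ?a l i) = A * charlier A k i"
    unfolding charlier_def sum_distrib_left by (simp add: Suc_diff_le mult_ac)
  ultimately show ?thesis by simp
qed

text \<open>Summing \<open>charlier_Suc\<close> against \<open>A ^ i / fact i\<close>: since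
  \<open>i * A ^ i / fact i\<close> is \<open>A\<close> times the preceding weight, the term with
  \<open>A\<close> cancels the part of \<open>i + j\<close> that comes from \<open>i\<close>. Only
  the part from \<open>j\<close> remains, which leaves a recursion lowering \<open>k\<close> and
  \<open>j\<close> together.\<close>

lemma charlier_sums:
  "(\<lambda>i. A ^ i / fact i * charlier A k (i + j)) sums (exp A * ((- 1) ^ k * (fact k * real (j choose k))))"
proof (induction k arbitrary: j)
  case 0
  have "(\<lambda>i. A ^ i / fact i) sums exp A" using exp_converges[of A] by (simp add: field_simps)
  then show ?case by (simp add: charlier_def)
next
  case (Suc k)
  let ?t = "\<lambda>j. exp A * ((- 1) ^ k * (fact k * real (j choose k)))"
  have 1: "(\<lambda>i. A * (A ^ i / fact i * charlier A k (i + j))) sums (A * ?t j)"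
    by (intro sums_mult Suc.IH)
  have "(\<lambda>i. real (Suc i) * A ^ (Suc i) / fact (Suc i) * charlier A k (Suc i + j - 1)) sums (A * ?t j)"
    using 1 by (simp add: fact_Suc mult.assoc del: of_nat_Suc)
  then have 2: "(\<lambda>i. real i * A ^ i / fact i * charlier A k (i + j - 1)) sums (A * ?t j)"
    by (subst (asm) sums_Suc_iff) simp
  have 3: "(\<lambda>i. real j * (A ^ i / fact i * charlier A k (i + j - 1))) sums (real j * ?t (j - 1))"
  proof (cases j)
    case (Suc j')
    then show ?thesis using sums_mult[OF Suc.IH[of j'], of "real j"] by simp
  qed simp
  have r: "real j * real (j - 1 choose k) = real (Suc k) * real (j choose Suc k)"
  proof (cases j)
    case (Suc i')
    show ?thesis unfolding of_nat_mult[symmetric] Suc Suc_times_binomial diff_Suc_1 ..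
  qed simp
  have "(\<lambda>i. A * (A ^ i / fact i * charlier A k (i + j)) - real i * A ^ i / fact i * charlier A k (i + j - 1)
      - real j * (A ^ i / fact i * charlier A k (i + j - 1))) sums (A * ?t j - A * ?t j - real j * ?t (j - 1))"
    by (intro sums_diff 1 2 3)
  also have "(\<lambda>i. A * (A ^ i / fact i * charlier A k (i + j)) - real i * A ^ i / fact i * charlier A k (i + j - 1)
      - real j * (A ^ i / fact i * charlier A k (i + j - 1))) = (\<lambda>i. A ^ i / fact i * charlier A (Suc k) (i + j))"
    unfolding charlier_Suc by (simp add: fun_eq_iff algebra_simps add_divide_distrib)
  also have "A * ?t j - A * ?t j - real j * ?t (j - 1) = exp A * ((- 1) ^ Suc k * fact k * (- real j * real (j - 1 choose k)) * - 1)"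
    by simp
  also have "\<dots> = exp A * ((- 1) ^ Suc k * (fact (Suc k) * real (j choose Suc k)))"
    using r by (simp add: fact_Suc del: of_nat_Suc)
  finally show ?case .
qed

text \<open>The biorthogonality behind the whole computation: the value is 0 for
  \<open>j < k\<close> and nonzero for \<open>j = k\<close>. Moments turn the Laguerre sums into
  Charlier values, which are then summed with Poisson weights.\<close>

lemma dual_P_moment:
  assumes "\<alpha> > -1"
  shows "has_pos_integral
           (\<lambda>y. y powr \<alpha> * exp (- y) * (y ^ j * bessel_F \<alpha> j (A * y)) * dual_P \<alpha> A k y)
           (exp A * ((- 1) ^ k * (fact k * real (j choose k))))"
proof -
  let ?w = "\<lambda>y. y powr \<alpha> * exp (- y) * (y ^ j * bessel_F \<alpha> j (A * y))"
  let ?c = "\<lambda>l m. real (k choose l) * A ^ (k - l) * (real (l choose m) * pochhammer (\<alpha> + 1 + real m) (l - m) * (- 1) ^ m)"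
  let ?g = "\<lambda>i m. A ^ i / fact i * pochhammer (real (i + j) + \<alpha> + 1) m"
  have "has_pos_integral
     (\<lambda>y. \<Sum>l\<le>k. \<Sum>m\<le>l. ?c l m * (?w y * y ^ m))
     (\<Sum>l\<le>k. \<Sum>m\<le>l. ?c l m * (\<Sum>i. ?g i m))"
    by (intro has_bochner_integral_sum has_bochner_integral_mult_right bessel_F_moment assms)
  also have "(\<lambda>y. \<Sum>l\<le>k. \<Sum>m\<le>l. ?c l m * (?w y * y ^ m))
    = (\<lambda>y. ?w y * dual_P \<alpha> A k y)"
  proof (rule ext)
    fix y :: real
    show "(\<Sum>l\<le>k. \<Sum>m\<le>l. ?c l m * (?w y * y ^ m))
      = ?w y * dual_P \<alpha> A k y"
      unfolding dual_P_def laguerre_q_def sum_distrib_left power_minus[of y]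
      by (intro sum.cong refl) (simp only: mult_ac)
  qed
  also have "(\<Sum>l\<le>k. \<Sum>m\<le>l. ?c l m * (\<Sum>i. ?g i m)) = exp A * ((- 1) ^ k * (fact k * real (j choose k)))"
  proof -
    have "summable (\<lambda>i. ?g i m)" for m
      using summable_pochhammer_exp[of "real j + \<alpha> + 1" A m] assms by (simp add: add_ac)
    then have "(\<lambda>i. \<Sum>l\<le>k. \<Sum>m\<le>l. ?c l m * ?g i m) sums (\<Sum>l\<le>k. \<Sum>m\<le>l. ?c l m * (\<Sum>i. ?g i m))"
      by (intro sums_sum sums_mult summable_sums)
    moreover have "(\<Sum>l\<le>k. \<Sum>m\<le>l. ?c l m * ?g i m) = A ^ i / fact i * charlier A k (i + j)" for i
    proof -
      have "(\<Sum>m\<le>l. ?c l m * ?g i m) = A ^ i / fact i * (real (k choose l) * A ^ (k - l) * ((- 1) ^ l * (fact l * real (i + j choose l))))" for l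
      proof -
        have "(\<Sum>m\<le>l. ?c l m * ?g i m) = A ^ i / fact i * (real (k choose l) * A ^ (k - l) *
           (\<Sum>m\<le>l. real (l choose m) * (- 1) ^ m * pochhammer (\<alpha> + 1 + real m) (l - m) * pochhammer (real (i + j) + \<alpha> + 1) m))"
          by (simp only: sum_distrib_left mult_ac)
        \<comment> \<open>The two bases differ by exactly \<open>- (i + j)\<close>, so
          \<open>\<alpha>\<close> drops out and a falling factorial of \<open>i + j\<close> is
          left.\<close>
        also have "(\<Sum>m\<le>l. real (l choose m) * (- 1) ^ m * pochhammer (\<alpha> + 1 + real m) (l - m) * pochhammer (real (i + j) + \<alpha> + 1) m)
          = pochhammer (- real (i + j)) l"
          unfolding pochhammer_alternating_sum by (simp add: algebra_simps)
        finally show ?thesis by (simp only: pochhammer_neg_of_nat)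
      qed
      then show ?thesis by (simp only: charlier_def sum_distrib_left)
    qed
    ultimately show ?thesis using charlier_sums[of A k j] by (simp add: sums_iff)
  qed
  finally show ?thesis .
qed

section \<open>The kernel determined by its reproducing property\<close>

text \<open>Binomial inversion. The product \<open>(i choose k) * (k choose j)\<close> equals
  \<open>(i choose j) * (i - j choose (k - j))\<close>, and the alternating sum of a row of Pascal's
  triangle vanishes unless \<open>i = j\<close>.\<close>

lemma alternating_choose_orthogonal:
  assumes "i < n"
  shows "(\<Sum>k<n. (- 1) ^ k * real (i choose k) * real (k choose j)) = (if i = j then (- 1) ^ j else 0)"
proof -
  have "(\<Sum>k<n. (- 1) ^ k * real (i choose k) * real (k choose j))
      = (\<Sum>k\<in>{j..i}. (- 1) ^ k * real (i choose k) * real (k choose j))"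
    using assms by (intro sum.mono_neutral_right) (auto simp: binomial_eq_0 not_le)
  also have "\<dots> = (if i = j then (- 1) ^ j else 0)"
  proof (cases "j \<le> i")
    case True
    have "(\<Sum>k\<in>{j..i}. (- 1) ^ k * real (i choose k) * real (k choose j))
        = (\<Sum>m\<le>i - j. (- 1) ^ j * real (i choose j) * ((- 1) ^ m * real (i - j choose m)))"
    proof (rule sum.reindex_bij_witness[where i = "\<lambda>m. m + j" and j = "\<lambda>k. k - j"])
      fix k assume k: "k \<in> {j..i}"
      then have "(i choose k) * (k choose j) = (i choose j) * (i - j choose (k - j))"
        by (intro choose_mult) auto
      then have "real (i choose k) * real (k choose j) = real (i choose j) * real (i - j choose (k - j))"
        by (simp only: of_nat_mult[symmetric])
      moreover have "(- 1) ^ k = (- 1) ^ j * (- 1 :: real) ^ (k - j)"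
        using k by (simp flip: power_add)
      ultimately show "(- 1) ^ j * real (i choose j) * ((- 1) ^ (k - j) * real (i - j choose (k - j)))
          = (- 1) ^ k * real (i choose k) * real (k choose j)"
        by (simp only: mult.assoc) (simp only: mult.left_commute)
    qed (use True in auto)
    also have "\<dots> = (- 1) ^ j * real (i choose j) * (\<Sum>m\<le>i - j. (- 1) ^ m * real (i - j choose m))"
      by (simp only: sum_distrib_left)
    also have "\<dots> = (if i = j then (- 1) ^ j else 0)"
      using choose_alternating_sum[of "i - j", where ?'a = real] True by auto
    finally show ?thesis .
  qed auto
  finally show ?thesis .
qed

text \<open>
  The dual system to the polynomials \<open>dual_P\<close>: \<open>dual_Q \<alpha> A k (y)\<close> is the coefficient of \<open>w\<^sup>k\<close> in
  \<open>y\<^sup>\<alpha> e\<^sup>-\<^sup>y e\<^sup>w\<^sup>-\<^sup>A bessel_F \<alpha> 0 (y (A - w))\<close>.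
\<close>

definition dual_Q :: "real \<Rightarrow> real \<Rightarrow> nat \<Rightarrow> real \<Rightarrow> real" where
  "dual_Q \<alpha> A k y = exp (- A) * (y powr \<alpha> * exp (- y)) / fact k *
     (\<Sum>j\<le>k. real (k choose j) * (- y) ^ j * bessel_F \<alpha> j (A * y))"

definition dual_kernel :: "real \<Rightarrow> real \<Rightarrow> nat \<Rightarrow> real \<Rightarrow> real \<Rightarrow> real" where
  "dual_kernel \<alpha> A n x y = (\<Sum>k<n. dual_P \<alpha> A k x * dual_Q \<alpha> A k y)"

lemma has_bochner_integral_pos_lborel_scale:
  fixes f :: "real \<Rightarrow> 'a :: {banach, second_countable_topology}"
  assumes "has_pos_integral f I" "b > 0"
  shows "has_pos_integral (\<lambda>y. f (b * y)) (I /\<^sub>R b)"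
proof -
  have "has_bochner_integral lborel (\<lambda>x. indicator {0<..} (0 + b * x) *\<^sub>R f (0 + b * x)) (I /\<^sub>R \<bar>b\<bar>)"
    using assms by (subst lborel_has_bochner_integral_real_affine_iff[symmetric])
      (auto simp: has_bochner_integral_restrict_space)
  moreover have "indicator {0<..} (0 + b * x) = (indicator {0<..} x :: real)" for x
    using assms(2) by (auto simp: indicator_def zero_less_mult_iff)
  ultimately show ?thesis
    using assms(2) by (simp add: has_bochner_integral_restrict_space)
qed

text \<open>Testing against \<open>n\<close> polynomials gives \<open>n\<close> equations for the
  \<open>n\<close> coefficients \<open>c j\<close>. The system is not solved for \<open>c\<close>:
  the equations are inserted into the claimed sum, and binomial inversion contracts it back to
  \<open>K y\<close>. The factor \<open>b\<close> is the Jacobian of the scaling.\<close>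

lemma dual_kernel_unique:
  fixes K :: "real \<Rightarrow> complex" and c :: "nat \<Rightarrow> complex"
  assumes \<alpha>: "\<alpha> > -1" and b: "b > 0"
    and K: "\<And>y. y > 0 \<Longrightarrow> K y = (\<Sum>j<n. c j * of_real ((b * y) powr \<alpha> * exp (- (b * y)) * ((b * y) ^ j * bessel_F \<alpha> j (A * (b * y)))))"
    and rep: "\<And>k. k < n \<Longrightarrow> (\<integral>y. K y * of_real (dual_P \<alpha> A k (b * y)) \<partial>pos_lborel) = of_real (dual_P \<alpha> A k x)"
    and y: "y > 0"
  shows "K y = of_real (b * (\<Sum>k<n. dual_P \<alpha> A k x * dual_Q \<alpha> A k (b * y)))"
proof -
  let ?m = "\<lambda>i k. exp A * ((- 1) ^ k * (fact k * real (i choose k)))"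
  let ?s = "\<lambda>i k j. (- 1) ^ k * real (i choose k) * real (k choose j)"
  let ?g = "\<lambda>j y. y powr \<alpha> * exp (- y) * (y ^ j * bessel_F \<alpha> j (A * y))"
  have mom: "of_real (b * dual_P \<alpha> A k x) = (\<Sum>i<n. c i * of_real (?m i k))" if "k < n" for k
  proof -
    have "has_pos_integral (\<lambda>y. \<Sum>i<n. c i * of_real (?g i (b * y) * dual_P \<alpha> A k (b * y)))
       (\<Sum>i<n. c i * of_real (?m i k /\<^sub>R b))"
      by (intro has_bochner_integral_sum has_bochner_integral_mult_right has_bochner_integral_of_real
          has_bochner_integral_pos_lborel_scale[where f = "\<lambda>y. ?g _ y * dual_P \<alpha> A k y"] dual_P_moment \<alpha> b)
    then have "(\<integral>y. (\<Sum>i<n. c i * of_real (?g i (b * y) * dual_P \<alpha> A k (b * y))) \<partial>pos_lborel)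
       = (\<Sum>i<n. c i * of_real (?m i k /\<^sub>R b))"
      by (rule has_bochner_integral_integral_eq)
    also have "(\<integral>y. (\<Sum>i<n. c i * of_real (?g i (b * y) * dual_P \<alpha> A k (b * y))) \<partial>pos_lborel)
       = (\<integral>y. K y * of_real (dual_P \<alpha> A k (b * y)) \<partial>pos_lborel)"
    proof (rule Bochner_Integration.integral_cong[OF refl])
      fix y assume "y \<in> space pos_lborel"
      then have "y > 0" by (simp add: space_restrict_space)
      then show "(\<Sum>i<n. c i * of_real (?g i (b * y) * dual_P \<alpha> A k (b * y))) = K y * of_real (dual_P \<alpha> A k (b * y))"
        by (subst K) (auto simp only: sum_distrib_right of_real_mult mult.assoc)
    qed
    finally have "of_real (dual_P \<alpha> A k x) = (\<Sum>i<n. c i * of_real (?m i k /\<^sub>R b))"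
      using rep[OF that] by simp
    then have "of_real b * of_real (dual_P \<alpha> A k x) = (\<Sum>i<n. of_real b * (c i * of_real (?m i k /\<^sub>R b)))"
      by (simp only: sum_distrib_left)
    also have "\<dots> = (\<Sum>i<n. c i * of_real (?m i k))"
      using b by (intro sum.cong) auto
    finally show ?thesis by simp
  qed
  \<comment> \<open>The factors \<open>exp (- A)\<close> and \<open>fact k\<close> of
    \<open>dual_Q\<close> cancel those of the moment. The inner sum may run to \<open>n\<close>
    since \<open>k choose j\<close> vanishes for \<open>j > k\<close>.\<close>
  have Q: "of_real (?m i k) * of_real (dual_Q \<alpha> A k z)
     = (\<Sum>j<n. complex_of_real ((?s i k j) * ((- 1) ^ j * ?g j z)))" if "k < n" for k i z
  proof -
    have "?m i k * dual_Q \<alpha> A k z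
      = (exp A * exp (- A)) * ((- 1) ^ k * real (i choose k) * (z powr \<alpha> * exp (- z)) * (\<Sum>j\<le>k. real (k choose j) * (- z) ^ j * bessel_F \<alpha> j (A * z)))"
      by (simp add: dual_Q_def)
    also have "\<dots> = (\<Sum>j\<le>k. (?s i k j) * ((- 1) ^ j * ?g j z))"
      unfolding power_minus[of z] sum_distrib_left exp_minus_inverse
      by (intro sum.cong refl) (simp only: mult_ac mult_1_left)
    also have "\<dots> = (\<Sum>j<n. (?s i k j) * ((- 1) ^ j * ?g j z))"
      using that by (intro sum.mono_neutral_left) (auto simp: binomial_eq_0 not_le)
    finally show ?thesis by (simp only: of_real_mult[symmetric] of_real_sum[symmetric])
  qed
  define z where "z = b * y"
  have "complex_of_real (b * (\<Sum>k<n. dual_P \<alpha> A k x * dual_Q \<alpha> A k z)) = (\<Sum>k<n. of_real (b * dual_P \<alpha> A k x) * of_real (dual_Q \<alpha> A k z))"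
    by (simp add: sum_distrib_left mult_ac)
  also have "\<dots> = (\<Sum>k<n. \<Sum>i<n. c i * (of_real (?m i k) * of_real (dual_Q \<alpha> A k z)))"
  proof (rule sum.cong[OF refl])
    fix k assume "k \<in> {..<n}"
    then have "k < n" by simp
    show "of_real (b * dual_P \<alpha> A k x) * of_real (dual_Q \<alpha> A k z) = (\<Sum>i<n. c i * (of_real (?m i k) * of_real (dual_Q \<alpha> A k z)))"
      unfolding mom[OF \<open>k < n\<close>] sum_distrib_right by (simp only: mult.assoc)
  qed
  also have "\<dots> = (\<Sum>k<n. \<Sum>i<n. c i * (\<Sum>j<n. complex_of_real ((?s i k j) * ((- 1) ^ j * ?g j z))))"
    by (intro sum.cong refl) (simp only: Q lessThan_iff)
  also have "\<dots> = (\<Sum>i<n. c i * (\<Sum>k<n. \<Sum>j<n. complex_of_real ((?s i k j) * ((- 1) ^ j * ?g j z))))"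
    by (subst sum.swap) (simp only: sum_distrib_left)
  also have "\<dots> = (\<Sum>i<n. c i * (\<Sum>j<n. complex_of_real ((\<Sum>k<n. ?s i k j) * ((- 1) ^ j * ?g j z))))"
    unfolding sum_distrib_right of_real_sum by (subst sum.swap) (rule refl)
  also have "\<dots> = (\<Sum>i<n. c i * of_real (?g i z))"
  proof (intro sum.cong refl arg_cong2[where f = "(*)"])
    fix i assume "i \<in> {..<n}"
    then have i: "i < n" by simp
    have "(\<Sum>j<n. complex_of_real ((\<Sum>k<n. ?s i k j) * ((- 1) ^ j * ?g j z)))
       = (\<Sum>j<n. if j = i then complex_of_real ((- 1) ^ i * ((- 1) ^ i * ?g i z)) else 0)"
      using alternating_choose_orthogonal[OF i] by (intro sum.cong refl) auto
    also have "\<dots> = of_real (?g i z)"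
      using i by (simp flip: power_mult_distrib mult.assoc)
    finally show "(\<Sum>j<n. complex_of_real ((\<Sum>k<n. ?s i k j) * ((- 1) ^ j * ?g j z)))
       = of_real (?g i z)" .
  qed
  also have "\<dots> = K y" unfolding z_def using K[OF y] by simp
  finally show ?thesis unfolding z_def by simp
qed

section \<open>Asymptotics of the dual kernel\<close>

definition poisson_cdf :: "nat \<Rightarrow> real \<Rightarrow> real" where
  "poisson_cdf m \<mu> = exp (- \<mu>) * (\<Sum>i<m. \<mu> ^ i / fact i)"

lemma sums_exp_real: "(\<lambda>i. x ^ i / fact i) sums exp (x :: real)"
  using exp_converges[of x] by (simp add: divide_inverse mult.commute)

lemma poisson_cdf_nonneg: "\<mu> \<ge> 0 \<Longrightarrow> 0 \<le> poisson_cdf m \<mu>"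
  unfolding poisson_cdf_def by (intro mult_nonneg_nonneg sum_nonneg) auto

lemma poisson_cdf_mono:
  assumes "\<mu> \<ge> 0" "m \<le> n"
  shows "poisson_cdf m \<mu> \<le> poisson_cdf n \<mu>"
  unfolding poisson_cdf_def using assms by (intro mult_left_mono sum_mono2) auto

lemma poisson_cdf_le_1:
  assumes "\<mu> \<ge> 0"
  shows "poisson_cdf m \<mu> \<le> 1"
proof -
  have "(\<Sum>i<m. \<mu> ^ i / fact i) \<le> (\<Sum>i. \<mu> ^ i / fact i)"
    using assms sums_exp_real[of \<mu>] by (intro sum_le_suminf) (auto simp: sums_iff)
  then have "(\<Sum>i<m. \<mu> ^ i / fact i) \<le> exp \<mu>"
    using sums_exp_real[of \<mu>] by (simp add: sums_iff)
  then have "poisson_cdf m \<mu> \<le> exp (- \<mu>) * exp \<mu>"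
    unfolding poisson_cdf_def by (intro mult_left_mono) auto
  then show ?thesis by (simp flip: exp_add)
qed

text \<open>Exponential tilting: for \<open>i < m\<close> and \<open>\<theta> \<le> 1\<close> each
  term may be multiplied by \<open>\<theta> ^ i / \<theta> ^ m\<close>, which is at least 1, and the
  tilted sum is at most an exponential.\<close>

lemma poisson_cdf_upper:
  assumes "\<mu> \<ge> 0" "0 < \<theta>" "\<theta> \<le> 1"
  shows "poisson_cdf m \<mu> \<le> exp (\<mu> * \<theta> - \<mu>) / \<theta> ^ m"
proof -
  have "(\<Sum>i<m. \<mu> ^ i / fact i) \<le> (\<Sum>i<m. (\<mu> * \<theta>) ^ i / fact i / \<theta> ^ m)"
  proof (intro sum_mono)
    fix i assume "i \<in> {..<m}"
    then have "\<theta> ^ m \<le> \<theta> ^ i" using assms by (intro power_decreasing) auto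
    then have "1 \<le> \<theta> ^ i / \<theta> ^ m" using assms by (simp add: field_simps)
    from mult_left_mono[OF this, of "\<mu> ^ i / fact i"]
    show "\<mu> ^ i / fact i \<le> (\<mu> * \<theta>) ^ i / fact i / \<theta> ^ m"
      using assms by (simp add: power_mult_distrib)
  qed
  also have "\<dots> = (\<Sum>i<m. (\<mu> * \<theta>) ^ i / fact i) / \<theta> ^ m"
    by (simp only: sum_divide_distrib)
  also have "\<dots> \<le> exp (\<mu> * \<theta>) / \<theta> ^ m"
  proof (intro divide_right_mono)
    have "(\<Sum>i<m. (\<mu> * \<theta>) ^ i / fact i) \<le> (\<Sum>i. (\<mu> * \<theta>) ^ i / fact i)"
      using assms sums_exp_real[of "\<mu> * \<theta>"] by (intro sum_le_suminf) (auto simp: sums_iff)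
    then show "(\<Sum>i<m. (\<mu> * \<theta>) ^ i / fact i) \<le> exp (\<mu> * \<theta>)"
      using sums_exp_real[of "\<mu> * \<theta>"] by (simp add: sums_iff)
  qed (use assms in auto)
  finally have "exp (- \<mu>) * (\<Sum>i<m. \<mu> ^ i / fact i) \<le> exp (- \<mu>) * (exp (\<mu> * \<theta>) / \<theta> ^ m)"
    by (intro mult_left_mono) auto
  also have "\<dots> = exp (\<mu> * \<theta> - \<mu>) / \<theta> ^ m"
    by (simp add: exp_diff exp_minus field_simps)
  finally show ?thesis unfolding poisson_cdf_def .
qed

text \<open>The same tilting with \<open>\<theta> \<ge> 1\<close>, applied to the complementary
  terms of index at least \<open>m\<close>.\<close>

lemma poisson_cdf_lower:
  assumes "\<mu> \<ge> 0" "\<theta> \<ge> 1"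
  shows "1 - poisson_cdf m \<mu> \<le> exp (\<mu> * \<theta> - \<mu>) / \<theta> ^ m"
proof -
  have s: "(\<lambda>i. \<mu> ^ (i + m) / fact (i + m)) sums (exp \<mu> - (\<Sum>i<m. \<mu> ^ i / fact i))"
    using sums_exp_real[of \<mu>] sums_iff_shift'[of "\<lambda>i. \<mu> ^ i / fact i" m "exp \<mu>"] by simp
  have s': "(\<lambda>i. (\<mu> * \<theta>) ^ (i + m) / fact (i + m)) sums (exp (\<mu> * \<theta>) - (\<Sum>i<m. (\<mu> * \<theta>) ^ i / fact i))"
    using sums_exp_real[of "\<mu> * \<theta>"] sums_iff_shift'[of "\<lambda>i. (\<mu> * \<theta>) ^ i / fact i" m "exp (\<mu> * \<theta>)"] by simp
  have "exp \<mu> - (\<Sum>i<m. \<mu> ^ i / fact i) \<le> (exp (\<mu> * \<theta>) - (\<Sum>i<m. (\<mu> * \<theta>) ^ i / fact i)) / \<theta> ^ m"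
  proof (rule sums_le[OF _ s sums_divide[OF s']])
    fix i
    have "\<theta> ^ m \<le> \<theta> ^ (i + m)" using assms by (intro power_increasing) auto
    then have "1 \<le> \<theta> ^ (i + m) / \<theta> ^ m" using assms by (simp add: field_simps)
    from mult_left_mono[OF this, of "\<mu> ^ (i + m) / fact (i + m)"]
    show "\<mu> ^ (i + m) / fact (i + m) \<le> (\<mu> * \<theta>) ^ (i + m) / fact (i + m) / \<theta> ^ m"
      using assms by (simp add: power_mult_distrib)
  qed
  also have "\<dots> \<le> exp (\<mu> * \<theta>) / \<theta> ^ m"
    using assms by (intro divide_right_mono) (auto intro!: sum_nonneg)
  finally have "exp (- \<mu>) * (exp \<mu> - (\<Sum>i<m. \<mu> ^ i / fact i)) \<le> exp (- \<mu>) * (exp (\<mu> * \<theta>) / \<theta> ^ m)"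
    by (intro mult_left_mono) auto
  also have "\<dots> = exp (\<mu> * \<theta> - \<mu>) / \<theta> ^ m"
    by (simp add: exp_diff exp_minus field_simps)
  also have "exp (- \<mu>) * (exp \<mu> - (\<Sum>i<m. \<mu> ^ i / fact i)) = 1 - poisson_cdf m \<mu>"
    unfolding poisson_cdf_def right_diff_distrib by (simp add: exp_minus)
  finally show ?thesis .
qed

text \<open>The Chernoff rate: both tail bounds are used with \<open>\<theta> = 1 / r\<close>.\<close>

lemma chernoff_base:
  assumes "(r :: real) > 0" "r \<noteq> 1"
  shows "(\<lambda>n. (r * exp (1 - r)) ^ n) \<longlonglongrightarrow> 0"
proof -
  have "exp (r - 1) > r"
    using exp_minus_greater[of "1 - r"] assms by simp
  then have "r * exp (1 - r) < exp (r - 1) * exp (1 - r)"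
    by (intro mult_strict_right_mono) auto
  then have "r * exp (1 - r) < 1" by (simp flip: exp_add)
  then show ?thesis using assms by (intro LIMSEQ_power_zero) simp
qed

text \<open>Below the threshold the shift by \<open>j\<close> costs only the constant
  \<open>1 / r ^ j\<close>; above it, monotonicity in the cutoff removes \<open>j\<close>.\<close>

lemma poisson_cdf_tendsto:
  assumes r: "r > 0" "r \<noteq> 1"
  shows "(\<lambda>n. poisson_cdf (n - j) (real n * r)) \<longlonglongrightarrow> (if r < 1 then 1 else 0)"
proof (cases "r < 1")
  case True
  have e: "(\<lambda>n. (r * exp (1 - r)) ^ n / r ^ j) \<longlonglongrightarrow> 0"
    using tendsto_divide[OF chernoff_base[OF r] tendsto_const[of "r ^ j"]] r by simp
  have "(\<lambda>n. poisson_cdf (n - j) (real n * r) - 1) \<longlonglongrightarrow> 0"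
  proof (rule Lim_null_comparison[OF _ e])
    show "\<forall>\<^sub>F n in sequentially. norm (poisson_cdf (n - j) (real n * r) - 1) \<le> (r * exp (1 - r)) ^ n / r ^ j"
      \<comment> \<open>From \<open>n \<ge> j\<close> on, the subtraction \<open>n - j\<close> is
        not truncated and \<open>r ^ (n - j)\<close> splits as a quotient.\<close>
      using eventually_ge_at_top[of j]
    proof eventually_elim
      case (elim n)
      have "1 - poisson_cdf (n - j) (real n * r) \<le> exp (real n * r * (1 / r) - real n * r) / (1 / r) ^ (n - j)"
        using r True by (intro poisson_cdf_lower) auto
      also have "\<dots> = exp (real n * (1 - r)) * r ^ (n - j)"
        using r by (simp add: power_one_over algebra_simps)
      also have "\<dots> = (r * exp (1 - r)) ^ n / r ^ j"
        using r elim by (simp add: exp_of_nat_mult power_mult_distrib power_diff)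
      finally show ?case using poisson_cdf_le_1[of "real n * r" "n - j"] r by simp
    qed
  qed
  then show ?thesis using True by (simp add: LIM_zero_iff)
next
  case False
  then have r1: "r > 1" using r by simp
  have "(\<lambda>n. poisson_cdf (n - j) (real n * r)) \<longlonglongrightarrow> 0"
  proof (rule Lim_null_comparison[OF always_eventually chernoff_base[OF r]], rule allI)
    fix n
    have "poisson_cdf (n - j) (real n * r) \<le> poisson_cdf n (real n * r)"
      using r by (intro poisson_cdf_mono) auto
    also have "\<dots> \<le> exp (real n * r * (1 / r) - real n * r) / (1 / r) ^ n"
      using r r1 by (intro poisson_cdf_upper) auto
    also have "\<dots> = exp (real n * (1 - r)) * r ^ n"
      using r by (simp add: power_one_over algebra_simps)
    also have "\<dots> = (r * exp (1 - r)) ^ n"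
      by (simp add: exp_of_nat_mult power_mult_distrib)
    finally show "norm (poisson_cdf (n - j) (real n * r)) \<le> (r * exp (1 - r)) ^ n"
      using poisson_cdf_nonneg[of "real n * r" "n - j"] r by simp
  qed
  then show ?thesis using False by simp
qed

text \<open>Decay in \<open>r\<close> at any prescribed rate \<open>\<kappa>\<close>, uniformly in
  large \<open>n\<close>; it has to beat the exponential bounds on \<open>bessel_F\<close>. For
  \<open>r \<le> 4\<close> the right-hand side is at least 1. Beyond that, tilting by 1/2 and
  \<open>2 \<le> exp 1\<close> give the exponent \<open>n * (1 - r / 2)\<close>, and
  \<open>1 - r / 2 \<le> - r / 4\<close> holds exactly from 4 on.\<close>

lemma poisson_cdf_exp_bound:
  assumes "r \<ge> 0" "\<kappa> \<ge> 0" "real n \<ge> 4 * \<kappa>"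
  shows "poisson_cdf n (real n * r) \<le> exp (4 * \<kappa> - \<kappa> * r)"
proof (cases "r \<le> 4")
  case True
  have "poisson_cdf n (real n * r) \<le> 1" using assms by (intro poisson_cdf_le_1) auto
  also have "1 \<le> exp (4 * \<kappa> - \<kappa> * r)"
    using True assms mult_left_mono[of r 4 \<kappa>] by simp
  finally show ?thesis .
next
  case False
  have "poisson_cdf n (real n * r) \<le> exp (real n * r * (1 / 2) - real n * r) / (1 / 2) ^ n"
    using assms by (intro poisson_cdf_upper) auto
  also have "\<dots> = 2 ^ n * exp (- (real n * r) / 2)"
    by (simp add: power_one_over)
  also have "\<dots> \<le> exp 1 ^ n * exp (- (real n * r) / 2)"
    using exp_ge_add_one_self[of 1] by (intro mult_right_mono power_mono) auto
  also have "\<dots> = exp (real n * (1 - r / 2))"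
    by (simp add: exp_of_nat_mult[symmetric] exp_add[symmetric] algebra_simps)
  also have "\<dots> \<le> exp (4 * \<kappa> - \<kappa> * r)"
  proof -
    have "real n * (1 - r / 2) \<le> real n * (- r / 4)"
      using False by (intro mult_left_mono) auto
    also have "\<dots> \<le> - (\<kappa> * r)"
      using mult_right_mono[OF assms(3), of r] assms(1) by (simp add: algebra_simps)
    finally show ?thesis using assms by simp
  qed
  finally show ?thesis .
qed

section \<open>The sum over k as a Poisson-weighted Taylor expansion\<close>

text \<open>The Taylor series of \<open>bessel_F \<alpha> 0\<close> at
  \<open>\<tau> * \<eta>\<close> with increment \<open>- (\<eta> * r)\<close>, where the term
  \<open>j\<close> is weighted by the probability that a Poisson variable of mean
  \<open>n * r\<close> is less than \<open>n - j\<close>.\<close>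

definition kernel_profile :: "real \<Rightarrow> real \<Rightarrow> real \<Rightarrow> nat \<Rightarrow> real \<Rightarrow> real" where
  "kernel_profile \<alpha> \<tau> \<eta> n r =
     (\<Sum>j<n. bessel_F \<alpha> j (\<tau> * \<eta>) / fact j * (- (\<eta> * r)) ^ j * poisson_cdf (n - j) (real n * r))"

text \<open>Tannery's theorem: the weights are at most 1 and each tends to 1 or to 0, so the sum
  tends to the full Taylor series or to 0.\<close>

lemma kernel_profile_tendsto:
  assumes "\<alpha> > -1" "r > 0" "r \<noteq> 1"
  shows "(\<lambda>n. kernel_profile \<alpha> \<tau> \<eta> n r) \<longlonglongrightarrow> (if r < 1 then bessel_F \<alpha> 0 (- \<eta> * (r - \<tau>)) else 0)"
proof -
  let ?h = "\<lambda>j. bessel_F \<alpha> j (\<tau> * \<eta>) / fact j * (- (\<eta> * r)) ^ j"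
  \<comment> \<open>For \<open>j \<ge> n\<close> the truncated difference \<open>n - j\<close> is 0,
    and \<open>poisson_cdf 0\<close> is an empty sum.\<close>
  have eq: "kernel_profile \<alpha> \<tau> \<eta> n r = (\<Sum>j. ?h j * poisson_cdf (n - j) (real n * r))" for n
    unfolding kernel_profile_def
    by (rule suminf_finite[symmetric]) (auto simp: poisson_cdf_def)
  have sh: "summable (\<lambda>j. \<bar>?h j\<bar>)"
  proof (rule summable_comparison_test')
    show "summable (\<lambda>j. bessel_bound \<alpha> * exp \<bar>\<tau> * \<eta>\<bar> * (\<bar>\<eta> * r\<bar> ^ j / fact j))"
      using sums_exp_real[of "\<bar>\<eta> * r\<bar>"] by (intro summable_mult) (auto simp: sums_iff)
    show "norm \<bar>?h j\<bar> \<le> bessel_bound \<alpha> * exp \<bar>\<tau> * \<eta>\<bar> * (\<bar>\<eta> * r\<bar> ^ j / fact j)" for j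
      using mult_right_mono[OF bessel_F_bound[OF assms(1), of j "\<tau> * \<eta>"], of "\<bar>\<eta> * r\<bar> ^ j / fact j"]
      by (simp add: abs_mult power_abs mult_ac)
  qed
  have "(\<lambda>n. \<Sum>j. ?h j * poisson_cdf (n - j) (real n * r)) \<longlonglongrightarrow> (\<Sum>j. ?h j * (if r < 1 then 1 else 0))"
  proof (rule tannerys_theorem[THEN conjunct2, THEN conjunct2])
    show "(\<lambda>n. ?h j * poisson_cdf (n - j) (real n * r)) \<longlonglongrightarrow> ?h j * (if r < 1 then 1 else 0)" for j
      by (intro tendsto_mult tendsto_const poisson_cdf_tendsto assms)
    have "norm (?h j * poisson_cdf (n - j) (real n * r)) \<le> \<bar>?h j\<bar>" for j n
    proof -
      have "norm (?h j * poisson_cdf (n - j) (real n * r)) = \<bar>?h j\<bar> * poisson_cdf (n - j) (real n * r)"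
        unfolding real_norm_def abs_mult[of "?h j"] using assms
        by (simp only: abs_of_nonneg poisson_cdf_nonneg mult_nonneg_nonneg of_nat_0_le_iff less_imp_le)
      also have "\<dots> \<le> \<bar>?h j\<bar> * 1"
        using assms by (intro mult_left_mono poisson_cdf_le_1) auto
      finally show ?thesis by simp
    qed
    then show "\<forall>\<^sub>F (j, n) in at_top \<times>\<^sub>F sequentially. norm (?h j * poisson_cdf (n - j) (real n * r)) \<le> \<bar>?h j\<bar>"
      by (intro always_eventually) auto
  qed (use sh in auto)
  also have "(\<Sum>j. ?h j * (if r < 1 then 1 else 0)) = (if r < 1 then bessel_F \<alpha> 0 (- \<eta> * (r - \<tau>)) else 0)"
    using bessel_F_taylor[OF assms(1), of "\<tau> * \<eta>" "- (\<eta> * r)"] by (auto simp: sums_iff algebra_simps)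
  finally show ?thesis unfolding eq .
qed

text \<open>One common Poisson factor is kept, by monotonicity in the cutoff, since it has to
  provide the decay in \<open>r\<close> that offsets \<open>exp (\<eta> * r)\<close>.\<close>

lemma kernel_profile_bound:
  assumes "\<alpha> > -1" "r \<ge> 0" "\<eta> \<ge> 0"
  shows "\<bar>kernel_profile \<alpha> \<tau> \<eta> n r\<bar>
    \<le> bessel_bound \<alpha> * exp \<bar>\<tau> * \<eta>\<bar> * exp (\<eta> * r) * poisson_cdf n (real n * r)"
proof -
  let ?C = "bessel_bound \<alpha> * exp \<bar>\<tau> * \<eta>\<bar>"
  have C0: "bessel_bound \<alpha> \<ge> 0"
    using bessel_F_bound[OF assms(1), of 0 0] by simp
  then have C: "?C \<ge> 0" by simp
  have p: "poisson_cdf n (real n * r) \<ge> 0" using assms by (intro poisson_cdf_nonneg) auto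
  have "\<bar>kernel_profile \<alpha> \<tau> \<eta> n r\<bar>
     \<le> (\<Sum>j<n. \<bar>bessel_F \<alpha> j (\<tau> * \<eta>) / fact j * (- (\<eta> * r)) ^ j * poisson_cdf (n - j) (real n * r)\<bar>)"
    unfolding kernel_profile_def by (rule sum_abs)
  also have "\<dots> \<le> (\<Sum>j<n. ?C * ((\<eta> * r) ^ j / fact j) * poisson_cdf n (real n * r))"
  proof (rule sum_mono)
    fix j assume "j \<in> {..<n}"
    have "\<bar>bessel_F \<alpha> j (\<tau> * \<eta>) / fact j * (- (\<eta> * r)) ^ j * poisson_cdf (n - j) (real n * r)\<bar>
        = (\<bar>bessel_F \<alpha> j (\<tau> * \<eta>)\<bar> * ((\<eta> * r) ^ j / fact j)) * poisson_cdf (n - j) (real n * r)"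
      using assms poisson_cdf_nonneg[of "real n * r" "n - j"] by (simp add: abs_mult power_abs)
    also have "\<dots> \<le> (?C * ((\<eta> * r) ^ j / fact j)) * poisson_cdf n (real n * r)"
      using assms C0 by (intro mult_mono bessel_F_bound poisson_cdf_mono poisson_cdf_nonneg mult_nonneg_nonneg) auto
    finally show "\<bar>bessel_F \<alpha> j (\<tau> * \<eta>) / fact j * (- (\<eta> * r)) ^ j * poisson_cdf (n - j) (real n * r)\<bar>
        \<le> ?C * ((\<eta> * r) ^ j / fact j) * poisson_cdf n (real n * r)" .
  qed
  also have "\<dots> = ?C * (\<Sum>j<n. (\<eta> * r) ^ j / fact j) * poisson_cdf n (real n * r)"
    by (simp only: sum_distrib_left sum_distrib_right)
  also have "\<dots> \<le> ?C * exp (\<eta> * r) * poisson_cdf n (real n * r)"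
  proof (intro mult_right_mono mult_left_mono C p)
    have "(\<Sum>j<n. (\<eta> * r) ^ j / fact j) \<le> (\<Sum>j. (\<eta> * r) ^ j / fact j)"
      using assms sums_exp_real[of "\<eta> * r"] by (intro sum_le_suminf) (auto simp: sums_iff)
    then show "(\<Sum>j<n. (\<eta> * r) ^ j / fact j) \<le> exp (\<eta> * r)"
      using sums_exp_real[of "\<eta> * r"] by (simp add: sums_iff)
  qed
  finally show ?thesis .
qed

text \<open>The pairs of a Taylor index \<open>j\<close> and a Poisson index \<open>i\<close> with
  \<open>j + i < n\<close> are grouped by \<open>k = i + j\<close>, as in a Cauchy product.\<close>

lemma kernel_profile_eq:
  assumes "n > 0"
  shows "kernel_profile \<alpha> \<tau> \<eta> n r = exp (- (real n * r)) *
     (\<Sum>k<n. (real n * r) ^ k / fact k * (\<Sum>j\<le>k. real (k choose j) * (- (\<eta> / real n)) ^ j * bessel_F \<alpha> j (\<tau> * \<eta>)))"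
proof -
  define g where "g = (\<lambda>j i. bessel_F \<alpha> j (\<tau> * \<eta>) / fact j * (- (\<eta> * r)) ^ j * ((real n * r) ^ i / fact i))"
  have "kernel_profile \<alpha> \<tau> \<eta> n r = exp (- (real n * r)) * (\<Sum>j<n. \<Sum>i<n - j. g j i)"
    unfolding kernel_profile_def poisson_cdf_def g_def
    by (simp add: sum_distrib_left mult_ac)
  also have "(\<Sum>j<n. \<Sum>i<n - j. g j i) = (\<Sum>(j, i)\<in>{(j, i). j + i < n}. g j i)"
    by (subst sum.Sigma) (auto intro!: sum.cong)
  also have "\<dots> = (\<Sum>k<n. \<Sum>j\<le>k. g j (k - j))"
    by (rule sum.triangle_reindex)
  also have "\<dots> = (\<Sum>k<n. (real n * r) ^ k / fact k * (\<Sum>j\<le>k. real (k choose j) * (- (\<eta> / real n)) ^ j * bessel_F \<alpha> j (\<tau> * \<eta>)))"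
    unfolding sum_distrib_left
  proof (intro sum.cong refl)
    fix k j :: nat assume "j \<in> {..k}"
    then have jk: "j \<le> k" by simp
    have 1: "real (k choose j) = fact k / (fact j * fact (k - j))"
      by (rule binomial_fact[OF jk])
    have "(real n * r) ^ k = (real n * r) ^ j * (real n * r) ^ (k - j)"
      using jk by (simp flip: power_add)
    moreover have "(real n * r) ^ j * (- (\<eta> / real n)) ^ j = (- (\<eta> * r)) ^ j"
      unfolding power_mult_distrib[symmetric] using assms by (simp add: mult.commute)
    ultimately have "(real n * r) ^ k * (- (\<eta> / real n)) ^ j = (- (\<eta> * r)) ^ j * (real n * r) ^ (k - j)"
      by (metis mult.assoc mult.commute)
    then show "g j (k - j) = (real n * r) ^ k / fact k * (real (k choose j) * (- (\<eta> / real n)) ^ j * bessel_F \<alpha> j (\<tau> * \<eta>))"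
      unfolding g_def 1 by (simp add: field_simps)
  qed
  finally show ?thesis .
qed

text \<open>Inserting the integral for \<open>dual_P\<close> at \<open>u = n * s\<close> makes
  \<open>(n * (s + \<tau>)) ^ k / fact k\<close> appear, and the factor \<open>exp (- A)\<close> of
  \<open>dual_Q\<close> completes it to a Poisson weight.\<close>

lemma dual_kernel_eq_integral:
  assumes \<alpha>: "\<alpha> > -1" and n: "n > 0" and \<eta>: "\<eta> > 0"
  shows "dual_kernel \<alpha> (real n * \<tau>) n (\<xi> / real n) (\<eta> / real n) / real n =
    exp ((\<xi> - \<eta>) / real n) * \<eta> powr \<alpha> *
    (\<integral>s. s powr \<alpha> * bessel_F \<alpha> 0 (- \<xi> * s) * kernel_profile \<alpha> \<tau> \<eta> n (s + \<tau>) \<partial>pos_lborel)"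
proof -
  let ?I = "\<lambda>s. s powr \<alpha> * bessel_F \<alpha> 0 (- \<xi> * s) * kernel_profile \<alpha> \<tau> \<eta> n (s + \<tau>)"
  let ?A = "real n * \<tau>" and ?N = "real n"
  let ?f = "\<lambda>k u. u powr \<alpha> * exp (- u) * (u + ?A) ^ k * bessel_F \<alpha> 0 (- (\<xi> / ?N) * u)"
  have "has_pos_integral (\<lambda>s. \<Sum>k<n. dual_Q \<alpha> ?A k (\<eta> / ?N) * ?f k (?N * s))
     (\<Sum>k<n. dual_Q \<alpha> ?A k (\<eta> / ?N) * ((exp (- (\<xi> / ?N)) * dual_P \<alpha> ?A k (\<xi> / ?N)) /\<^sub>R ?N))"
    using n by (intro has_bochner_integral_sum has_bochner_integral_mult_right
        has_bochner_integral_pos_lborel_scale[where f = "?f _"] dual_P_integral \<alpha>) auto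
  also have "(\<Sum>k<n. dual_Q \<alpha> ?A k (\<eta> / ?N) * ((exp (- (\<xi> / ?N)) * dual_P \<alpha> ?A k (\<xi> / ?N)) /\<^sub>R ?N))
     = exp (- (\<xi> / ?N)) * (dual_kernel \<alpha> ?A n (\<xi> / ?N) (\<eta> / ?N) / ?N)"
    unfolding dual_kernel_def by (simp add: sum_distrib_left sum_divide_distrib divide_inverse mult_ac)
  finally have I: "(\<integral>s. (\<Sum>k<n. dual_Q \<alpha> ?A k (\<eta> / ?N) * ?f k (?N * s)) \<partial>pos_lborel)
     = exp (- (\<xi> / ?N)) * (dual_kernel \<alpha> ?A n (\<xi> / ?N) (\<eta> / ?N) / ?N)"
    by (rule has_bochner_integral_integral_eq)
  have "(\<integral>s. (\<Sum>k<n. dual_Q \<alpha> ?A k (\<eta> / ?N) * ?f k (?N * s)) \<partial>pos_lborel)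
     = (\<integral>s. (exp (- (\<eta> / ?N)) * \<eta> powr \<alpha>) * (?I s) \<partial>pos_lborel)"
  proof (rule Bochner_Integration.integral_cong[OF refl])
    fix s assume "s \<in> space pos_lborel"
    then have s: "s > 0" by (simp add: space_restrict_space)
    let ?S = "\<lambda>k. \<Sum>j\<le>k. real (k choose j) * (- (\<eta> / ?N)) ^ j * bessel_F \<alpha> j (\<tau> * \<eta>)"
    \<comment> \<open>The powers of \<open>n\<close> from the substitution and from the argument of
      \<open>dual_Q\<close> cancel.\<close>
    have "(?N * s) powr \<alpha> * (\<eta> / ?N) powr \<alpha> = (s * \<eta>) powr \<alpha>"
      using s \<eta> n by (simp flip: powr_mult)
    then have p: "(?N * s) powr \<alpha> * (\<eta> / ?N) powr \<alpha> = s powr \<alpha> * \<eta> powr \<alpha>"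
      using s \<eta> by (simp add: powr_mult)
    have e: "exp (- ?A) * exp (- (?N * s)) = exp (- (?N * (s + \<tau>)))"
      by (simp add: exp_add[symmetric] algebra_simps)
    have "dual_Q \<alpha> ?A k (\<eta> / ?N) * ?f k (?N * s) =
       (exp (- (\<eta> / ?N)) * \<eta> powr \<alpha> * (s powr \<alpha> * bessel_F \<alpha> 0 (- \<xi> * s))) *
       (exp (- (?N * (s + \<tau>))) * ((?N * (s + \<tau>)) ^ k / fact k * ?S k))" for k
    proof -
      have 1: "?A * (\<eta> / ?N) = \<tau> * \<eta>" "- (\<xi> / ?N) * (?N * s) = - \<xi> * s" "?N * s + ?A = ?N * (s + \<tau>)"
        using n by (simp_all add: algebra_simps)
      have "dual_Q \<alpha> ?A k (\<eta> / ?N) * ?f k (?N * s) =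
        ((?N * s) powr \<alpha> * (\<eta> / ?N) powr \<alpha>) * (exp (- ?A) * exp (- (?N * s))) * exp (- (\<eta> / ?N)) * bessel_F \<alpha> 0 (- \<xi> * s)
          * ((?N * (s + \<tau>)) ^ k / fact k * ?S k)"
        unfolding dual_Q_def 1 by (simp only: mult_ac divide_inverse)
      also have "\<dots> = (exp (- (\<eta> / ?N)) * \<eta> powr \<alpha> * (s powr \<alpha> * bessel_F \<alpha> 0 (- \<xi> * s))) *
       (exp (- (?N * (s + \<tau>))) * ((?N * (s + \<tau>)) ^ k / fact k * ?S k))"
        unfolding p e by (simp only: mult_ac)
      finally show ?thesis .
    qed
    then have "(\<Sum>k<n. dual_Q \<alpha> ?A k (\<eta> / ?N) * ?f k (?N * s)) =
       (exp (- (\<eta> / ?N)) * \<eta> powr \<alpha> * (s powr \<alpha> * bessel_F \<alpha> 0 (- \<xi> * s))) *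
       (exp (- (?N * (s + \<tau>))) * (\<Sum>k<n. (?N * (s + \<tau>)) ^ k / fact k * ?S k))"
      by (simp only: sum_distrib_left)
    also have "\<dots> = (exp (- (\<eta> / ?N)) * \<eta> powr \<alpha>) * (?I s)"
      unfolding kernel_profile_eq[OF n] by (simp only: mult_ac)
    finally show "(\<Sum>k<n. dual_Q \<alpha> ?A k (\<eta> / ?N) * ?f k (?N * s)) = (exp (- (\<eta> / ?N)) * \<eta> powr \<alpha>) * (?I s)" .
  qed
  also have "\<dots> = (exp (- (\<eta> / ?N)) * \<eta> powr \<alpha>) * (\<integral>s. ?I s \<partial>pos_lborel)"
    by (rule integral_mult_right_zero)
  finally have "exp (- (\<xi> / ?N)) * (dual_kernel \<alpha> ?A n (\<xi> / ?N) (\<eta> / ?N) / ?N) = \<dots>" using I by simp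
  then have "exp (\<xi> / ?N) * (exp (- (\<xi> / ?N)) * (dual_kernel \<alpha> ?A n (\<xi> / ?N) (\<eta> / ?N) / ?N))
     = exp (\<xi> / ?N) * ((exp (- (\<eta> / ?N)) * \<eta> powr \<alpha>) * (\<integral>s. ?I s \<partial>pos_lborel))"
    by (rule arg_cong)
  then show ?thesis
    unfolding mult.assoc[symmetric] exp_add[symmetric] by (simp add: diff_divide_distrib)
qed

lemma kernel_integral_tendsto:
  assumes \<alpha>: "\<alpha> > -1" and \<tau>: "0 < \<tau>" and \<xi>: "\<xi> > 0" and \<eta>: "\<eta> > 0"
  shows "(\<lambda>n. \<integral>s. s powr \<alpha> * bessel_F \<alpha> 0 (- \<xi> * s) * kernel_profile \<alpha> \<tau> \<eta> n (s + \<tau>) \<partial>pos_lborel)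
    \<longlonglongrightarrow> (\<integral>s. s powr \<alpha> * bessel_F \<alpha> 0 (- \<xi> * s) * (if s < 1 - \<tau> then bessel_F \<alpha> 0 (- \<eta> * s) else 0) \<partial>pos_lborel)"
proof -
  let ?f = "\<lambda>n s. s powr \<alpha> * bessel_F \<alpha> 0 (- \<xi> * s) * kernel_profile \<alpha> \<tau> \<eta> n (s + \<tau>)"
  let ?g = "\<lambda>s. s powr \<alpha> * bessel_F \<alpha> 0 (- \<xi> * s) * (if s < 1 - \<tau> then bessel_F \<alpha> 0 (- \<eta> * s) else 0)"
  \<comment> \<open>The rate exceeds the combined growth \<open>\<xi> + \<eta>\<close> of the two
    Bessel bounds by 1, which leaves \<open>exp (- s)\<close> in the dominating function.\<close>
  define \<kappa> where "\<kappa> = \<xi> + \<eta> + 1"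
  \<comment> \<open>From this index on the Poisson bound with rate \<open>\<kappa>\<close> applies;
    the sequence is shifted by \<open>N\<close> so that the domination holds for every term.\<close>
  define N where "N = nat \<lceil>4 * \<kappa>\<rceil>"
  define C where "C = bessel_bound \<alpha>"
  define W where "W = C * (C * exp \<bar>\<tau> * \<eta>\<bar>) * exp ((\<eta> - \<kappa>) * \<tau> + 4 * \<kappa>)"
  have C0: "C \<ge> 0" using bessel_F_bound[OF \<alpha>, of 0 0] unfolding C_def by simp
  note [measurable] = bessel_F_measurable[OF \<alpha>]
  have [measurable]: "kernel_profile \<alpha> \<tau> \<eta> n \<in> borel_measurable borel" for n
    unfolding kernel_profile_def poisson_cdf_def by measurable
  have "(\<lambda>n. \<integral>s. ?f (n + N) s \<partial>pos_lborel)
    \<longlonglongrightarrow> (\<integral>s. ?g s \<partial>pos_lborel)"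
  proof (rule integral_dominated_convergence[where w = "\<lambda>s. W * (s powr \<alpha> * exp (- s))"])
    show "integrable pos_lborel (\<lambda>s. W * (s powr \<alpha> * exp (- s)))"
      using has_bochner_integral_Gamma[OF \<alpha>] by (auto simp: has_bochner_integral_iff)
    have "AE s in pos_lborel. s \<noteq> 1 - \<tau>"
      using AE_lborel_singleton[of "1 - \<tau>"] by (subst AE_restrict_space_iff) auto
    moreover have "AE s in pos_lborel. s > 0"
      by (rule AE_I2) (simp add: space_restrict_space)
    ultimately show "AE s in pos_lborel. (\<lambda>n. ?f (n + N) s)
       \<longlonglongrightarrow> ?g s"
    proof eventually_elim
      case (elim s)
      have "(\<lambda>n. kernel_profile \<alpha> \<tau> \<eta> n (s + \<tau>)) \<longlonglongrightarrow> (if s + \<tau> < 1 then bessel_F \<alpha> 0 (- \<eta> * (s + \<tau> - \<tau>)) else 0)"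
        using elim \<tau> by (intro kernel_profile_tendsto \<alpha>) auto
      then have "(\<lambda>n. kernel_profile \<alpha> \<tau> \<eta> n (s + \<tau>)) \<longlonglongrightarrow> (if s < 1 - \<tau> then bessel_F \<alpha> 0 (- \<eta> * s) else 0)"
        by (auto simp: less_diff_eq split: if_splits)
      then show ?case by (intro tendsto_mult tendsto_const LIMSEQ_ignore_initial_segment)
    qed
    show "AE s in pos_lborel. norm (?f (n + N) s)
        \<le> W * (s powr \<alpha> * exp (- s))" for n
    proof (rule AE_I2)
      fix s assume "s \<in> space pos_lborel"
      then have s: "s > 0" by (simp add: space_restrict_space)
      have nN: "real (n + N) \<ge> 4 * \<kappa>" unfolding N_def by linarith
      have 1: "\<bar>bessel_F \<alpha> 0 (- \<xi> * s)\<bar> \<le> C * exp (\<xi> * s)"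
        using bessel_F_bound[OF \<alpha>, of 0 "- \<xi> * s"] s \<xi> unfolding C_def by (simp add: abs_mult)
      have "\<bar>kernel_profile \<alpha> \<tau> \<eta> (n + N) (s + \<tau>)\<bar>
          \<le> C * exp \<bar>\<tau> * \<eta>\<bar> * exp (\<eta> * (s + \<tau>)) * poisson_cdf (n + N) (real (n + N) * (s + \<tau>))"
        unfolding C_def using s \<tau> \<eta> by (intro kernel_profile_bound \<alpha>) auto
      also have "\<dots> \<le> C * exp \<bar>\<tau> * \<eta>\<bar> * exp (\<eta> * (s + \<tau>)) * exp (4 * \<kappa> - \<kappa> * (s + \<tau>))"
        using s \<tau> \<xi> \<eta> C0 nN by (intro mult_left_mono poisson_cdf_exp_bound) (auto simp: \<kappa>_def)
      finally have 2: "\<bar>kernel_profile \<alpha> \<tau> \<eta> (n + N) (s + \<tau>)\<bar> \<le> C * exp \<bar>\<tau> * \<eta>\<bar> * exp (\<eta> * (s + \<tau>)) * exp (4 * \<kappa> - \<kappa> * (s + \<tau>))" .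
      have "norm (?f (n + N) s)
         = s powr \<alpha> * (\<bar>bessel_F \<alpha> 0 (- \<xi> * s)\<bar> * \<bar>kernel_profile \<alpha> \<tau> \<eta> (n + N) (s + \<tau>)\<bar>)"
        by (simp add: abs_mult)
      also have "\<dots> \<le> s powr \<alpha> * ((C * exp (\<xi> * s)) * (C * exp \<bar>\<tau> * \<eta>\<bar> * exp (\<eta> * (s + \<tau>)) * exp (4 * \<kappa> - \<kappa> * (s + \<tau>))))"
        using C0 by (intro mult_left_mono mult_mono 1 2) auto
      also have "\<dots> = C * (C * exp \<bar>\<tau> * \<eta>\<bar>) * s powr \<alpha> * (exp (\<xi> * s) * (exp (\<eta> * (s + \<tau>)) * exp (4 * \<kappa> - \<kappa> * (s + \<tau>))))"
        by (simp only: mult_ac)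
      also have "exp (\<xi> * s) * (exp (\<eta> * (s + \<tau>)) * exp (4 * \<kappa> - \<kappa> * (s + \<tau>))) = exp ((\<eta> - \<kappa>) * \<tau> + 4 * \<kappa>) * exp (- s)"
        unfolding exp_add[symmetric] by (simp add: \<kappa>_def algebra_simps)
      also have "C * (C * exp \<bar>\<tau> * \<eta>\<bar>) * s powr \<alpha> * (exp ((\<eta> - \<kappa>) * \<tau> + 4 * \<kappa>) * exp (- s)) = W * (s powr \<alpha> * exp (- s))"
        unfolding W_def by (simp only: mult_ac)
      finally show "norm (?f (n + N) s) \<le> W * (s powr \<alpha> * exp (- s))" .
    qed
  qed (rule measurable_restrict_space1, measurable)+
  then show ?thesis by (rule LIMSEQ_offset)
qed

lemma dual_kernel_tendsto:
  assumes \<alpha>: "\<alpha> > -1" and \<tau>: "0 < \<tau>" and \<xi>: "\<xi> > 0" and \<eta>: "\<eta> > 0"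
  shows "(\<lambda>n. dual_kernel \<alpha> (real n * \<tau>) n (\<xi> / real n) (\<eta> / real n) / real n)
    \<longlonglongrightarrow> \<eta> powr \<alpha> * (\<integral>s. s powr \<alpha> * bessel_F \<alpha> 0 (- \<xi> * s) * (if s < 1 - \<tau> then bessel_F \<alpha> 0 (- \<eta> * s) else 0) \<partial>pos_lborel)"
proof -
  let ?I = "\<lambda>n. \<integral>s. s powr \<alpha> * bessel_F \<alpha> 0 (- \<xi> * s) * kernel_profile \<alpha> \<tau> \<eta> n (s + \<tau>) \<partial>pos_lborel"
  have "(\<lambda>n. (\<xi> - \<eta>) / real n) \<longlonglongrightarrow> 0"
    by (rule lim_const_over_n)
  from tendsto_exp[OF this] have "(\<lambda>n. exp ((\<xi> - \<eta>) / real n)) \<longlonglongrightarrow> 1" by simp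
  from tendsto_mult[OF tendsto_mult[OF this tendsto_const[of "\<eta> powr \<alpha>"]] kernel_integral_tendsto[OF assms]]
  have "(\<lambda>n. exp ((\<xi> - \<eta>) / real n) * \<eta> powr \<alpha> * ?I n)
    \<longlonglongrightarrow> \<eta> powr \<alpha> * (\<integral>s. s powr \<alpha> * bessel_F \<alpha> 0 (- \<xi> * s) * (if s < 1 - \<tau> then bessel_F \<alpha> 0 (- \<eta> * s) else 0) \<partial>pos_lborel)"
    by simp
  moreover have "\<forall>\<^sub>F n in sequentially. exp ((\<xi> - \<eta>) / real n) * \<eta> powr \<alpha> * ?I n = dual_kernel \<alpha> (real n * \<tau>) n (\<xi> / real n) (\<eta> / real n) / real n"
    using eventually_gt_at_top[of 0] by eventually_elim (simp only: dual_kernel_eq_integral[OF \<alpha> _ \<eta>])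
  ultimately show ?thesis by (rule Lim_transform_eventually)
qed

section \<open>The Bessel kernel\<close>

text \<open>For positive \<open>x\<close> and \<open>y\<close> this is the integral over (0,1) of
  \<open>bessel_J \<alpha> (sqrt (x * s)) * bessel_J \<alpha> (sqrt (y * s))\<close>, divided by
  \<open>(x * y / 16) powr (\<alpha> / 2)\<close>. The cutoff sits in the integrand so that the
  measure stays the one used before.\<close>

definition bessel_integral :: "real \<Rightarrow> real \<Rightarrow> real \<Rightarrow> real" where
  "bessel_integral \<alpha> x y =
     (\<integral>s. s powr \<alpha> * bessel_F \<alpha> 0 (- (x / 4) * s) * (if s < 1 then bessel_F \<alpha> 0 (- (y / 4) * s) else 0) \<partial>pos_lborel)"

lemma
  assumes \<alpha>: "\<alpha> > -1" and u: "u \<longlonglongrightarrow> x" and v: "v \<longlonglongrightarrow> y"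
  shows bessel_integral_tendsto: "(\<lambda>n. bessel_integral \<alpha> (u n) (v n)) \<longlonglongrightarrow> bessel_integral \<alpha> x y"
    and integrable_bessel_integral: "integrable pos_lborel
      (\<lambda>s. s powr \<alpha> * bessel_F \<alpha> 0 (- (x / 4) * s) * (if s < 1 then bessel_F \<alpha> 0 (- (y / 4) * s) else 0))"
proof -
  from convergent_imp_Bseq[OF convergentI[OF u]] obtain U where U: "\<And>n. \<bar>u n\<bar> \<le> U" by (auto simp: Bseq_def)
  from convergent_imp_Bseq[OF convergentI[OF v]] obtain V where V: "\<And>n. \<bar>v n\<bar> \<le> V" by (auto simp: Bseq_def)
  define C where "C = bessel_bound \<alpha>"
  have C0: "C \<ge> 0" using bessel_F_bound[OF \<alpha>, of 0 0] unfolding C_def by simp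
  \<comment> \<open>On \<open>s < 1\<close> the constant 1 is at most
    \<open>exp 1 * exp (- s)\<close>, so a multiple of the Gamma density dominates.\<close>
  define W where "W = (C * exp U) * (C * exp V) * exp 1"
  let ?f = "\<lambda>x y s. s powr \<alpha> * bessel_F \<alpha> 0 (- (x / 4) * s) * (if s < 1 then bessel_F \<alpha> 0 (- (y / 4) * s) else 0)"
  note [measurable] = bessel_F_measurable[OF \<alpha>]
  have meas: "?f x y \<in> borel_measurable pos_lborel" for x y
    by (rule measurable_restrict_space1) measurable
  have w: "integrable pos_lborel (\<lambda>s. W * (s powr \<alpha> * exp (- s)))"
    using has_bochner_integral_Gamma[OF \<alpha>] by (auto simp: has_bochner_integral_iff)
  have cont: "isCont (bessel_F \<alpha> 0) z" for z
    using bessel_F_deriv[OF \<alpha>] by (rule DERIV_isCont)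
  have lim: "AE s in pos_lborel. (\<lambda>n. ?f (u n) (v n) s) \<longlonglongrightarrow> ?f x y s"
  proof (rule AE_I2)
    fix s
    have "(\<lambda>n. bessel_F \<alpha> 0 (- (u n / 4) * s)) \<longlonglongrightarrow> bessel_F \<alpha> 0 (- (x / 4) * s)"
      "(\<lambda>n. bessel_F \<alpha> 0 (- (v n / 4) * s)) \<longlonglongrightarrow> bessel_F \<alpha> 0 (- (y / 4) * s)"
      by (rule isCont_tendsto_compose[OF cont], intro tendsto_intros u v, simp)+
    then show "(\<lambda>n. ?f (u n) (v n) s) \<longlonglongrightarrow> ?f x y s"
      by (cases "s < 1") (auto intro!: tendsto_intros)
  qed
  have bound: "AE s in pos_lborel. norm (?f (u n) (v n) s) \<le> W * (s powr \<alpha> * exp (- s))" for n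
  proof (rule AE_I2)
    fix s assume "s \<in> space pos_lborel"
    then have s: "s > 0" by (simp add: space_restrict_space)
    show "norm (?f (u n) (v n) s) \<le> W * (s powr \<alpha> * exp (- s))"
    proof (cases "s < 1")
      case True
      have b: "\<bar>bessel_F \<alpha> 0 (- (x / 4) * s)\<bar> \<le> C * exp U" if "\<bar>x\<bar> \<le> U" for x U
      proof -
        have "\<bar>x\<bar> / 4 * s \<le> U * 1" using that True s by (intro mult_mono) auto
        then have "\<bar>- (x / 4) * s\<bar> \<le> U" using s by (simp add: abs_mult)
        then have "C * exp \<bar>- (x / 4) * s\<bar> \<le> C * exp U" using C0 by (intro mult_left_mono) auto
        then show ?thesis using bessel_F_bound[OF \<alpha>, of 0 "- (x / 4) * s"] unfolding C_def by linarith
      qed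
      have "norm (?f (u n) (v n) s) = s powr \<alpha> * (\<bar>bessel_F \<alpha> 0 (- (u n / 4) * s)\<bar> * \<bar>bessel_F \<alpha> 0 (- (v n / 4) * s)\<bar>) * 1"
        using True by (simp add: abs_mult)
      also have "\<dots> \<le> s powr \<alpha> * ((C * exp U) * (C * exp V)) * (exp 1 * exp (- s))"
        using True s C0 U V by (intro mult_mono b) (auto simp flip: exp_add)
      also have "\<dots> = W * (s powr \<alpha> * exp (- s))"
        unfolding W_def by (simp only: mult_ac)
      finally show ?thesis .
    next
      case False
      then show ?thesis unfolding W_def using C0 by simp
    qed
  qed
  show "(\<lambda>n. bessel_integral \<alpha> (u n) (v n)) \<longlonglongrightarrow> bessel_integral \<alpha> x y"
    unfolding bessel_integral_def by (rule integral_dominated_convergence[OF meas meas w lim bound])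
  show "integrable pos_lborel (?f x y)"
    by (rule integrable_dominated_convergence[OF meas meas w lim bound])
qed

text \<open>
  The integrand is, up to the factor \<open>x - y\<close>, the derivative of the Wronskian-type expression on the
  left, by the differential equation \<open>bessel_F_rec\<close>.
\<close>

lemma bessel_integral_eq:
  assumes \<alpha>: "\<alpha> > -1"
  shows "x * bessel_F \<alpha> 1 (- (x / 4)) * bessel_F \<alpha> 0 (- (y / 4)) - y * bessel_F \<alpha> 0 (- (x / 4)) * bessel_F \<alpha> 1 (- (y / 4))
    = (x - y) * bessel_integral \<alpha> x y"
proof -
  let ?F = "\<lambda>j x s. bessel_F \<alpha> j (- (x / 4) * s)"
  let ?W = "\<lambda>s. x * ?F 1 x s * ?F 0 y s - y * ?F 0 x s * ?F 1 y s"
  have d: "((\<lambda>s. ?F j x s) has_real_derivative ?F (Suc j) x s * - (x / 4)) (at s)" for j x s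
    by (rule DERIV_chain2[OF bessel_F_deriv[OF \<alpha>]]) (auto intro!: derivative_eq_intros)
  have ode: "- (x / 4) * s * ?F 2 x s = ?F 0 x s - (\<alpha> + 1) * ?F 1 x s" for x s
    using bessel_F_rec[OF \<alpha>, of "- (x / 4) * s" 0] by (simp add: numeral_2_eq_2)
  have "((\<lambda>s. (x - y) * (s powr \<alpha> * ?F 0 x s * ?F 0 y s)) has_integral 1 powr (\<alpha> + 1) * ?W 1 - 0 powr (\<alpha> + 1) * ?W 0) {0..1}"
  proof (rule fundamental_theorem_of_calculus_interior)
    \<comment> \<open>For negative \<alpha> the integrand is unbounded at 0, but the primitive is
      continuous there because \<open>\<alpha> + 1 > 0\<close>; derivatives are taken in the open
      interval only.\<close>
    show "continuous_on {0..1} (\<lambda>s. s powr (\<alpha> + 1) * ?W s)"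
      using \<alpha> by (intro continuous_intros continuous_on_powr') auto
    fix s :: real assume s: "s \<in> {0<..<1}"
    have "((\<lambda>s. s powr (\<alpha> + 1) * ?W s) has_real_derivative
       ((\<alpha> + 1) * s powr (\<alpha> + 1 - 1)) * ?W s + s powr (\<alpha> + 1) *
        (x * ((?F 2 x s * - (x / 4)) * ?F 0 y s + ?F 1 x s * (?F 1 y s * - (y / 4)))
         - y * ((?F 1 x s * - (x / 4)) * ?F 1 y s + ?F 0 x s * (?F 2 y s * - (y / 4))))) (at s)"
      using s d[of 0 x s] d[of 1 x s] d[of 0 y s] d[of 1 y s]
      by (auto intro!: derivative_eq_intros simp: numeral_2_eq_2 algebra_simps)
    also have "((\<alpha> + 1) * s powr (\<alpha> + 1 - 1)) * ?W s + s powr (\<alpha> + 1) *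
        (x * ((?F 2 x s * - (x / 4)) * ?F 0 y s + ?F 1 x s * (?F 1 y s * - (y / 4)))
         - y * ((?F 1 x s * - (x / 4)) * ?F 1 y s + ?F 0 x s * (?F 2 y s * - (y / 4))))
      = s powr \<alpha> * ((\<alpha> + 1) * ?W s + (x * (- (x / 4) * s * ?F 2 x s) * ?F 0 y s - y * ?F 0 x s * (- (y / 4) * s * ?F 2 y s)))"
      using s by (simp add: powr_add field_simps)
    also have "\<dots> = (x - y) * (s powr \<alpha> * ?F 0 x s * ?F 0 y s)"
      unfolding ode by (simp add: algebra_simps)
    finally show "((\<lambda>s. s powr (\<alpha> + 1) * ?W s) has_vector_derivative (x - y) * (s powr \<alpha> * ?F 0 x s * ?F 0 y s)) (at s)"
      by (simp add: has_real_derivative_iff_has_vector_derivative)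
  qed simp
  then have 0: "((\<lambda>s. (x - y) * (s powr \<alpha> * ?F 0 x s * ?F 0 y s)) has_integral ?W 1) {0..1}"
    using \<alpha> by simp
  have "((\<lambda>s. (x - y) * (s powr \<alpha> * ?F 0 x s * ?F 0 y s)) has_integral ?W 1) {0<..<1}"
  proof (rule has_integral_spike_set_eq[THEN iffD1, OF _ _ 0])
    show "negligible {s \<in> {0..1} - {0<..<1}. (x - y) * (s powr \<alpha> * ?F 0 x s * ?F 0 y s) \<noteq> 0}"
      by (rule negligible_subset[of "{0, 1}"]) (auto simp: less_le)
    show "negligible {s \<in> {0<..<1} - {0..1}. (x - y) * (s powr \<alpha> * ?F 0 x s * ?F 0 y s) \<noteq> 0}"
      by (rule negligible_subset[of "{}"]) auto
  qed
  then have "((\<lambda>s. if s \<in> {0<..<1} then (x - y) * (s powr \<alpha> * ?F 0 x s * ?F 0 y s) else 0) has_integral ?W 1) {0<..}"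
    by (subst has_integral_restrict) auto
  then have 1: "((\<lambda>s. (x - y) * (s powr \<alpha> * ?F 0 x s * (if s < 1 then ?F 0 y s else 0))) has_integral ?W 1) {0<..}"
    by (rule has_integral_cong[THEN iffD1, rotated]) auto
  have "set_integrable lborel {0<..} (\<lambda>s. s powr \<alpha> * ?F 0 x s * (if s < 1 then ?F 0 y s else 0))"
    using integrable_bessel_integral[OF \<alpha> tendsto_const tendsto_const, of x y]
    unfolding set_integrable_def by (subst (asm) integrable_restrict_space) auto
  from set_borel_integral_eq_integral[OF this]
  have 2: "((\<lambda>s. s powr \<alpha> * ?F 0 x s * (if s < 1 then ?F 0 y s else 0)) has_integral bessel_integral \<alpha> x y) {0<..}"
    unfolding bessel_integral_def set_lebesgue_integral_def
    by (subst integral_restrict_space) (auto simp: has_integral_iff)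
  from has_integral_unique[OF 1 has_integral_mult_right[OF 2, of "x - y"]] show ?thesis by simp
qed

lemma bessel_J_deriv:
  assumes \<alpha>: "\<alpha> > -1" and r: "r > 0"
  shows "r * deriv (bessel_J \<alpha>) r = (r / 2) powr \<alpha> * (\<alpha> * bessel_F \<alpha> 0 (- (r\<^sup>2 / 4)) - r\<^sup>2 / 2 * bessel_F \<alpha> 1 (- (r\<^sup>2 / 4)))"
proof -
  have "((\<lambda>r. bessel_F \<alpha> 0 (- (r\<^sup>2 / 4))) has_real_derivative bessel_F \<alpha> (Suc 0) (- (r\<^sup>2 / 4)) * - (r / 2)) (at r)"
    by (rule DERIV_chain2[OF bessel_F_deriv[OF \<alpha>]]) (auto intro!: derivative_eq_intros)
  then have "((\<lambda>r. (r / 2) powr \<alpha> * bessel_F \<alpha> 0 (- (r\<^sup>2 / 4))) has_real_derivative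
     (\<alpha> * (r / 2) powr (\<alpha> - 1) * (1 / 2)) * bessel_F \<alpha> 0 (- (r\<^sup>2 / 4)) + (r / 2) powr \<alpha> * (bessel_F \<alpha> 1 (- (r\<^sup>2 / 4)) * - (r / 2))) (at r)"
    using r by (auto intro!: derivative_eq_intros simp: algebra_simps)
  then have "(bessel_J \<alpha> has_real_derivative
     (\<alpha> * (r / 2) powr (\<alpha> - 1) * (1 / 2)) * bessel_F \<alpha> 0 (- (r\<^sup>2 / 4)) + (r / 2) powr \<alpha> * (bessel_F \<alpha> 1 (- (r\<^sup>2 / 4)) * - (r / 2))) (at r)"
    by (rule has_field_derivative_transform_within_open[where S = "{0<..}"])
      (use r bessel_J_eq[OF \<alpha>] in auto)
  then have 1: "deriv (bessel_J \<alpha>) r = (\<alpha> * (r / 2) powr (\<alpha> - 1) * (1 / 2)) * bessel_F \<alpha> 0 (- (r\<^sup>2 / 4)) + (r / 2) powr \<alpha> * (bessel_F \<alpha> 1 (- (r\<^sup>2 / 4)) * - (r / 2))"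
    by (rule DERIV_imp_deriv)
  have 2: "(r / 2) powr \<alpha> = (r / 2) powr (\<alpha> - 1) * (r / 2)"
    using r by (simp add: powr_diff)
  show ?thesis unfolding 1 2 by (simp add: algebra_simps power2_eq_square)
qed

text \<open>The way to evaluate both kernels on the diagonal: exhibit a jointly continuous formula
  that agrees off it.\<close>

lemma diag_extend_eq:
  fixes F H :: "real \<Rightarrow> real \<Rightarrow> 'a :: t2_space"
  assumes eq: "\<And>u v. 0 < u \<Longrightarrow> 0 < v \<Longrightarrow> u \<noteq> v \<Longrightarrow> F u v = H u v"
    and cont: "continuous_on ({0<..} \<times> {0<..}) (\<lambda>(u, v). H u v)"
    and pos: "x > 0" "y > 0"
  shows "diag_extend F x y = H x y"
proof (cases "x = y")
  case True
  let ?S = "{(u, v :: real). 0 < u \<and> 0 < v \<and> u \<noteq> v}"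
  have "((\<lambda>(u, v). H u v) \<longlongrightarrow> H x x) (at (x, x) within {0<..} \<times> {0<..})"
    using cont pos by (force simp: continuous_on_def)
  then have "((\<lambda>(u, v). H u v) \<longlongrightarrow> H x x) (at (x, x) within ?S)"
    by (rule tendsto_within_subset) auto
  then have "((\<lambda>(u, v). F u v) \<longlongrightarrow> H x x) (at (x, x) within ?S)"
    by (rule Lim_transform_eventually) (auto simp: eventually_at_filter eq intro!: always_eventually)
  \<comment> \<open>\<open>Lim\<close> picks out the limit only where limits are unique, that is, if
    the diagonal point can be approached from off the diagonal.\<close>
  moreover have "at (x, x) within ?S \<noteq> bot"
    unfolding trivial_limit_within islimpt_sequential not_not
  proof (intro exI conjI allI)
    show "(x + 1 / real (Suc n), x) \<in> ?S - {(x, x)}" for n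
      using pos by (auto intro!: add_pos_pos)
    have "(\<lambda>n. (x + 1 / real (Suc n), x)) \<longlonglongrightarrow> (x + 0, x)"
      by (intro tendsto_intros LIMSEQ_Suc lim_1_over_n)
    then show "(\<lambda>n. (x + 1 / real (Suc n), x)) \<longlonglongrightarrow> (x, x)" by simp
  qed
  ultimately show ?thesis
    using True unfolding diag_extend_def by (simp add: tendsto_Lim)
qed (use eq pos in \<open>simp add: diag_extend_def\<close>)

text \<open>The terms with the factor \<alpha> in the two derivatives cancel by antisymmetry. What
  remains is the Wronskian-type expression of \<open>bessel_integral_eq\<close>, whose factor
  \<open>x - y\<close> removes the denominator.\<close>

lemma bessel_limit_kernel_eq:
  assumes \<alpha>: "\<alpha> > -1" and pos: "x > 0" "y > 0"
  shows "bessel_limit_kernel \<alpha> x y = (y / 4) powr \<alpha> * bessel_integral \<alpha> x y / 4"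
  unfolding bessel_limit_kernel_def
proof (rule diag_extend_eq[where H = "\<lambda>x y. (y / 4) powr \<alpha> * bessel_integral \<alpha> x y / 4", OF _ _ pos])
  fix x y :: real assume pos: "x > 0" "y > 0" and "x \<noteq> y"
  have s: "(sqrt x)\<^sup>2 = x" "(sqrt y)\<^sup>2 = y" "sqrt x > 0" "sqrt y > 0" using pos by auto
  let ?F = "\<lambda>j x. bessel_F \<alpha> j (- (x / 4))"
  let ?J = "bessel_J \<alpha> (sqrt x) * sqrt y * deriv (bessel_J \<alpha>) (sqrt y) - sqrt x * deriv (bessel_J \<alpha>) (sqrt x) * bessel_J \<alpha> (sqrt y)"
  let ?p = "(sqrt x / 2) powr \<alpha> * (sqrt y / 2) powr \<alpha>"
  have "?J
    = bessel_J \<alpha> (sqrt x) * (sqrt y * deriv (bessel_J \<alpha>) (sqrt y)) - (sqrt x * deriv (bessel_J \<alpha>) (sqrt x)) * bessel_J \<alpha> (sqrt y)"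
    by (simp only: mult.assoc)
  also have "\<dots> = ?p / 2 * (x * ?F 1 x * ?F 0 y - y * ?F 0 x * ?F 1 y)"
    unfolding bessel_J_deriv[OF \<alpha> s(3)] bessel_J_deriv[OF \<alpha> s(4)] bessel_J_eq[OF \<alpha> s(3)] bessel_J_eq[OF \<alpha> s(4)] s
    by (simp add: algebra_simps)
  also have "\<dots> = ?p / 2 * ((x - y) * bessel_integral \<alpha> x y)"
    by (simp only: bessel_integral_eq[OF \<alpha>])
  finally have 0: "?J
      = ?p / 2 * ((x - y) * bessel_integral \<alpha> x y)" .
  have 1: "(?J)
      / (2 * (x - y)) = ?p / 4 * bessel_integral \<alpha> x y"
  proof -
    have "q / 2 * (d * B) / (2 * d) = q / 4 * B" if "d \<noteq> 0" for q d B :: real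
      using that by simp
    then show ?thesis unfolding 0 using \<open>x \<noteq> y\<close> by (metis right_minus_eq)
  qed
  have h: "sqrt z / 2 = (z / 4) powr (1 / 2)" if "z > 0" for z
    using that by (simp add: powr_half_sqrt real_sqrt_divide)
  have "(y / x) powr (\<alpha> / 2) * ?p = (y / x) powr (\<alpha> / 2) * ((x / 4) powr (\<alpha> / 2) * (y / 4) powr (\<alpha> / 2))"
    unfolding h[OF pos(1)] h[OF pos(2)] powr_powr by simp
  also have "\<dots> = ((y / x) * ((x / 4) * (y / 4))) powr (\<alpha> / 2)"
  proof -
    have "((y / x) * ((x / 4) * (y / 4))) powr (\<alpha> / 2) = (y / x) powr (\<alpha> / 2) * ((x / 4) * (y / 4)) powr (\<alpha> / 2)"
      by (rule powr_mult)
    moreover have "((x / 4) * (y / 4)) powr (\<alpha> / 2) = (x / 4) powr (\<alpha> / 2) * (y / 4) powr (\<alpha> / 2)"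
      by (rule powr_mult)
    ultimately show ?thesis by (simp only:)
  qed
  \<comment> \<open>Here \<open>x\<close> cancels: the asymmetric prefactor turns the symmetric
    power of \<open>x * y\<close> into a power of \<open>y\<close> alone.\<close>
  also have "(y / x) * ((x / 4) * (y / 4)) = (y / 4) powr 2"
    using pos by (simp add: power2_eq_square)
  also have "((y / 4) powr 2) powr (\<alpha> / 2) = (y / 4) powr \<alpha>" unfolding powr_powr by simp
  finally have 2: "(y / x) powr (\<alpha> / 2) * ?p = (y / 4) powr \<alpha>" .
  show "(y / x) powr (\<alpha> / 2) *
     ((?J)
      / (2 * (x - y))) = (y / 4) powr \<alpha> * bessel_integral \<alpha> x y / 4"
    unfolding 1 2[symmetric] by simp
next
  have "continuous_on ({0<..} \<times> {0<..}) (\<lambda>z. bessel_integral \<alpha> (fst z) (snd z))"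
    unfolding continuous_on_sequentially comp_def
    by (auto intro!: bessel_integral_tendsto \<alpha> tendsto_fst tendsto_snd
        simp: split_beta dest: tendsto_fst tendsto_snd)
  then show "continuous_on ({0<..} \<times> {0<..}) (\<lambda>(x, y). (y / 4) powr \<alpha> * bessel_integral \<alpha> x y / 4)"
    unfolding split_beta by (intro continuous_intros) auto
qed

text \<open>Replacing \<open>s\<close> by \<open>s / (1 - \<tau>)\<close> maps the interval of
  length \<open>1 - \<tau>\<close> onto (0,1). This fixes the arguments
  \<open>x / (4 * (1 - \<tau>))\<close>; the 4 is that of \<open>bessel_J_eq\<close>.\<close>

lemma dual_kernel_tendsto_bessel:
  assumes \<alpha>: "\<alpha> > -1" and \<tau>: "0 < \<tau>" "\<tau> < 1" and pos: "x > 0" "y > 0"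
  shows "(\<lambda>n. dual_kernel \<alpha> (real n * \<tau>) n (x / (4 * (1 - \<tau>)) / real n) (y / (4 * (1 - \<tau>)) / real n) / (4 * (1 - \<tau>) * real n))
    \<longlonglongrightarrow> bessel_limit_kernel \<alpha> x y"
proof -
  define \<rho> where "\<rho> = 1 - \<tau>"
  have \<rho>: "\<rho> > 0" using \<tau> by (simp add: \<rho>_def)
  define \<xi> where "\<xi> = x / (4 * \<rho>)"
  define \<eta> where "\<eta> = y / (4 * \<rho>)"
  let ?f = "\<lambda>s. s powr \<alpha> * bessel_F \<alpha> 0 (- \<xi> * s) * (if s < 1 - \<tau> then bessel_F \<alpha> 0 (- \<eta> * s) else 0)"
  let ?I = "\<integral>s. ?f s \<partial>pos_lborel"
  let ?g = "\<lambda>s. s powr \<alpha> * bessel_F \<alpha> 0 (- (x / 4) * s) * (if s < 1 then bessel_F \<alpha> 0 (- (y / 4) * s) else 0)"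
  have g: "has_pos_integral ?g (bessel_integral \<alpha> x y)"
    unfolding bessel_integral_def has_bochner_integral_iff
    using integrable_bessel_integral[OF \<alpha> tendsto_const tendsto_const, of x y] by simp
  have "has_pos_integral (\<lambda>s. \<rho> powr \<alpha> * ?g (1 / \<rho> * s)) (\<rho> powr \<alpha> * (bessel_integral \<alpha> x y /\<^sub>R (1 / \<rho>)))"
    using \<rho> by (intro has_bochner_integral_mult_right has_bochner_integral_pos_lborel_scale[OF g]) auto
  then have "(\<integral>s. \<rho> powr \<alpha> * ?g (1 / \<rho> * s) \<partial>pos_lborel) = \<rho> powr \<alpha> * (bessel_integral \<alpha> x y /\<^sub>R (1 / \<rho>))"
    by (rule has_bochner_integral_integral_eq)
  also have "(\<integral>s. \<rho> powr \<alpha> * ?g (1 / \<rho> * s) \<partial>pos_lborel) = ?I"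
  proof (rule Bochner_Integration.integral_cong[OF refl])
    fix s assume "s \<in> space pos_lborel"
    then have s: "s > 0" by (simp add: space_restrict_space)
    have "\<rho> powr \<alpha> * (1 / \<rho> * s) powr \<alpha> = (\<rho> * (1 / \<rho> * s)) powr \<alpha>"
      by (rule powr_mult[symmetric])
    then have "\<rho> powr \<alpha> * (1 / \<rho> * s) powr \<alpha> = s powr \<alpha>" using \<rho> by simp
    moreover have "1 / \<rho> * s < 1 \<longleftrightarrow> s < 1 - \<tau>" using \<rho> by (simp add: \<rho>_def)
    moreover have "- (x / 4) * (1 / \<rho> * s) = - \<xi> * s" "- (y / 4) * (1 / \<rho> * s) = - \<eta> * s"
      by (simp_all add: \<xi>_def \<eta>_def)
    ultimately show "\<rho> powr \<alpha> * ?g (1 / \<rho> * s) = ?f s" by (simp only: mult.assoc[symmetric])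
  qed
  finally have I: "?I = \<rho> powr \<alpha> * \<rho> * bessel_integral \<alpha> x y" using \<rho> by simp
  have "(\<eta> * \<rho>) powr \<alpha> = \<eta> powr \<alpha> * \<rho> powr \<alpha>"
    by (rule powr_mult)
  then have "\<eta> powr \<alpha> * \<rho> powr \<alpha> = (y / 4) powr \<alpha>" using \<rho> by (simp add: \<eta>_def)
  then have "\<eta> powr \<alpha> * ?I / (4 * \<rho>) = bessel_limit_kernel \<alpha> x y"
    unfolding I bessel_limit_kernel_eq[OF \<alpha> pos] using \<rho> by simp
  moreover have "(\<lambda>n. dual_kernel \<alpha> (real n * \<tau>) n (\<xi> / real n) (\<eta> / real n) / real n / (4 * \<rho>)) \<longlonglongrightarrow> \<eta> powr \<alpha> * ?I / (4 * \<rho>)"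
    using \<rho> pos by (intro tendsto_divide dual_kernel_tendsto \<alpha> \<tau> tendsto_const) (auto simp: \<xi>_def \<eta>_def)
  ultimately show ?thesis by (simp add: \<xi>_def \<eta>_def \<rho>_def mult_ac)
qed

section \<open>Functions on the slit plane\<close>

abbreviation slit_plane :: "complex set" where
  "slit_plane \<equiv> - \<real>\<^sub>\<ge>\<^sub>0"

lemma open_slit_plane: "open slit_plane"
  using closed_nonneg_Reals_complex by (simp add: open_Compl)

abbreviation at_upper :: "real \<Rightarrow> complex filter" where
  "at_upper x \<equiv> at (complex_of_real x) within {z. Im z > 0}"

abbreviation at_lower :: "real \<Rightarrow> complex filter" where
  "at_lower x \<equiv> at (complex_of_real x) within {z. Im z < 0}"

text \<open>The upper and lower boundary functions are explicit arguments, so sums and products act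
  on all three at once and \<open>slit_fun f p p\<close> expresses the absence of a jump.\<close>

definition slit_fun :: "(complex \<Rightarrow> complex) \<Rightarrow> (real \<Rightarrow> complex) \<Rightarrow> (real \<Rightarrow> complex) \<Rightarrow> bool" where
  "slit_fun f p q \<longleftrightarrow> f holomorphic_on slit_plane \<and>
     (\<forall>x>0. (f \<longlongrightarrow> p x) (at_upper x)) \<and>
     (\<forall>x>0. (f \<longlongrightarrow> q x) (at_lower x)) \<and>
     continuous_on {0<..} p \<and> continuous_on {0<..} q"

lemma slit_fun_holomorphic:
  assumes "g holomorphic_on U" "open U" "slit_plane \<subseteq> U" "\<And>x. x > 0 \<Longrightarrow> complex_of_real x \<in> U"
  shows "slit_fun g (\<lambda>x. g (of_real x)) (\<lambda>x. g (of_real x))"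
proof -
  have c: "isCont g (of_real x)" if "x > 0" for x
    using assms that by (meson continuous_on_eq_continuous_at holomorphic_on_imp_continuous_on)
  have "continuous_on {0<..} (\<lambda>x. g (of_real x))"
  proof (intro continuous_at_imp_continuous_on ballI)
    fix x :: real assume "x \<in> {0<..}"
    then show "isCont (\<lambda>x. g (of_real x)) x"
      using c by (intro isCont_o2[where f = of_real and g = g]) auto
  qed
  then show ?thesis
    unfolding slit_fun_def using assms(1,3) c
    by (auto intro: holomorphic_on_subset tendsto_within_subset[of _ _ _ UNIV] simp: isCont_def)
qed

lemma slit_fun_const: "slit_fun (\<lambda>z. c) (\<lambda>x. c) (\<lambda>x. c)"
  using slit_fun_holomorphic[of "\<lambda>z. c" UNIV] by simp

lemma slit_fun_ident: "slit_fun (\<lambda>z. z) (\<lambda>x. of_real x) (\<lambda>x. of_real x)"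
  using slit_fun_holomorphic[of "\<lambda>z. z" UNIV] by simp

lemma slit_fun_add:
  "slit_fun f p q \<Longrightarrow> slit_fun f' p' q' \<Longrightarrow> slit_fun (\<lambda>z. f z + f' z) (\<lambda>x. p x + p' x) (\<lambda>x. q x + q' x)"
  unfolding slit_fun_def by (auto intro!: holomorphic_intros tendsto_intros continuous_intros)

lemma slit_fun_diff:
  "slit_fun f p q \<Longrightarrow> slit_fun f' p' q' \<Longrightarrow> slit_fun (\<lambda>z. f z - f' z) (\<lambda>x. p x - p' x) (\<lambda>x. q x - q' x)"
  unfolding slit_fun_def by (auto intro!: holomorphic_intros tendsto_intros continuous_intros)

lemma slit_fun_mult:
  "slit_fun f p q \<Longrightarrow> slit_fun f' p' q' \<Longrightarrow> slit_fun (\<lambda>z. f z * f' z) (\<lambda>x. p x * p' x) (\<lambda>x. q x * q' x)"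
  unfolding slit_fun_def by (auto intro!: holomorphic_intros tendsto_intros continuous_intros)

lemmas slit_fun_intros = slit_fun_const slit_fun_ident slit_fun_add slit_fun_diff slit_fun_mult

lemma half_planes_nontrivial:
  "at_upper x \<noteq> bot"
  "at_lower x \<noteq> bot"
proof -
  have seq: "(\<lambda>n. complex_of_real x + complex_of_real c * \<i> * of_real (1 / real (Suc n))) \<longlonglongrightarrow> complex_of_real x + complex_of_real c * \<i> * of_real 0" for c
    by (intro tendsto_intros LIMSEQ_Suc lim_1_over_n)
  show "at_upper x \<noteq> bot"
    unfolding trivial_limit_within islimpt_sequential not_not
  proof (intro exI conjI allI)
    show "(\<lambda>n. complex_of_real x + complex_of_real 1 * \<i> * of_real (1 / real (Suc n))) \<longlonglongrightarrow> complex_of_real x"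
      using seq[of 1] by simp
  qed (auto simp: complex_eq_iff)
  show "at_lower x \<noteq> bot"
    unfolding trivial_limit_within islimpt_sequential not_not
  proof (intro exI conjI allI)
    show "(\<lambda>n. complex_of_real x + complex_of_real (- 1) * \<i> * of_real (1 / real (Suc n))) \<longlonglongrightarrow> complex_of_real x"
      using seq[of "-1"] by simp
  qed (auto simp: complex_eq_iff)
qed

text \<open>Growth conditions are stated off the cut only; passing to the limit extends them to the
  boundary values. The radii form an open set so that they persist near the boundary point.\<close>

lemma slit_fun_bdry_bound:
  assumes f: "slit_fun f p q"
    and B: "\<And>z. z \<in> slit_plane \<Longrightarrow> cmod z \<in> A \<Longrightarrow> cmod (f z) \<le> B" and A: "open A" "x \<in> A" "x > 0"
  shows "cmod (p x) \<le> B" "cmod (q x) \<le> B"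
proof -
  have "isCont cmod (complex_of_real x)" by simp
  then have "(cmod \<longlongrightarrow> x) (at (complex_of_real x))" using A by (simp add: isCont_def)
  then have ev: "eventually (\<lambda>z. cmod z \<in> A) (at (complex_of_real x))"
    using A by (metis topological_tendstoD)
  have ev1: "eventually (\<lambda>z. cmod (f z) \<le> B) (at (complex_of_real x) within S)"
    if "\<And>z. z \<in> S \<Longrightarrow> Im z \<noteq> 0" for S
  proof -
    have "eventually (\<lambda>z. cmod z \<in> A) (at (complex_of_real x) within S)"
      using ev by (rule filter_leD[OF at_le, rotated]) simp
    moreover have "eventually (\<lambda>z. z \<in> S) (at (complex_of_real x) within S)"
      by (auto simp: eventually_at_filter)
    ultimately show ?thesis
      by eventually_elim (use that B in \<open>auto simp: complex_nonneg_Reals_iff\<close>)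
  qed
  show "cmod (p x) \<le> B"
    using f A(3) half_planes_nontrivial(1)[of x]
    by (intro tendsto_upperbound[OF tendsto_norm ev1]) (auto simp: slit_fun_def)
  show "cmod (q x) \<le> B"
    using f A(3) half_planes_nontrivial(2)[of x]
    by (intro tendsto_upperbound[OF tendsto_norm ev1]) (auto simp: slit_fun_def)
qed

text \<open>Without a jump the function continues analytically across the cut, the singularity at 0
  is removable because it is weaker than a simple pole, and Liouville's theorem applies to the
  entire extension.\<close>

lemma slit_fun_polynomial:
  assumes f: "slit_fun f p p"
    and zero: "((\<lambda>z. z * f z) \<longlongrightarrow> 0) (at 0 within slit_plane)"
    and inf: "f \<in> O[inf at_infinity (principal slit_plane)](\<lambda>z. z ^ m)"
  shows "\<exists>r. degree r \<le> m \<and> (\<forall>z\<in>slit_plane. f z = poly r z) \<and> (\<forall>x>0. p x = poly r (of_real x))"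
proof -
  define g where "g = (\<lambda>z. if z \<in> slit_plane then f z else p (Re z))"
  have g_p: "g (of_real x) = p x" if "x > 0" for x
    using that by (simp add: g_def)
  have hol_D: "g holomorphic_on slit_plane"
    using f by (subst holomorphic_cong[of _ _ _ f]) (auto simp: g_def slit_fun_def)
  have g_at: "isCont g (of_real x)" if x: "x > 0" for x
  proof -
    have "(f \<longlongrightarrow> p x) (at_upper x)"
      using f x by (auto simp: slit_fun_def)
    then have 1: "(g \<longlongrightarrow> p x) (at_upper x)"
      by (rule Lim_transform_eventually) (auto simp: eventually_at_filter g_def complex_nonneg_Reals_iff intro!: always_eventually)
    have "(f \<longlongrightarrow> p x) (at_lower x)"
      using f x by (auto simp: slit_fun_def)
    then have 2: "(g \<longlongrightarrow> p x) (at_lower x)"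
      by (rule Lim_transform_eventually) (auto simp: eventually_at_filter g_def complex_nonneg_Reals_iff intro!: always_eventually)
    have "isCont p x"
      using f x by (auto simp: slit_fun_def continuous_on_eq_continuous_at)
    then have "isCont (\<lambda>z. p (Re z)) (complex_of_real x)"
      by (intro isCont_o2[where f = Re and g = p]) auto
    then have "((\<lambda>z. p (Re z)) \<longlongrightarrow> p x) (at (complex_of_real x) within {z. Im z = 0})"
      by (auto simp: isCont_def intro: tendsto_within_subset)
    moreover have "eventually (\<lambda>z. p (Re z) = g z) (at (complex_of_real x) within {z. Im z = 0})"
    proof -
      have "eventually (\<lambda>z. Re z > 0) (nhds (complex_of_real x))"
        using x by (intro eventually_nhds_in_open[of "{z. Re z > 0}", simplified] open_halfspace_Re_gt) auto
      then show ?thesis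
        unfolding eventually_at_filter by eventually_elim (auto simp: g_def complex_nonneg_Reals_iff)
    qed
    ultimately have 3: "(g \<longlongrightarrow> p x) (at (of_real x) within {z. Im z = 0})"
      by (rule Lim_transform_eventually)
    have "(g \<longlongrightarrow> p x) (at (of_real x) within ({z. Im z > 0} \<union> {z. Im z < 0}) \<union> {z. Im z = 0})"
      by (intro Lim_Un 1 2 3)
    also have "({z. Im z > 0} \<union> {z. Im z < 0}) \<union> {z. Im z = 0} = UNIV" by auto
    finally show ?thesis using g_p[OF x] by (simp add: isCont_def)
  qed
  let ?S = "{z. Re z > 0}"
  \<comment> \<open>Morera's argument: continuity on the real line joins the two holomorphic halves.
    The right half-plane and the slit plane together cover everything but 0.\<close>
  have "g holomorphic_on ?S"
  proof (rule holomorphic_on_paste_across_line[where d = \<i> and k = 0])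
    show "open ?S" by (rule open_halfspace_Re_gt)
    show "g holomorphic_on ?S \<inter> {z. \<i> \<bullet> z < 0}" "g holomorphic_on ?S \<inter> {z. 0 < \<i> \<bullet> z}"
      by (rule holomorphic_on_subset[OF hol_D]; force simp: complex_nonneg_Reals_iff inner_complex_def)+
    have "isCont g z" if "Re z > 0" for z
    proof (cases "Im z = 0")
      case True
      then have "complex_of_real (Re z) = z" by (simp add: complex_eq_iff)
      then show ?thesis using g_at[OF that] by simp
    next
      case False
      then show ?thesis
        using holomorphic_on_imp_continuous_on[OF hol_D] open_slit_plane
        by (simp add: continuous_on_eq_continuous_at complex_nonneg_Reals_iff)
    qed
    then show "continuous_on ?S g"
      by (intro continuous_at_imp_continuous_on) auto
  qed auto
  then have "g holomorphic_on slit_plane \<union> ?S"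
    by (intro holomorphic_on_Un hol_D open_slit_plane open_halfspace_Re_gt)
  moreover have "slit_plane \<union> ?S = UNIV - {0}"
    by (auto simp: complex_nonneg_Reals_iff complex_eq_iff)
  ultimately have hol: "g holomorphic_on UNIV - {0}" by simp
  have "((\<lambda>z. (z - 0) * g z) \<longlongrightarrow> 0) (at 0)"
    unfolding tendsto_iff
  proof (intro allI impI)
    fix e :: real assume e: "e > 0"
    \<comment> \<open>Half of \<open>e\<close>, because the strict bound becomes a weak one when it
      passes to the boundary values on the cut.\<close>
    from zero have "eventually (\<lambda>z. dist (z * f z) 0 < e / 2) (at 0 within slit_plane)"
      using e unfolding tendsto_iff by (meson half_gt_zero)
    then obtain d where d: "d > 0" and d': "\<And>z. z \<in> slit_plane \<Longrightarrow> z \<noteq> 0 \<Longrightarrow> cmod z < d \<Longrightarrow> cmod (z * f z) < e / 2"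
      unfolding eventually_at by (auto simp: dist_norm)
    have d2: "cmod (z * f z) < e / 2" if "z \<in> slit_plane" "cmod z < d" for z
      using d'[of z] that by (cases "z = 0") auto
    have "cmod (z * g z) < e" if z: "z \<noteq> 0" "cmod z < d" for z
    proof (cases "z \<in> slit_plane")
      case True
      then show ?thesis using d2[of z] z e by (simp add: g_def)
    next
      case False
      then have zr: "z = of_real (Re z)" "Re z > 0"
        using z by (auto simp: complex_nonneg_Reals_iff complex_eq_iff)
      have "slit_fun (\<lambda>z. z * f z) (\<lambda>x. of_real x * p x) (\<lambda>x. of_real x * p x)"
        by (intro slit_fun_intros f)
      then have "cmod (of_real (Re z) * p (Re z)) \<le> e / 2"
      proof (rule slit_fun_bdry_bound(1)[where A = "{..<d}"])
        show "Re z \<in> {..<d}" using z zr by (metis complex_Re_le_cmod le_less_trans lessThan_iff)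
      qed (use less_imp_le[OF d2] zr in auto)
      then show ?thesis using zr e g_p[of "Re z"] by (metis field_sum_of_halves le_less_trans less_add_same_cancel1 half_gt_zero)
    qed
    then show "eventually (\<lambda>z. dist ((z - 0) * g z) 0 < e) (at 0)"
      unfolding eventually_at using d by (auto simp: dist_norm)
  qed
  with hol obtain G where G: "G holomorphic_on UNIV" "\<And>z. z \<noteq> 0 \<Longrightarrow> G z = g z"
    using holomorphic_on_extend_lim[of g UNIV 0] by auto
  from inf obtain C where "eventually (\<lambda>z. cmod (f z) \<le> C * cmod (z ^ m)) (inf at_infinity (principal slit_plane))"
    by (auto elim!: landau_o.bigE)
  then obtain A where A: "\<And>z. cmod z \<ge> A \<Longrightarrow> z \<in> slit_plane \<Longrightarrow> cmod (f z) \<le> C * cmod z ^ m"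
    unfolding eventually_inf_principal eventually_at_infinity by (auto simp: norm_power)
  have "cmod (G z) \<le> C * cmod z ^ m" if z: "cmod z \<ge> max A 0 + 1" for z
  proof -
    have z0: "z \<noteq> 0" using z by auto
    show ?thesis
    proof (cases "z \<in> slit_plane")
      case True
      then show ?thesis using A[of z] z G(2)[OF z0] by (simp add: g_def)
    next
      case False
      then have zr: "z = of_real (Re z)" "Re z > 0"
        using z0 by (auto simp: complex_nonneg_Reals_iff complex_eq_iff)
      have cz: "cmod z = Re z" using zr by (metis norm_of_real abs_of_pos)
      \<comment> \<open>Division by \<open>z ^ m\<close> makes the growth bound constant, the form
        in which it passes to the cut.\<close>
      have "slit_fun (\<lambda>z. inverse (z ^ m)) (\<lambda>x. inverse (of_real x ^ m)) (\<lambda>x. inverse (of_real x ^ m))"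
        by (rule slit_fun_holomorphic[where U = "UNIV - {0}"]) (auto intro!: holomorphic_intros)
      from slit_fun_mult[OF f this] have "cmod (p (Re z) * inverse (of_real (Re z) ^ m)) \<le> C"
      proof (rule slit_fun_bdry_bound(1)[where A = "{max A 0<..}"])
        fix w :: complex assume w: "w \<in> slit_plane" "cmod w \<in> {max A 0<..}"
        then have "w \<noteq> 0" by auto
        then show "cmod (f w * inverse (w ^ m)) \<le> C"
          using A[of w] w by (simp add: norm_divide norm_power divide_le_eq flip: divide_inverse)
      qed (use z zr cz in auto)
      then have "cmod (p (Re z)) \<le> C * Re z ^ m"
        using zr(2) by (simp add: norm_divide norm_power divide_le_eq flip: divide_inverse)
      then show ?thesis using G(2)[OF z0] g_p[OF zr(2)] zr(1) cz by metis
    qed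
  qed
  then have L: "G z = (\<Sum>k\<le>m. (deriv ^^ k) G 0 / fact k * z ^ k)" for z
    by (rule Liouville_polynomial[OF G(1)])
  define r where "r = (\<Sum>k\<le>m. monom ((deriv ^^ k) G 0 / fact k) k)"
  have r: "poly r z = G z" for z
    unfolding r_def L[of z] by (simp add: poly_sum poly_monom)
  have "degree r \<le> m"
    unfolding r_def by (intro degree_sum_le) (auto intro: order.trans[OF degree_monom_le])
  moreover have "f z = poly r z" if "z \<in> slit_plane" for z
    using G(2)[of z] that r[of z] by (cases "z = 0") (auto simp: g_def)
  moreover have "p x = poly r (of_real x)" if "x > 0" for x
    using G(2)[of "of_real x"] that r[of "of_real x"] g_p[of x] by auto
  ultimately show ?thesis by blast
qed

section \<open>Integration along the cut in logarithmic coordinates\<close>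

lemma exp_in_slit_plane:
  assumes "0 < Im z" "Im z < 2 * pi"
  shows "exp z \<in> slit_plane"
proof
  assume "exp z \<in> \<real>\<^sub>\<ge>\<^sub>0"
  then have "exp z = of_real (cmod (exp z))"
    by (auto elim!: nonneg_Reals_cases simp del: norm_exp_eq_Re)
  then have "exp z = exp (of_real (Re z))" by (simp add: exp_of_real)
  then obtain n :: int where "z = of_real (Re z) + of_real (of_int (2 * n) * pi) * \<i>"
    by (auto simp: exp_eq)
  then have "Im z = Im (of_real (Re z) + of_real (of_int (2 * n) * pi) * \<i>)" by (rule arg_cong)
  then have "Im z = of_int (2 * n) * pi" by simp
  then have "Im z = 2 * (of_int n * pi)" by simp
  then have "0 * pi < of_int n * pi" "of_int n * pi < 1 * pi" using assms by linarith+
  then have "(0 :: real) < of_int n" "of_int n < (1 :: real)"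
    by (simp_all only: mult_less_cancel_right_pos[OF pi_gt_zero])
  then show False by simp
qed

lemma contour_integral_horizontal:
  fixes F :: "complex \<Rightarrow> complex"
  assumes "a < b" "continuous_on {a..b} (\<lambda>s. F (Complex s m))"
  shows "contour_integral (linepath (Complex a m) (Complex b m)) F = integral {a..b} (\<lambda>s. F (Complex s m))"
proof -
  let ?g = "\<lambda>t. a + t * (b - a)"
  have "((\<lambda>t. (b - a) *\<^sub>R F (Complex (?g t) m)) has_integral integral {?g 0..?g 1} (\<lambda>s. F (Complex s m))) {0..1}"
  proof (rule has_integral_substitution[where c = a and d = b])
    show "?g ` {0..1} \<subseteq> {a..b}"
    proof
      fix s assume "s \<in> ?g ` {0..1}"
      then obtain t where t: "0 \<le> t" "t \<le> 1" "s = ?g t" by auto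
      have "?g t \<le> a + 1 * (b - a)" using t assms by (intro add_left_mono mult_right_mono) auto
      then have "a \<le> ?g t" "?g t \<le> b" using t assms by auto
      then show "s \<in> {a..b}" unfolding t(3) atLeastAtMost_iff ..
    qed
  qed (use assms in \<open>auto intro!: derivative_eq_intros\<close>)
  moreover have "linepath (Complex a m) (Complex b m) t = Complex (?g t) m" for t
    by (simp add: linepath_def complex_eq_iff algebra_simps)
  moreover have "Complex b m - Complex a m = of_real (b - a)" by (simp add: complex_eq_iff)
  ultimately have "(F has_contour_integral integral {a..b} (\<lambda>s. F (Complex s m))) (linepath (Complex a m) (Complex b m))"
    unfolding has_contour_integral_linepath by (simp add: scaleR_conv_of_real mult.commute)
  then show ?thesis by (rule contour_integral_unique)
qed

lemma contour_integral_bound_const: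
  fixes F :: "complex \<Rightarrow> complex"
  assumes F: "continuous_on (closed_segment a b) F"
    and B: "\<And>z. z \<in> closed_segment a b \<Longrightarrow> cmod (F z - c) \<le> e" and e: "e \<ge> 0"
  shows "cmod (contour_integral (linepath a b) F - c * (b - a)) \<le> e * cmod (b - a)"
proof -
  have "(F has_contour_integral contour_integral (linepath a b) F) (linepath a b)"
    using F by (intro has_contour_integral_integral contour_integrable_continuous_linepath)
  moreover have "((\<lambda>z. c) has_contour_integral c * (b - a)) (linepath a b)"
    using has_contour_integral_const_linepath by blast
  ultimately have "((\<lambda>z. F z - c) has_contour_integral contour_integral (linepath a b) F - c * (b - a)) (linepath a b)"
    by (rule has_contour_integral_diff)
  then show ?thesis
    by (rule has_contour_integral_bound_linepath[OF _ e B])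
qed

text \<open>The pullback of \<open>f z dz\<close> under \<open>exp\<close>, with
  \<open>exp z\<close> as Jacobian. The two sides of the cut become the edges
  \<open>Im z = 0\<close> and \<open>Im z = 2 * pi\<close>, so a keyhole contour becomes a rectangle
  on which the function is continuous up to the edges.\<close>

definition strip_fun :: "(complex \<Rightarrow> complex) \<Rightarrow> (real \<Rightarrow> complex) \<Rightarrow> (real \<Rightarrow> complex) \<Rightarrow> complex \<Rightarrow> complex" where
  "strip_fun f p q z = exp z *
     (if Im z = 0 then p (exp (Re z)) else if Im z = 2 * pi then q (exp (Re z)) else f (exp z))"

lemma exp_bottom: "Im z = 0 \<Longrightarrow> exp z = of_real (exp (Re z))"
  and exp_top: "Im z = 2 * pi \<Longrightarrow> exp z = of_real (exp (Re z))"
  by (simp_all add: exp_eq_polar cis.ctr complex_eq_iff)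

lemma strip_fun_differentiable:
  assumes f: "slit_fun f p q" and z: "0 < Im z" "Im z < 2 * pi"
  shows "strip_fun f p q field_differentiable at z"
proof -
  let ?S = "{z. 0 < Im z \<and> Im z < 2 * pi}"
  have "open ?S"
    by (simp add: Collect_conj_eq open_Int open_halfspace_Im_gt open_halfspace_Im_lt)
  have "(\<lambda>z. exp z * (f \<circ> exp) z) holomorphic_on ?S"
    using f exp_in_slit_plane
    by (intro holomorphic_intros holomorphic_on_compose_gen[where t = slit_plane]) (auto simp: slit_fun_def)
  then have "strip_fun f p q holomorphic_on ?S"
    by (rule holomorphic_transform) (auto simp: strip_fun_def)
  then show ?thesis
    using \<open>open ?S\<close> z by (simp add: holomorphic_on_imp_differentiable_at)
qed

text \<open>An edge point is approached from inside the strip, where the boundary limit of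
  \<open>f\<close> applies, and along the edge, where continuity of the boundary function
  applies.\<close>

lemma tendsto_strip_edge:
  fixes F f :: "complex \<Rightarrow> complex"
  assumes lim: "(f \<longlongrightarrow> r (exp (Re z))) (at (exp z) within H)" and r: "isCont r (exp (Re z))"
    and T: "\<And>w. w \<in> T \<Longrightarrow> exp w \<in> H \<and> exp w \<noteq> exp z \<and> F w = exp w * f (exp w)"
    and L: "\<And>w. w \<in> L \<Longrightarrow> F w = exp w * r (exp (Re w))" "z \<in> L"
    and S: "at z within S = at z within (T \<union> L)"
  shows "(F \<longlongrightarrow> F z) (at z within S)"
proof -
  have texp: "(exp \<longlongrightarrow> exp z) (at z within A)" for A
    by (intro tendsto_intros)
  have ev: "eventually (\<lambda>w. w \<in> A) (at z within A)" for A
    by (auto simp: eventually_at_filter)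
  have "eventually (\<lambda>w. exp w \<in> H \<and> exp w \<noteq> exp z) (at z within T)"
    using ev[of T] by eventually_elim (simp add: T)
  with texp have "filterlim exp (at (exp z) within H) (at z within T)"
    unfolding filterlim_at by blast
  from tendsto_mult[OF texp filterlim_compose[OF lim this]]
  have "((\<lambda>w. exp w * f (exp w)) \<longlongrightarrow> F z) (at z within T)"
    by (simp add: L)
  then have A: "(F \<longlongrightarrow> F z) (at z within T)"
    by (rule Lim_transform_eventually) (use ev[of T] in \<open>eventually_elim, simp add: T\<close>)
  have "((\<lambda>w. r (exp (Re w))) \<longlongrightarrow> r (exp (Re z))) (at z within L)"
    by (rule isCont_tendsto_compose[OF r]) (intro tendsto_intros)
  from tendsto_mult[OF texp this]
  have "((\<lambda>w. exp w * r (exp (Re w))) \<longlongrightarrow> F z) (at z within L)"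
    by (simp add: L)
  then have B: "(F \<longlongrightarrow> F z) (at z within L)"
    by (rule Lim_transform_eventually) (use ev[of L] in \<open>eventually_elim, simp add: L\<close>)
  show ?thesis unfolding S by (rule Lim_Un[OF A B])
qed

lemma strip_fun_continuous:
  assumes f: "slit_fun f p q"
  shows "continuous_on {z. 0 \<le> Im z \<and> Im z \<le> 2 * pi} (strip_fun f p q)"
  unfolding continuous_on_def
proof
  let ?S = "{z. 0 \<le> Im z \<and> Im z \<le> 2 * pi}"
  let ?F = "strip_fun f p q"
  fix z assume z: "z \<in> ?S"
  consider "0 < Im z \<and> Im z < 2 * pi" | "Im z = 0" | "Im z = 2 * pi" using z by fastforce
  then show "(?F \<longlongrightarrow> ?F z) (at z within ?S)"
  proof cases
    case 1
    then have "isCont ?F z"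
      using strip_fun_differentiable[OF f] by (auto intro: field_differentiable_imp_continuous_at)
    then show ?thesis by (auto simp: isCont_def intro: tendsto_within_subset)
  next
    case 2
    \<comment> \<open>Only the lower half of the strip: there \<open>exp\<close> lands in the upper
      half-plane.\<close>
    let ?T = "{z. 0 < Im z \<and> Im z < pi}" and ?L = "{w. Im w = 0}"
    show ?thesis
    proof (rule tendsto_strip_edge[where H = "{z. Im z > 0}" and T = ?T and L = ?L])
      show "(f \<longlongrightarrow> p (exp (Re z))) (at (exp z) within {z. Im z > 0})" "isCont p (exp (Re z))"
        using f by (auto simp: slit_fun_def exp_bottom[OF 2] continuous_on_eq_continuous_at)
      show "exp w \<in> {z. Im z > 0} \<and> exp w \<noteq> exp z \<and> ?F w = exp w * f (exp w)" if "w \<in> ?T" for w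
      proof -
        have "Im (exp w) > 0" using that by (simp add: Im_exp sin_gt_zero)
        moreover have "Im (exp z) = 0" by (simp add: exp_bottom[OF 2])
        ultimately show ?thesis using that by (auto simp: strip_fun_def)
      qed
      show "at z within ?S = at z within (?T \<union> ?L)"
        by (rule at_within_nhd[of z "{w. Im w < pi}"]) (use 2 in \<open>auto simp: open_halfspace_Im_lt\<close>)
    qed (use 2 in \<open>auto simp: strip_fun_def\<close>)
  next
    case 3
    \<comment> \<open>The upper half of the strip is mapped into the lower half-plane.\<close>
    let ?T = "{z. pi < Im z \<and> Im z < 2 * pi}" and ?L = "{w. Im w = 2 * pi}"
    show ?thesis
    proof (rule tendsto_strip_edge[where H = "{z. Im z < 0}" and T = ?T and L = ?L])
      show "(f \<longlongrightarrow> q (exp (Re z))) (at (exp z) within {z. Im z < 0})" "isCont q (exp (Re z))"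
        using f by (auto simp: slit_fun_def exp_top[OF 3] continuous_on_eq_continuous_at)
      show "exp w \<in> {z. Im z < 0} \<and> exp w \<noteq> exp z \<and> ?F w = exp w * f (exp w)" if "w \<in> ?T" for w
      proof -
        have "Im (exp w) < 0" using that by (simp add: Im_exp mult_less_0_iff sin_lt_zero)
        moreover have "Im (exp z) = 0" by (simp add: exp_top[OF 3])
        ultimately show ?thesis using that by (auto simp: strip_fun_def)
      qed
      show "at z within ?S = at z within (?T \<union> ?L)"
        by (rule at_within_nhd[of z "{w. Im w > pi}"]) (use 3 in \<open>auto simp: open_halfspace_Im_gt\<close>)
    qed (use 3 in \<open>auto simp: strip_fun_def\<close>)
  qed
qed

lemma strip_fun_bound:
  assumes f: "slit_fun f p q"
    and B: "\<And>z. z \<in> slit_plane \<Longrightarrow> cmod z \<in> A \<Longrightarrow> cmod (z * f z - c) \<le> e"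
    and A: "open A" "exp (Re z) \<in> A" and z: "0 \<le> Im z" "Im z \<le> 2 * pi"
  shows "cmod (strip_fun f p q z - c) \<le> e"
proof -
  have "slit_fun (\<lambda>z. z * f z - c) (\<lambda>x. of_real x * p x - c) (\<lambda>x. of_real x * q x - c)"
    by (intro slit_fun_intros f)
  note bd = slit_fun_bdry_bound[OF this B A(1,2)]
  consider "0 < Im z \<and> Im z < 2 * pi" | "Im z = 0" | "Im z = 2 * pi" using z by fastforce
  then show ?thesis
  proof cases
    case 1
    then show ?thesis using B[OF exp_in_slit_plane[of z]] A by (auto simp: strip_fun_def)
  next
    case 2
    then show ?thesis using bd(1) exp_bottom[of z] by (simp add: strip_fun_def)
  next
    case 3
    then show ?thesis using bd(2) exp_top[of z] by (simp add: strip_fun_def)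
  qed
qed

lemma integral_exp_substitution:
  fixes p :: "real \<Rightarrow> complex"
  assumes "continuous_on {0<..} p" "T > 0"
  shows "integral {-T..T} (\<lambda>s. of_real (exp s) * p (exp s)) = integral {exp (-T)..exp T} p"
proof -
  have "((\<lambda>s. exp s *\<^sub>R p (exp s)) has_integral integral {exp (-T)..exp T} p) {-T..T}"
  proof (rule has_integral_substitution[where c = "exp (-T)" and d = "exp T"])
    show "continuous_on {exp (- T)..exp T} p"
      by (rule continuous_on_subset[OF assms(1)]) (auto intro: less_le_trans[OF exp_gt_zero])
    show "(exp has_field_derivative exp x) (at x within {- T..T})" for x
      by (intro derivative_eq_intros) auto
  qed (use assms(2) in auto)
  then show ?thesis by (simp add: scaleR_conv_of_real integral_unique)
qed

text \<open>Cauchy's theorem on the rectangle of width \<open>2 * T\<close> and height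
  \<open>2 * pi\<close>. The horizontal sides give the truncated integrals of \<open>p\<close> and
  of \<open>q\<close> with opposite orientation, the right side tends to
  \<open>2 * pi * \<i> * c\<close>, and the left side tends to 0.\<close>

lemma slit_fun_jump_integral:
  assumes f: "slit_fun f p q"
    and zero: "((\<lambda>z. z * f z) \<longlongrightarrow> 0) (at 0 within slit_plane)"
    and inf: "((\<lambda>z. z * f z) \<longlongrightarrow> c) (inf at_infinity (principal slit_plane))"
    and int: "integrable pos_lborel (\<lambda>x. p x - q x)"
  shows "(\<integral>x. p x - q x \<partial>pos_lborel) = - 2 * pi * \<i> * c"
proof -
  let ?I = "\<lambda>n :: nat. {exp (- real n)..exp (real n)}"
  let ?F = "strip_fun f p q"
  let ?C = "\<lambda>a b. contour_integral (linepath a b) ?F"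
  let ?J = "\<lambda>T p. integral {exp (-T)..exp T} p"
  have pc: "continuous_on {0<..} p" and qc: "continuous_on {0<..} q"
    using f by (auto simp: slit_fun_def)
  have bound: "eventually (\<lambda>T. cmod (?J T p - ?J T q + 2 * pi * \<i> * c) \<le> e) at_top"
    if e: "e > 0" for e
  proof -
    \<comment> \<open>Each of the two vertical sides has length \<open>2 * pi\<close>, so an error
      \<open>d\<close> on both adds up to \<open>e\<close>.\<close>
    define d where "d = e / (4 * pi)"
    have d: "d > 0" using e by (simp add: d_def)
    from inf d have "eventually (\<lambda>z. dist (z * f z) c < d) (inf at_infinity (principal slit_plane))"
      unfolding tendsto_iff by blast
    then obtain A where A: "\<And>z. cmod z \<ge> A \<Longrightarrow> z \<in> slit_plane \<Longrightarrow> cmod (z * f z - c) < d"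
      unfolding eventually_inf_principal eventually_at_infinity by (auto simp: dist_norm)
    from zero d have "eventually (\<lambda>z. dist (z * f z) 0 < d) (at 0 within slit_plane)"
      unfolding tendsto_iff by blast
    then obtain r where r: "r > 0" and r': "\<And>z. z \<in> slit_plane \<Longrightarrow> z \<noteq> 0 \<Longrightarrow> cmod z < r \<Longrightarrow> cmod (z * f z - 0) < d"
      unfolding eventually_at by (auto simp: dist_norm)
    have "eventually (\<lambda>T. T > 0 \<and> exp T > A \<and> exp (- T) < r) at_top"
    proof (intro eventually_conj eventually_gt_at_top)
      show "eventually (\<lambda>T. A < exp T) at_top"
        using exp_at_top by (simp add: filterlim_at_top_dense)
      have "((\<lambda>T. exp (- T)) \<longlongrightarrow> (0 :: real)) at_top"
        using exp_at_bot filterlim_uminus_at_bot_at_top filterlim_compose by blast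
      then show "eventually (\<lambda>T. exp (- T) < r) at_top"
        using r by (rule order_tendstoD(2))
    qed
    then show ?thesis
    proof eventually_elim
      case (elim T)
      let ?a = "Complex (- T) 0" and ?b = "Complex T 0" and ?c = "Complex T (2 * pi)" and ?d = "Complex (- T) (2 * pi)"
      let ?R = "cbox ?a ?c"
      have RS: "?R \<subseteq> {z. 0 \<le> Im z \<and> Im z \<le> 2 * pi}" by (auto simp: in_cbox_complex_iff)
      have cont: "continuous_on ?R ?F"
        by (rule continuous_on_subset[OF strip_fun_continuous[OF f] RS])
      have path: "path_image (rectpath ?a ?c) \<subseteq> ?R"
        using elim by (intro path_image_rectpath_subset_cbox) auto
      have seg: "closed_segment ?a ?b \<subseteq> ?R" "closed_segment ?b ?c \<subseteq> ?R" "closed_segment ?d ?c \<subseteq> ?R" "closed_segment ?d ?a \<subseteq> ?R"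
        by (intro closed_segment_subset convex_box; use elim in \<open>simp add: in_cbox_complex_iff\<close>)+
      have "(?F has_contour_integral 0) (rectpath ?a ?c)"
      proof (rule Cauchy_theorem_convex[OF cont _ finite.emptyI])
        show "?F field_differentiable at x" if "x \<in> interior ?R - {}" for x
          using that by (intro strip_fun_differentiable[OF f]) (auto simp: interior_cbox in_box_complex_iff)
      qed (use path in auto)
      then have sum0: "?C ?a ?b + ?C ?b ?c
          + ?C ?c ?d + ?C ?d ?a = 0"
        unfolding rectpath_def Let_def by (intro has_chain_integral_chain_integral4) simp
      have line: "continuous_on {-T..T} (\<lambda>s. ?F (Complex s m))" if "m = 0 \<or> m = 2 * pi" for m
        by (rule continuous_on_compose2[OF strip_fun_continuous[OF f]])
          (use that in \<open>auto intro!: continuous_intros\<close>)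
      have "?C ?a ?b = integral {-T..T} (\<lambda>s. ?F (Complex s 0))"
        using elim by (intro contour_integral_horizontal line) auto
      also have "(\<lambda>s. ?F (Complex s 0)) = (\<lambda>s. of_real (exp s) * p (exp s))"
        by (simp add: strip_fun_def exp_bottom fun_eq_iff)
      also have "integral {-T..T} (\<lambda>s. of_real (exp s) * p (exp s)) = ?J T p"
        using elim by (intro integral_exp_substitution pc) auto
      finally have bottom: "?C ?a ?b = ?J T p" .
      have "?C ?d ?c = integral {-T..T} (\<lambda>s. ?F (Complex s (2 * pi)))"
        using elim by (intro contour_integral_horizontal line) auto
      also have "(\<lambda>s. ?F (Complex s (2 * pi))) = (\<lambda>s. of_real (exp s) * q (exp s))"
        by (simp add: strip_fun_def exp_top fun_eq_iff)
      also have "integral {-T..T} (\<lambda>s. of_real (exp s) * q (exp s)) = ?J T q"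
        using elim by (intro integral_exp_substitution qc) auto
      finally have top: "?C ?c ?d = - ?J T q"
        using contour_integral_reverse_linepath[OF continuous_on_subset[OF cont seg(3)]] by (metis minus_minus)
      have right: "cmod (?C ?b ?c - c * (?c - ?b)) \<le> d * cmod (?c - ?b)"
      proof (rule contour_integral_bound_const[OF continuous_on_subset[OF cont seg(2)]])
        fix z assume "z \<in> closed_segment ?b ?c"
        then have "Re z = T" "0 \<le> Im z" "Im z \<le> 2 * pi"
          by (auto simp: closed_segment_same_Re closed_segment_eq_real_ivl split: if_splits)
        then show "cmod (?F z - c) \<le> d"
          using A elim by (intro strip_fun_bound[OF f, where A = "{A<..}"]) (auto intro: less_imp_le)
      qed (use d in auto)
      have left: "cmod (?C ?d ?a - 0 * (?a - ?d)) \<le> d * cmod (?a - ?d)"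
      proof (rule contour_integral_bound_const[OF continuous_on_subset[OF cont seg(4)]])
        fix z assume "z \<in> closed_segment ?d ?a"
        then have "Re z = - T" "0 \<le> Im z" "Im z \<le> 2 * pi"
          by (auto simp: closed_segment_same_Re closed_segment_eq_real_ivl split: if_splits)
        then show "cmod (?F z - 0) \<le> d"
          using less_imp_le[OF r'] elim d by (intro strip_fun_bound[OF f, where A = "{..<r}"]) force+
      qed (use d in auto)
      have cb: "?c - ?b = 2 * pi * \<i>" "?a - ?d = - (2 * pi * \<i>)" by (simp_all add: complex_eq_iff)
      have "?J T p - ?J T q + 2 * pi * \<i> * c
        = - (?C ?b ?c - c * (?c - ?b)) - ?C ?d ?a"
        using sum0 unfolding bottom top cb by (simp add: algebra_simps add_eq_0_iff)
      also have "cmod \<dots> \<le> d * cmod (?c - ?b) + d * cmod (?a - ?d)"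
        using norm_triangle_ineq4[of "- (?C ?b ?c - c * (?c - ?b))" "?C ?d ?a"] right left
        by (simp only: norm_minus_cancel mult_zero_left diff_zero)
      also have "\<dots> = e" unfolding cb by (simp add: norm_mult d_def)
      finally show ?case .
    qed
  qed
  define J where "J = (\<lambda>n :: nat. integral (?I n) p - integral (?I n) q)"
  have J1: "J \<longlonglongrightarrow> - 2 * pi * \<i> * c"
    unfolding tendsto_iff
  proof (intro allI impI)
    fix e :: real assume "e > 0"
    then have "eventually (\<lambda>n :: nat. cmod (J n + 2 * pi * \<i> * c) \<le> e / 2) sequentially"
      unfolding J_def using filterlim_real_sequentially
      by (intro eventually_compose_filterlim[OF bound]) auto
    then show "eventually (\<lambda>n. dist (J n) (- 2 * pi * \<i> * c) < e) sequentially"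
      by eventually_elim (use \<open>e > 0\<close> in \<open>auto simp: dist_norm\<close>)
  qed
  have J2: "J n = (\<integral>x. indicator (?I n) x *\<^sub>R (p x - q x) \<partial>pos_lborel)" for n
  proof -
    have sub: "?I n \<subseteq> {0<..}" by (auto intro: less_le_trans[OF exp_gt_zero])
    have "set_integrable lborel {0<..} (\<lambda>x. p x - q x)"
      using int unfolding set_integrable_def by (subst (asm) integrable_restrict_space) auto
    then have "set_integrable lborel (?I n) (\<lambda>x. p x - q x)"
      by (rule set_integrable_subset) (use sub in auto)
    from set_borel_integral_eq_integral(2)[OF this]
    have "(LINT x:?I n|lborel. p x - q x) = integral (?I n) (\<lambda>x. p x - q x)" .
    also have "\<dots> = J n"
      unfolding J_def using continuous_on_subset[OF pc sub] continuous_on_subset[OF qc sub]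
      by (intro Henstock_Kurzweil_Integration.integral_diff integrable_continuous_interval)
    finally have "J n = (LINT x:?I n|lborel. p x - q x)" ..
    also have "\<dots> = (\<integral>x. indicator (?I n) x *\<^sub>R (p x - q x) \<partial>pos_lborel)"
      unfolding set_lebesgue_integral_def
      by (subst integral_restrict_space) (use sub in \<open>auto intro!: Bochner_Integration.integral_cong simp: indicator_def\<close>)
    finally show ?thesis .
  qed
  \<comment> \<open>The truncated integrals of \<open>p\<close> and \<open>q\<close> are combined
    before the limit; their difference is dominated by the integrable norm of the jump.\<close>
  have "(\<lambda>n. \<integral>x. indicator (?I n) x *\<^sub>R (p x - q x) \<partial>pos_lborel) \<longlonglongrightarrow> (\<integral>x. p x - q x \<partial>pos_lborel)"
  proof (rule integral_dominated_convergence[where w = "\<lambda>x. norm (p x - q x)"])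
    show "AE x in pos_lborel. (\<lambda>n. indicator (?I n) x *\<^sub>R (p x - q x)) \<longlonglongrightarrow> p x - q x"
    proof (rule AE_I2)
      fix x assume "x \<in> space pos_lborel"
      then have x: "x > 0" by (simp add: space_restrict_space)
      have "eventually (\<lambda>n :: nat. real n \<ge> \<bar>ln x\<bar>) sequentially"
        using filterlim_real_sequentially by (simp add: filterlim_at_top)
      then have "eventually (\<lambda>n. p x - q x = indicator (?I n) x *\<^sub>R (p x - q x)) sequentially"
      proof eventually_elim
        case (elim n)
        then have "exp (- real n) \<le> exp (ln x)" "exp (ln x) \<le> exp (real n)" by auto
        then show ?case using x by simp
      qed
      then show "(\<lambda>n. indicator (?I n) x *\<^sub>R (p x - q x)) \<longlonglongrightarrow> p x - q x"
        by (rule Lim_transform_eventually[OF tendsto_const])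
    qed
    show "(\<lambda>x. indicator (?I n) x *\<^sub>R (p x - q x)) \<in> borel_measurable pos_lborel" for n
      using int by (intro borel_measurable_scaleR) (auto intro: measurable_restrict_space1)
    show "AE x in pos_lborel. norm (indicator (?I n) x *\<^sub>R (p x - q x)) \<le> norm (p x - q x)" for n
      by (rule AE_I2) (auto simp: indicator_def)
  qed (use int in auto)
  then have "J \<longlonglongrightarrow> (\<integral>x. p x - q x \<partial>pos_lborel)" using J2 by presburger
  from LIMSEQ_unique[OF this J1] show ?thesis .
qed

section \<open>The Riemann-Hilbert problem\<close>

lemma cyclic_index_simps: "(4 :: 3) = 1" "(5 :: 3) = 2"
  by simp_all

text \<open>The adjugate; since the indices are cyclic modulo 3, no signs occur.\<close>

definition adj3 :: "complex^3^3 \<Rightarrow> complex^3^3" where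
  "adj3 M = (\<chi> j l. M $ (l + 1) $ (j + 1) * M $ (l + 2) $ (j + 2) - M $ (l + 2) $ (j + 1) * M $ (l + 1) $ (j + 2))"

lemma adj3_mult_left: "adj3 M ** M = mat (det M)"
  by (simp add: vec_eq_iff forall_3 matrix_matrix_mult_def sum_3 adj3_def mat_def det_3 cyclic_index_simps algebra_simps)

lemma adj3_mult_right: "M ** adj3 M = mat (det M)"
  by (simp add: vec_eq_iff forall_3 matrix_matrix_mult_def sum_3 adj3_def mat_def det_3 cyclic_index_simps algebra_simps)

lemma matrix_inv_eq_adj3:
  assumes "det M = 1"
  shows "matrix_inv M = adj3 M"
proof -
  have "\<exists>B. M ** B = mat 1 \<and> B ** M = mat 1"
    using adj3_mult_left[of M] adj3_mult_right[of M] assms by auto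
  then have "M ** matrix_inv M = mat 1"
    unfolding matrix_inv_def by (rule someI2_ex) simp
  then have "adj3 M ** (M ** matrix_inv M) = adj3 M" by simp
  then show ?thesis
    unfolding matrix_mul_assoc adj3_mult_left assms by simp
qed

lemma mult_jump_nth:
  "(M ** jump a \<alpha> t n x) $ i $ 1 = M $ i $ 1"
  "(M ** jump a \<alpha> t n x) $ i $ 2 = M $ i $ 1 * of_real (weight1 a \<alpha> t n x) + M $ i $ 2"
  "(M ** jump a \<alpha> t n x) $ i $ 3 = M $ i $ 1 * of_real (weight2 a \<alpha> t n x) + M $ i $ 3"
  by (simp_all add: matrix_matrix_mult_def sum_3 jump_def)

lemma det_mult_jump: "det (M ** jump a \<alpha> t n x) = det M"
  by (simp add: det_mul) (simp add: det_3 jump_def)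

text \<open>On the adjugate the jump acts from the left by its own inverse, which alters only the
  first row.\<close>

lemma adj3_mult_jump:
  "adj3 (M ** jump a \<alpha> t n x) $ 1 $ l = adj3 M $ 1 $ l
     - (of_real (weight1 a \<alpha> t n x) * adj3 M $ 2 $ l + of_real (weight2 a \<alpha> t n x) * adj3 M $ 3 $ l)"
  "adj3 (M ** jump a \<alpha> t n x) $ 2 $ l = adj3 M $ 2 $ l"
  "adj3 (M ** jump a \<alpha> t n x) $ 3 $ l = adj3 M $ 3 $ l"
  by (simp_all add: adj3_def cyclic_index_simps mult_jump_nth algebra_simps)

section \<open>The weights in the rescaled variable and the span they generate\<close>

text \<open>The scale \<open>b\<close> normalizes the exponential factor, and then \<open>A\<close>
  is forced: one quarter of the squared Bessel argument is \<open>A * (b * x)\<close>.\<close>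

lemma weight_eq:
  fixes a \<alpha> t x :: real and n j :: nat
  assumes a: "a > 0" and \<alpha>: "\<alpha> > -1" and t: "0 < t" "t < 1" and n: "n > 0" and x: "x > 0"
  defines "b \<equiv> real n / (t * (1 - t))" and "A \<equiv> real n * (a * (1 - t) / t)"
  shows "x powr ((\<alpha> + real j) / 2) * exp (- (real n * x) / (t * (1 - t))) * bessel_I (\<alpha> + real j) (2 * real n * sqrt (a * x) / t)
    = (sqrt a * (1 - t)) powr (\<alpha> + real j) * ((b * x) powr \<alpha> * exp (- (b * x)) * ((b * x) ^ j * bessel_F \<alpha> j (A * (b * x))))"
proof -
  let ?X = "2 * real n * sqrt (a * x) / t"
  have X: "?X > 0" using assms by simp
  have b: "b > 0" using assms by simp
  have "?X\<^sup>2 / 4 = A * (b * x)"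
    unfolding A_def b_def using a t x by (simp add: power_divide power_mult_distrib power2_eq_square field_simps)
  then have I: "bessel_I (\<alpha> + real j) ?X = (?X / 2) powr (\<alpha> + real j) * bessel_F \<alpha> j (A * (b * x))"
    using bessel_I_eq[OF \<alpha> X, of j] by simp
  have X2: "?X / 2 = (sqrt a * (1 - t)) * (b * sqrt x)"
    unfolding b_def using t by (simp add: real_sqrt_mult field_simps)
  have "x powr ((\<alpha> + real j) / 2) * (?X / 2) powr (\<alpha> + real j)
      = (sqrt a * (1 - t)) powr (\<alpha> + real j) * (x powr (1 / 2 * (\<alpha> + real j)) * (b * sqrt x) powr (\<alpha> + real j))"
    unfolding X2 powr_mult[of "sqrt a * (1 - t)"] by simp
  also have "x powr (1 / 2 * (\<alpha> + real j)) * (b * sqrt x) powr (\<alpha> + real j) = (b * x) powr (\<alpha> + real j)"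
  proof -
    have "x powr (1 / 2 * (\<alpha> + real j)) = (sqrt x) powr (\<alpha> + real j)"
      using x by (simp add: powr_powr flip: powr_half_sqrt)
    then have "x powr (1 / 2 * (\<alpha> + real j)) * (b * sqrt x) powr (\<alpha> + real j) = (sqrt x * (b * sqrt x)) powr (\<alpha> + real j)"
      by (simp only: powr_mult)
    also have "sqrt x * (b * sqrt x) = b * x" using x by simp
    finally show ?thesis .
  qed
  also have "(b * x) powr (\<alpha> + real j) = (b * x) powr \<alpha> * (b * x) ^ j"
    using b x by (simp add: powr_add powr_realpow)
  finally have "x powr ((\<alpha> + real j) / 2) * (?X / 2) powr (\<alpha> + real j) = (sqrt a * (1 - t)) powr (\<alpha> + real j) * ((b * x) powr \<alpha> * (b * x) ^ j)" .
  moreover have "- (real n * x) / (t * (1 - t)) = - (b * x)" by (simp add: b_def)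
  ultimately show ?thesis unfolding I by (simp only: mult_ac)
qed

lemma weights_eq:
  fixes a \<alpha> t x :: real and n :: nat
  assumes a: "a > 0" and \<alpha>: "\<alpha> > -1" and t: "0 < t" "t < 1" and n: "n > 0" and x: "x > 0"
  defines "b \<equiv> real n / (t * (1 - t))" and "A \<equiv> real n * (a * (1 - t) / t)"
  shows "weight1 a \<alpha> t n x = (sqrt a * (1 - t)) powr \<alpha> * ((b * x) powr \<alpha> * exp (- (b * x)) * ((b * x) ^ 0 * bessel_F \<alpha> 0 (A * (b * x))))"
    and "weight2 a \<alpha> t n x = (sqrt a * (1 - t)) powr (\<alpha> + 1) * ((b * x) powr \<alpha> * exp (- (b * x)) * ((b * x) ^ 1 * bessel_F \<alpha> 1 (A * (b * x))))"
  using weight_eq[OF assms(1-6), of 0] weight_eq[OF assms(1-6), of 1]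
  unfolding weight1_def weight2_def b_def A_def by (simp_all only: of_nat_0 of_nat_1 add_0_right)

text \<open>The span after division by the common factor \<open>Z powr \<alpha> * exp (- Z)\<close>
  of the weights.\<close>

definition bessel_span :: "real \<Rightarrow> real \<Rightarrow> nat \<Rightarrow> (real \<Rightarrow> complex) \<Rightarrow> bool" where
  "bessel_span \<alpha> A n f \<longleftrightarrow> (\<exists>c. \<forall>Z>0. f Z = (\<Sum>j<n. c j * of_real (Z ^ j * bessel_F \<alpha> j (A * Z))))"

lemma bessel_span_zero: "bessel_span \<alpha> A n (\<lambda>Z. 0)"
  unfolding bessel_span_def by (rule exI[of _ "\<lambda>_. 0"]) simp

lemma bessel_span_add:
  assumes "bessel_span \<alpha> A n f" "bessel_span \<alpha> A n g"
  shows "bessel_span \<alpha> A n (\<lambda>Z. f Z + g Z)"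
proof -
  from assms obtain c d where "\<forall>Z>0. f Z = (\<Sum>j<n. c j * of_real (Z ^ j * bessel_F \<alpha> j (A * Z)))"
    "\<forall>Z>0. g Z = (\<Sum>j<n. d j * of_real (Z ^ j * bessel_F \<alpha> j (A * Z)))"
    unfolding bessel_span_def by blast
  then show ?thesis
    unfolding bessel_span_def by (intro exI[of _ "\<lambda>j. c j + d j"]) (simp add: sum.distrib ring_distribs)
qed

lemma bessel_span_cmult:
  assumes "bessel_span \<alpha> A n f"
  shows "bessel_span \<alpha> A n (\<lambda>Z. k * f Z)"
proof -
  from assms obtain c where "\<forall>Z>0. f Z = (\<Sum>j<n. c j * of_real (Z ^ j * bessel_F \<alpha> j (A * Z)))"
    unfolding bessel_span_def by blast
  then show ?thesis
    unfolding bessel_span_def by (intro exI[of _ "\<lambda>j. k * c j"]) (simp add: sum_distrib_left mult.assoc)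
qed

lemma bessel_span_sum:
  assumes "finite S" "\<And>i. i \<in> S \<Longrightarrow> bessel_span \<alpha> A n (f i)"
  shows "bessel_span \<alpha> A n (\<lambda>Z. \<Sum>i\<in>S. f i Z)"
  using assms by (induction S) (auto intro: bessel_span_zero bessel_span_add)

text \<open>By \<open>bessel_F_rec\<close> each factor \<open>Z\<close> produces terms whose index
  is higher by 1 and by 2, so \<open>k\<close> factors raise it by at most
  \<open>2 * k\<close>.\<close>

lemma bessel_span_power:
  assumes "\<alpha> > -1" "2 * k + i < n"
  shows "bessel_span \<alpha> A n (\<lambda>Z. of_real (Z ^ k * (Z ^ i * bessel_F \<alpha> i (A * Z))))"
  using assms(2)
proof (induction k arbitrary: i)
  case 0
  then show ?case
    unfolding bessel_span_def
    by (intro exI[of _ "\<lambda>j. if j = i then 1 else 0"]) (auto simp: if_distrib[of "\<lambda>x. x * _"] cong: if_cong)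
next
  case (Suc k)
  have "Z ^ Suc k * (Z ^ i * bessel_F \<alpha> i (A * Z))
     = A * (Z ^ k * (Z ^ (i + 2) * bessel_F \<alpha> (i + 2) (A * Z)))
       + (\<alpha> + real i + 1) * (Z ^ k * (Z ^ (i + 1) * bessel_F \<alpha> (i + 1) (A * Z)))" for Z
  proof -
    have "Z ^ Suc k * (Z ^ i * bessel_F \<alpha> i (A * Z))
      = Z ^ Suc k * (Z ^ i * (A * Z * bessel_F \<alpha> (i + 2) (A * Z) + (\<alpha> + real i + 1) * bessel_F \<alpha> (i + 1) (A * Z)))"
      by (simp only: bessel_F_rec[OF assms(1)])
    then show ?thesis by (simp add: algebra_simps power_add power2_eq_square)
  qed
  then have "(\<lambda>Z. complex_of_real (Z ^ Suc k * (Z ^ i * bessel_F \<alpha> i (A * Z))))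
     = (\<lambda>Z. of_real A * of_real (Z ^ k * (Z ^ (i + 2) * bessel_F \<alpha> (i + 2) (A * Z)))
       + of_real (\<alpha> + real i + 1) * of_real (Z ^ k * (Z ^ (i + 1) * bessel_F \<alpha> (i + 1) (A * Z))))"
    by (simp only: of_real_add of_real_mult)
  moreover have "bessel_span \<alpha> A n \<dots>"
    using Suc.prems by (intro bessel_span_add bessel_span_cmult Suc.IH) auto
  ultimately show ?case by (simp only:)
qed

text \<open>The zero polynomial is listed apart because its \<open>degree\<close> is 0. The case
  occurs for \<open>n = 1\<close>, where the second weight contributes nothing.\<close>

lemma bessel_span_poly:
  assumes \<alpha>: "\<alpha> > -1" and deg: "S = 0 \<or> 2 * degree S + i < n"
  shows "bessel_span \<alpha> A n (\<lambda>Z. poly S (of_real (c * Z)) * of_real (Z ^ i * bessel_F \<alpha> i (A * Z)))"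
proof (cases "S = 0")
  case False
  have "poly S (of_real (c * Z)) * of_real (Z ^ i * bessel_F \<alpha> i (A * Z))
    = (\<Sum>k\<le>degree S. (coeff S k * of_real (c ^ k)) * of_real (Z ^ k * (Z ^ i * bessel_F \<alpha> i (A * Z))))" for Z
    unfolding poly_altdef sum_distrib_right by (simp add: power_mult_distrib mult_ac)
  moreover have "bessel_span \<alpha> A n (\<lambda>Z. \<Sum>k\<le>degree S. (coeff S k * of_real (c ^ k)) * of_real (Z ^ k * (Z ^ i * bessel_F \<alpha> i (A * Z))))"
    using deg False by (intro bessel_span_sum bessel_span_cmult bessel_span_power \<alpha>) auto
  ultimately show ?thesis by simp
qed (simp add: bessel_span_zero)

lemma integrable_weight_poly:
  fixes b A :: real and S :: "complex poly"
  assumes \<alpha>: "\<alpha> > -1" and b: "b > 0"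
  shows "integrable pos_lborel (\<lambda>y. complex_of_real (\<kappa> * ((b * y) powr \<alpha> * exp (- (b * y)) * ((b * y) ^ j * bessel_F \<alpha> j (A * (b * y))))) * poly S (of_real y))"
proof -
  let ?g = "\<lambda>m z. z powr \<alpha> * exp (- z) * (z ^ j * bessel_F \<alpha> j (A * z)) * z ^ m"
  have int: "integrable pos_lborel (\<lambda>y. complex_of_real (?g m (b * y)))" for m
    using has_bochner_integral_pos_lborel_scale[OF bessel_F_moment[OF \<alpha>, of j A m] b]
    by (intro integrable_of_real) (simp add: has_bochner_integral_iff)
  have "integrable pos_lborel (\<lambda>y. \<Sum>m\<le>degree S. (of_real \<kappa> * coeff S m * of_real ((1 / b) ^ m)) * complex_of_real (?g m (b * y)))"
    by (intro Bochner_Integration.integrable_sum integrable_mult_right int)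
  moreover have "(of_real \<kappa> * coeff S m * of_real ((1 / b) ^ m)) * complex_of_real (?g m (b * y))
     = complex_of_real (\<kappa> * ((b * y) powr \<alpha> * exp (- (b * y)) * ((b * y) ^ j * bessel_F \<alpha> j (A * (b * y))))) * (coeff S m * of_real y ^ m)" for m y
  proof -
    have e: "complex_of_real ((1 / b) ^ m) * of_real ((b * y) ^ m) = of_real y ^ m"
      unfolding of_real_mult[symmetric] power_mult_distrib[symmetric] using b by simp
    let ?G = "(b * y) powr \<alpha> * exp (- (b * y)) * ((b * y) ^ j * bessel_F \<alpha> j (A * (b * y)))"
    have "(of_real \<kappa> * coeff S m * of_real ((1 / b) ^ m)) * complex_of_real (?G * (b * y) ^ m)
      = of_real \<kappa> * of_real ?G * coeff S m * (complex_of_real ((1 / b) ^ m) * of_real ((b * y) ^ m))"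
      unfolding of_real_mult[of ?G] by (simp only: mult_ac)
    also have "\<dots> = complex_of_real (\<kappa> * ?G) * (coeff S m * of_real y ^ m)"
      unfolding e of_real_mult[of \<kappa>] by (simp only: mult_ac)
    finally show ?thesis .
  qed
  ultimately show ?thesis by (simp only: poly_altdef sum_distrib_left)
qed

lemma dual_P_poly: "\<exists>q :: complex poly. degree q \<le> k \<and> (\<forall>y. poly q (of_real y) = of_real (dual_P \<alpha> A k (b * y)))"
proof -
  let ?c = "\<lambda>l m. real (k choose l) * A ^ (k - l) * (real (l choose m) * pochhammer (\<alpha> + 1 + real m) (l - m) * (- b) ^ m)"
  define q where "q = (\<Sum>l\<le>k. \<Sum>m\<le>l. monom (complex_of_real (?c l m)) m)"
  have "degree q \<le> k"
    unfolding q_def by (intro degree_sum_le) (auto intro!: degree_sum_le order.trans[OF degree_monom_le])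
  moreover have "poly q (of_real y) = of_real (dual_P \<alpha> A k (b * y))" for y
  proof -
    have "dual_P \<alpha> A k (b * y) = (\<Sum>l\<le>k. \<Sum>m\<le>l. ?c l m * y ^ m)"
      unfolding dual_P_def laguerre_q_def sum_distrib_left mult_minus_left[symmetric] power_mult_distrib
      by (simp only: mult.assoc)
    then show ?thesis by (simp add: q_def poly_sum poly_monom)
  qed
  ultimately show ?thesis by blast
qed

text \<open>In all three cases the growth allowed at the origin is weaker than that of a simple
  pole.\<close>

lemma origin_growth_limit:
  assumes "\<alpha> > -1"
  shows "((\<lambda>z. cmod z * origin_growth \<alpha> z) \<longlongrightarrow> 0) (at 0 within S)"
proof -
  have f: "filterlim cmod (at_right 0) (at 0 within S)"
    unfolding filterlim_at by (auto intro!: tendsto_norm_zero tendsto_ident_at simp: eventually_at_filter)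
  have "((\<lambda>r. r * (if \<alpha> < 0 then r powr \<alpha> else if \<alpha> = 0 then ln r else 1)) \<longlongrightarrow> 0) (at_right (0 :: real))"
  proof -
    consider "\<alpha> < 0" | "\<alpha> = 0" | "\<alpha> > 0" by linarith
    then show ?thesis
    proof cases
      case 1
      have "((\<lambda>r. r powr (\<alpha> + 1)) \<longlongrightarrow> 0 powr (\<alpha> + 1)) (at_right (0 :: real))"
        using assms by (intro tendsto_powr') (auto simp: eventually_at_filter intro!: tendsto_ident_at)
      then have "((\<lambda>r. r powr (\<alpha> + 1)) \<longlongrightarrow> 0) (at_right (0 :: real))" by simp
      then show ?thesis
        by (rule Lim_transform_eventually) (use 1 in \<open>auto simp: eventually_at_filter powr_add mult.commute\<close>)
    next
      case 2
      then show ?thesis by simp real_asymp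
    next
      case 3
      then show ?thesis by (auto intro!: tendsto_ident_at)
    qed
  qed
  from filterlim_compose[OF this f] show ?thesis unfolding origin_growth_def .
qed

lemma slit_fun_cong:
  assumes "slit_fun f p q" "\<And>x. x > 0 \<Longrightarrow> p x = p' x" "\<And>x. x > 0 \<Longrightarrow> q x = q' x"
  shows "slit_fun f p' q'"
proof -
  have "continuous_on {0<..} p' = continuous_on {0<..} p" "continuous_on {0<..} q' = continuous_on {0<..} q"
    using assms(2,3) by (auto intro!: continuous_on_cong)
  then show ?thesis using assms by (auto simp: slit_fun_def)
qed

lemma poly_div_power_tendsto_0:
  fixes q :: "complex poly"
  assumes "degree q < n"
  shows "((\<lambda>z. poly q z / z ^ n) \<longlongrightarrow> 0) at_infinity"
proof -
  have "((\<lambda>z. \<Sum>i\<le>degree q. coeff q i * inverse z ^ (n - i)) \<longlongrightarrow> 0) at_infinity"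
  proof (rule tendsto_null_sum)
    fix i assume "i \<in> {..degree q}"
    then have "n - i > 0" using assms by auto
    have "((\<lambda>z :: complex. inverse z ^ (n - i)) \<longlongrightarrow> 0 ^ (n - i)) at_infinity"
      by (intro tendsto_power tendsto_inverse_0)
    then have "((\<lambda>z :: complex. inverse z ^ (n - i)) \<longlongrightarrow> 0) at_infinity"
      using \<open>n - i > 0\<close> by (simp add: zero_power)
    then show "((\<lambda>z. coeff q i * inverse z ^ (n - i)) \<longlongrightarrow> 0) at_infinity"
      by (rule tendsto_mult_right_zero)
  qed
  moreover have "eventually (\<lambda>z. (\<Sum>i\<le>degree q. coeff q i * inverse z ^ (n - i)) = poly q z / z ^ n) at_infinity"
    unfolding eventually_at_infinity
  proof (intro exI[of _ 1] allI impI)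
    fix z :: complex assume "1 \<le> cmod z"
    then have z: "z \<noteq> 0" by auto
    have "coeff q i * inverse z ^ (n - i) = coeff q i * z ^ i / z ^ n" if "i \<le> degree q" for i
      using that assms z by (simp add: power_diff power_inverse field_simps)
    then show "(\<Sum>i\<le>degree q. coeff q i * inverse z ^ (n - i)) = poly q z / z ^ n"
      by (simp add: poly_altdef sum_divide_distrib)
  qed
  ultimately show ?thesis by (rule Lim_transform_eventually)
qed

lemma poly_root_factor:
  fixes r :: "complex poly"
  assumes "poly r x = 0" "degree r \<le> m"
  shows "\<exists>T. (T = 0 \<or> degree T < m) \<and> (\<forall>y. poly r y = (x - y) * poly T y)"
proof -
  from assms(1) obtain T where T: "r = [:- x, 1:] * T"
    by (auto simp: poly_eq_0_iff_dvd elim: dvdE)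
  have "degree r = degree [:- x, 1:] + degree T" if "T \<noteq> 0"
    unfolding T by (rule degree_mult_eq) (use that in simp_all)
  then have "T = 0 \<or> degree T < m"
    using assms(2) by (cases "T = 0") simp_all
  then have "(- T = 0 \<or> degree (- T) < m) \<and> (\<forall>y. poly r y = (x - y) * poly (- T) y)"
    unfolding T by (simp add: algebra_simps)
  then show ?thesis by blast
qed

section \<open>Determinant, polynomial entries and growth for one solution\<close>

locale bessel_rhp =
  fixes a \<alpha> t :: real and n :: nat and Y :: "complex \<Rightarrow> complex^3^3"
  assumes a: "a > 0" and \<alpha>: "\<alpha> > -1" and t: "0 < t" "t < 1" and n: "n > 0"
    and rhp: "rhp_solution a \<alpha> t n Y"
begin

definition n1 :: nat where "n1 = nat \<lceil>real n / 2\<rceil>"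

definition n2 :: nat where "n2 = n - n1"

definition col_degree :: "3 \<Rightarrow> int" where
  "col_degree j = (if j = 1 then int n else if j = 2 then - int n1 else - int n2)"

abbreviation at_inf :: "complex filter" where
  "at_inf \<equiv> inf at_infinity (principal slit_plane)"

abbreviation at_origin :: "complex filter" where
  "at_origin \<equiv> at 0 within slit_plane"

text \<open>Degrees below \<open>n1\<close> next to the first weight and below \<open>n2\<close>
  next to the second give indices \<open>2 * (n1 - 1)\<close> and \<open>2 * (n2 - 1) + 1\<close>,
  both below \<open>n\<close>. This is where the split is used.\<close>

lemma n1_le: "n1 \<le> n" "2 * n1 \<le> n + 1"
  unfolding n1_def using n by linarith+

lemma n2_le: "2 * n2 \<le> n"
  unfolding n2_def n1_def by linarith

lemma n_eq: "n = n1 + n2"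
  unfolding n2_def using n1_le by simp

lemma power_n_eq: "(z :: complex) ^ n = z ^ n1 * z ^ n2"
  using arg_cong[OF n_eq, of "\<lambda>k. z ^ k"] by (simp only: power_add)

lemma rhp_facts:
  shows "(\<lambda>z. Y z $ i $ j) analytic_on slit_plane"
    and "x > 0 \<Longrightarrow> (Y \<longlongrightarrow> bdry_plus Y x) (at_upper x)"
    and "x > 0 \<Longrightarrow> (Y \<longlongrightarrow> bdry_minus Y x) (at_lower x)"
    and "continuous_on {0<..} (bdry_plus Y)" "continuous_on {0<..} (bdry_minus Y)"
    and "x > 0 \<Longrightarrow> bdry_plus Y x = bdry_minus Y x ** jump a \<alpha> t n x"
    and "\<exists>E :: complex \<Rightarrow> complex^3^3.
          (\<forall>z\<in>slit_plane. Y z = (mat 1 + E z) **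
             vector [vector [z powi int n, 0, 0],
                     vector [0, z powi (- int n1), 0],
                     vector [0, 0, z powi (- int n2)]]) \<and>
          (\<forall>i j. (\<lambda>z. E z $ i $ j) \<in> O[at_inf](\<lambda>z. 1 / z))"
    and "(\<lambda>z. cmod (Y z $ i $ 1)) \<in> O[at_origin](\<lambda>z. 1)"
    and "(\<lambda>z. cmod (Y z $ i $ 2)) \<in> O[at_origin](origin_growth \<alpha>)"
    and "(\<lambda>z. cmod (Y z $ i $ 3)) \<in> O[at_origin](\<lambda>z. 1)"
  using rhp unfolding rhp_solution_def Let_def n2_def n1_def by blast+

lemma slit_Y: "slit_fun (\<lambda>z. Y z $ i $ j) (\<lambda>x. bdry_plus Y x $ i $ j) (\<lambda>x. bdry_minus Y x $ i $ j)"
  unfolding slit_fun_def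
  using rhp_facts(1-5) by (auto intro!: analytic_imp_holomorphic tendsto_vec_nth continuous_intros)

lemma slit_adj3:
  "slit_fun (\<lambda>z. adj3 (Y z) $ j $ l) (\<lambda>x. adj3 (bdry_plus Y x) $ j $ l) (\<lambda>x. adj3 (bdry_minus Y x) $ j $ l)"
  unfolding adj3_def vec_lambda_beta by (intro slit_fun_diff slit_fun_mult slit_Y)

lemma slit_row:
  "slit_fun (\<lambda>z. \<Sum>l\<in>UNIV. adj3 (Y z) $ j $ l * v l)
     (\<lambda>x. \<Sum>l\<in>UNIV. adj3 (bdry_plus Y x) $ j $ l * v l) (\<lambda>x. \<Sum>l\<in>UNIV. adj3 (bdry_minus Y x) $ j $ l * v (l :: 3))"
  unfolding sum_3 by (intro slit_fun_add slit_fun_mult slit_fun_const slit_adj3)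

lemma nonzero_at_inf: "eventually (\<lambda>z. z \<noteq> 0 \<and> z \<in> slit_plane) at_inf"
  by (auto simp: eventually_inf_principal intro!: always_eventually)

lemma tendsto_inverse_at_inf: "((\<lambda>z. 1 / z) \<longlongrightarrow> 0) at_inf"
  unfolding inverse_eq_divide[symmetric] by (rule tendsto_mono[OF inf_le1 tendsto_inverse_0])

lemma bigo_inverse_tendsto_0:
  assumes "(\<lambda>z. e z) \<in> O[at_inf](\<lambda>z. 1 / z)"
  shows "(e \<longlongrightarrow> 0) at_inf"
proof -
  have "(\<lambda>z. 1 / z) \<in> o[at_inf](\<lambda>z. 1 :: complex)"
    using tendsto_inverse_at_inf by (intro smalloI_tendsto) auto
  from landau_o.big_small_trans[OF assms this] show ?thesis
    using smalloD_tendsto by fastforce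
qed

lemma tendsto_imp_bigo_1: "(f \<longlongrightarrow> c) F \<Longrightarrow> f \<in> O[F](\<lambda>_. 1 :: complex)"
  by (rule bigoI_tendsto[where c = c]) auto

lemma Y_inf: "(\<lambda>z. Y z $ i $ j) \<in> O[at_inf](\<lambda>z. z powi col_degree j)"
proof -
  obtain E :: "complex \<Rightarrow> complex^3^3" where E: "\<forall>z\<in>slit_plane. Y z = (mat 1 + E z) **
             vector [vector [z powi int n, 0, 0], vector [0, z powi (- int n1), 0], vector [0, 0, z powi (- int n2)]]"
    "\<forall>i j. (\<lambda>z. E z $ i $ j) \<in> O[at_inf](\<lambda>z. 1 / z)"
    using rhp_facts(7) by blast
  have "Y z $ i $ j = (mat 1 $ i $ j + E z $ i $ j) * z powi col_degree j" if "z \<in> slit_plane" for z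
    using exhaust_3[of j] bspec[OF E(1) that]
    by (auto simp: matrix_matrix_mult_def sum_3 col_degree_def)
  then have ev: "eventually (\<lambda>z. Y z $ i $ j = (mat 1 $ i $ j + E z $ i $ j) * z powi col_degree j) at_inf"
    by (auto simp: eventually_inf_principal intro!: always_eventually)
  have "(\<lambda>z. (mat 1 $ i $ j + E z $ i $ j) * z powi col_degree j) \<in> O[at_inf](\<lambda>z. 1 * z powi col_degree j)"
  proof (intro landau_o.big.mult landau_o.big_refl)
    have "((\<lambda>z. mat 1 $ i $ j + E z $ i $ j) \<longlongrightarrow> mat 1 $ i $ j + 0) at_inf"
      using E(2) by (intro tendsto_add tendsto_const bigo_inverse_tendsto_0) auto
    then show "(\<lambda>z. mat 1 $ i $ j + E z $ i $ j) \<in> O[at_inf](\<lambda>_. 1)"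
      by (rule tendsto_imp_bigo_1)
  qed
  then show ?thesis by (simp add: landau_o.big.in_cong[OF ev])
qed

text \<open>Row \<open>j\<close> of the adjugate is built from the two columns other than
  \<open>j\<close>. As the three column degrees add up to 0, it grows with the opposite of the
  degree of column \<open>j\<close>.\<close>

lemma adj3_inf: "(\<lambda>z. adj3 (Y z) $ j $ l) \<in> O[at_inf](\<lambda>z. z powi col_degree (j + 1) * z powi col_degree (j + 2))"
  unfolding adj3_def vec_lambda_beta
  by (intro sum_in_bigo landau_o.big.mult Y_inf)

lemma row_inf: "(\<lambda>z. \<Sum>l\<in>UNIV. adj3 (Y z) $ j $ l * v l) \<in> O[at_inf](\<lambda>z. z powi col_degree (j + 1) * z powi col_degree (j + 2))"
proof (rule big_sum_in_bigo)
  fix l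
  have "(\<lambda>z. adj3 (Y z) $ j $ l * v l) \<in> O[at_inf](\<lambda>z. (z powi col_degree (j + 1) * z powi col_degree (j + 2)) * 1)"
    by (intro landau_o.big.mult adj3_inf) auto
  then show "(\<lambda>z. adj3 (Y z) $ j $ l * v l) \<in> O[at_inf](\<lambda>z. z powi col_degree (j + 1) * z powi col_degree (j + 2))"
    by simp
qed

lemma bigo_cong_at_inf:
  assumes "f \<in> O[at_inf](g)" "\<And>z. z \<noteq> 0 \<Longrightarrow> z \<in> slit_plane \<Longrightarrow> g z = h z"
  shows "f \<in> O[at_inf](h)"
proof -
  have "eventually (\<lambda>z. g z = h z) at_inf"
    using nonzero_at_inf by eventually_elim (use assms(2) in auto)
  then show ?thesis using assms(1) landau_o.big.cong by blast
qed

lemma row1_inf: "(\<lambda>z. \<Sum>l\<in>UNIV. adj3 (Y z) $ 1 $ l * v l) \<in> O[at_inf](\<lambda>z. 1 / z ^ n)"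
  by (rule bigo_cong_at_inf[OF row_inf])
    (simp add: col_degree_def power_int_minus power_n_eq divide_inverse)

lemma row2_inf: "(\<lambda>z. \<Sum>l\<in>UNIV. adj3 (Y z) $ 2 $ l * v l) \<in> O[at_inf](\<lambda>z. z ^ n1)"
  by (rule bigo_cong_at_inf[OF row_inf])
    (simp add: col_degree_def power_int_minus power_n_eq cyclic_index_simps)

lemma row3_inf: "(\<lambda>z. \<Sum>l\<in>UNIV. adj3 (Y z) $ 3 $ l * v l) \<in> O[at_inf](\<lambda>z. z ^ n2)"
  by (rule bigo_cong_at_inf[OF row_inf])
    (simp add: col_degree_def power_int_minus power_n_eq cyclic_index_simps)

lemma Y_origin_13:
  assumes "j \<noteq> 2"
  shows "(\<lambda>z. Y z $ i $ j) \<in> O[at_origin](\<lambda>_. 1)"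
proof -
  have "(\<lambda>z. cmod (Y z $ i $ j)) \<in> O[at_origin](\<lambda>z. 1)"
    using exhaust_3[of j] assms rhp_facts(8,10) by auto
  then obtain C where "eventually (\<lambda>z. norm (cmod (Y z $ i $ j)) \<le> C * norm (1 :: real)) at_origin"
    by (auto elim!: landau_o.bigE)
  then show ?thesis by (intro bigoI[of _ C]) simp
qed

lemma Y_origin_2: "(\<lambda>z. z * Y z $ i $ 2) \<in> o[at_origin](\<lambda>_. 1)"
proof (rule smalloI_tendsto)
  obtain C where C: "eventually (\<lambda>z. norm (cmod (Y z $ i $ 2)) \<le> C * norm (origin_growth \<alpha> z)) at_origin"
    using landau_o.bigE[OF rhp_facts(9)[of i]] by blast
  have "((\<lambda>z. C * norm (cmod z * origin_growth \<alpha> z)) \<longlongrightarrow> 0) at_origin"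
    using origin_growth_limit[OF \<alpha>, of slit_plane] by (intro tendsto_mult_right_zero tendsto_norm_zero)
  moreover have "eventually (\<lambda>z. norm (z * Y z $ i $ 2) \<le> C * norm (cmod z * origin_growth \<alpha> z)) at_origin"
    using C
  proof eventually_elim
    case (elim z)
    from mult_left_mono[OF this, of "cmod z"] show ?case by (simp add: norm_mult abs_mult mult_ac)
  qed
  ultimately show "((\<lambda>z. z * Y z $ i $ 2 / 1) \<longlongrightarrow> 0) at_origin"
    by (simp add: Lim_null_comparison)
qed auto

lemma ident_origin: "(\<lambda>z. z) \<in> o[at_origin](\<lambda>_. 1 :: complex)"
  by (rule smalloI_tendsto) (auto intro: tendsto_ident_at)

text \<open>Each product in a cofactor takes its factors from different columns, so the singular
  column 2 occurs at most once and the singularity stays weaker than a simple pole.\<close>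

lemma adj3_origin: "(\<lambda>z. z * adj3 (Y z) $ j $ l) \<in> o[at_origin](\<lambda>_. 1)"
proof -
  have *: "(\<lambda>z. z * (Y z $ i $ j * Y z $ i' $ j')) \<in> o[at_origin](\<lambda>_. 1)" if jj: "j \<noteq> j'" for i j i' j'
  proof -
    consider "j = 2" "j' \<noteq> 2" | "j' = 2" "j \<noteq> 2" | "j \<noteq> 2" "j' \<noteq> 2" using jj by auto
    then show ?thesis
    proof cases
      case 1
      have "(\<lambda>z. (z * Y z $ i $ 2) * Y z $ i' $ j') \<in> o[at_origin](\<lambda>_. 1 * 1)"
        by (rule landau_o.small_big_mult[OF Y_origin_2 Y_origin_13[OF 1(2)]])
      then show ?thesis using 1 by (simp add: mult_ac)
    next
      case 2
      have "(\<lambda>z. (z * Y z $ i' $ 2) * Y z $ i $ j) \<in> o[at_origin](\<lambda>_. 1 * 1)"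
        by (rule landau_o.small_big_mult[OF Y_origin_2 Y_origin_13[OF 2(2)]])
      then show ?thesis using 2 by (simp add: mult_ac)
    next
      case 3
      have "(\<lambda>z. z * (Y z $ i $ j * Y z $ i' $ j')) \<in> o[at_origin](\<lambda>_. 1 * (1 * 1))"
        by (intro landau_o.small_big_mult ident_origin landau_o.big.mult Y_origin_13 3)
      then show ?thesis by simp
    qed
  qed
  have "j + 1 \<noteq> j + 2" by simp
  then show ?thesis
    unfolding adj3_def vec_lambda_beta right_diff_distrib by (intro sum_in_smallo *)
qed

lemma row_origin: "((\<lambda>z. z * (\<Sum>l\<in>UNIV. adj3 (Y z) $ j $ l * v l)) \<longlongrightarrow> 0) at_origin"
proof -
  have "((\<lambda>z. z * adj3 (Y z) $ j $ l) \<longlongrightarrow> 0) at_origin" for l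
    using smalloD_tendsto[OF adj3_origin[of j l]] by simp
  then have "((\<lambda>z. \<Sum>l\<in>UNIV. (z * adj3 (Y z) $ j $ l) * v l) \<longlongrightarrow> 0) at_origin"
    by (intro tendsto_null_sum tendsto_mult_left_zero)
  then show ?thesis by (simp add: sum_distrib_left mult.assoc)
qed

lemma det_expand: "det M = (\<Sum>l\<in>UNIV. adj3 M $ 1 $ l * M $ l $ 1)"
proof -
  have "(adj3 M ** M) $ 1 $ 1 = det M" by (simp add: adj3_mult_left mat_def)
  then show ?thesis by (simp add: matrix_matrix_mult_def)
qed

lemma det_tendsto: "((\<lambda>z. det (Y z)) \<longlongrightarrow> 1) at_inf"
proof -
  obtain E :: "complex \<Rightarrow> complex^3^3" where E: "\<forall>z\<in>slit_plane. Y z = (mat 1 + E z) **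
             vector [vector [z powi int n, 0, 0], vector [0, z powi (- int n1), 0], vector [0, 0, z powi (- int n2)]]"
    "\<forall>i j. (\<lambda>z. E z $ i $ j) \<in> O[at_inf](\<lambda>z. 1 / z)"
    using rhp_facts(7) by blast
  have lim: "((\<lambda>z. (mat 1 + E z) $ i $ j) \<longlongrightarrow> mat 1 $ i $ j) at_inf" for i j
    using tendsto_add[OF tendsto_const bigo_inverse_tendsto_0[of "\<lambda>z. E z $ i $ j"], of "mat 1 $ i $ j"] E(2) by simp
  have "((\<lambda>z. det (mat 1 + E z)) \<longlongrightarrow> det (mat 1 :: complex^3^3)) at_inf"
    unfolding det_3 by (intro tendsto_add tendsto_diff tendsto_mult lim)
  then have "((\<lambda>z. det (mat 1 + E z)) \<longlongrightarrow> 1) at_inf" by simp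
  moreover have "eventually (\<lambda>z. det (mat 1 + E z) = det (Y z)) at_inf"
    using nonzero_at_inf
  proof eventually_elim
    case (elim z)
    have "det (vector [vector [z powi int n, 0, 0], vector [0, z powi (- int n1), 0], vector [0, 0, z powi (- int n2)]] :: complex^3^3)
      = z powi int n * z powi (- int n1) * z powi (- int n2)"
      by (simp add: det_3)
    also have "\<dots> = 1" using elim by (simp add: power_n_eq power_int_minus field_simps)
    finally show ?case using E(1) elim by (simp add: det_mul)
  qed
  ultimately show ?thesis by (rule Lim_transform_eventually)
qed

lemma slit_det: "slit_fun (\<lambda>z. det (Y z)) (\<lambda>x. det (bdry_plus Y x)) (\<lambda>x. det (bdry_minus Y x))"
  unfolding det_3 by (intro slit_fun_add slit_fun_diff slit_fun_mult slit_Y)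

lemma at_inf_nontrivial: "at_inf \<noteq> bot"
proof
  assume "at_inf = bot"
  then have "eventually (\<lambda>z. False) at_inf" by simp
  then obtain b where b: "\<And>z. cmod z \<ge> b \<Longrightarrow> z \<notin> slit_plane"
    unfolding eventually_inf_principal eventually_at_infinity by auto
  have "complex_of_real (- \<bar>b\<bar> - 1) \<in> slit_plane" by (simp add: complex_nonneg_Reals_iff)
  moreover have "cmod (complex_of_real (- \<bar>b\<bar> - 1)) \<ge> b" unfolding norm_of_real by simp
  ultimately show False using b by blast
qed

text \<open>The jump matrix has determinant 1, so the determinant has no jump. It is bounded at
  infinity and hence a constant polynomial, whose value is read off at infinity.\<close>

lemma det_eq_1: "z \<in> slit_plane \<Longrightarrow> det (Y z) = 1" "x > 0 \<Longrightarrow> det (bdry_plus Y x) = 1"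
proof -
  have "slit_fun (\<lambda>z. det (Y z)) (\<lambda>x. det (bdry_plus Y x)) (\<lambda>x. det (bdry_plus Y x))"
    by (rule slit_fun_cong[OF slit_det]) (auto simp: rhp_facts(6) det_mult_jump)
  moreover have "((\<lambda>z. z * det (Y z)) \<longlongrightarrow> 0) at_origin"
  proof -
    have "(\<lambda>z. (z * adj3 (Y z) $ 1 $ l) * Y z $ l $ 1) \<in> o[at_origin](\<lambda>_. 1 * 1)" for l
      by (intro landau_o.small_big_mult adj3_origin Y_origin_13) auto
    then have "((\<lambda>z. (z * adj3 (Y z) $ 1 $ l) * Y z $ l $ 1) \<longlongrightarrow> 0) at_origin" for l
      using smalloD_tendsto by fastforce
    then have "((\<lambda>z. \<Sum>l\<in>UNIV. (z * adj3 (Y z) $ 1 $ l) * Y z $ l $ 1) \<longlongrightarrow> 0) at_origin"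
      by (intro tendsto_null_sum)
    then show ?thesis unfolding det_expand by (simp add: sum_distrib_left mult.assoc)
  qed
  moreover have "(\<lambda>z. det (Y z)) \<in> O[at_inf](\<lambda>z. z ^ 0)"
    using tendsto_imp_bigo_1[OF det_tendsto] by simp
  ultimately obtain r where r: "degree r \<le> 0" "\<forall>z\<in>slit_plane. det (Y z) = poly r z"
    "\<forall>x>0. det (bdry_plus Y x) = poly r (of_real x)"
    using slit_fun_polynomial by blast
  then obtain c where c: "r = [:c:]" using degree_eq_zeroE[of r] by (metis le_zero_eq)
  have "((\<lambda>z. c) \<longlongrightarrow> 1) at_inf"
    using det_tendsto by (rule Lim_transform_eventually)
      (use nonzero_at_inf in \<open>eventually_elim, use r c in auto\<close>)
  then have "c = 1" using tendsto_unique[OF at_inf_nontrivial tendsto_const] by blast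
  then show "z \<in> slit_plane \<Longrightarrow> det (Y z) = 1" "x > 0 \<Longrightarrow> det (bdry_plus Y x) = 1"
    using r c by auto
qed

lemma column1_poly:
  "\<exists>p. degree p \<le> n \<and> (\<forall>z\<in>slit_plane. Y z $ l $ 1 = poly p z) \<and> (\<forall>x>0. bdry_plus Y x $ l $ 1 = poly p (of_real x))"
proof (rule slit_fun_polynomial)
  show "slit_fun (\<lambda>z. Y z $ l $ 1) (\<lambda>x. bdry_plus Y x $ l $ 1) (\<lambda>x. bdry_plus Y x $ l $ 1)"
    by (rule slit_fun_cong[OF slit_Y]) (auto simp: rhp_facts(6) mult_jump_nth)
  have "(\<lambda>z. z * Y z $ l $ 1) \<in> o[at_origin](\<lambda>_. 1 * 1)"
    by (intro landau_o.small_big_mult ident_origin Y_origin_13) auto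
  then show "((\<lambda>z. z * Y z $ l $ 1) \<longlongrightarrow> 0) at_origin"
    using smalloD_tendsto by fastforce
  show "(\<lambda>z. Y z $ l $ 1) \<in> O[at_inf](\<lambda>z. z ^ n)"
    using Y_inf[of l 1] by (simp add: col_degree_def)
qed

lemma row2_poly:
  "\<exists>r. degree r \<le> n1 \<and> (\<forall>z\<in>slit_plane. (\<Sum>l\<in>UNIV. adj3 (Y z) $ 2 $ l * v l) = poly r z) \<and>
     (\<forall>x>0. (\<Sum>l\<in>UNIV. adj3 (bdry_plus Y x) $ 2 $ l * v l) = poly r (of_real x))"
proof (rule slit_fun_polynomial[OF _ row_origin row2_inf])
  show "slit_fun (\<lambda>z. \<Sum>l\<in>UNIV. adj3 (Y z) $ 2 $ l * v l) (\<lambda>x. \<Sum>l\<in>UNIV. adj3 (bdry_plus Y x) $ 2 $ l * v l)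
      (\<lambda>x. \<Sum>l\<in>UNIV. adj3 (bdry_plus Y x) $ 2 $ l * v l)"
    by (rule slit_fun_cong[OF slit_row]) (auto simp: rhp_facts(6) adj3_mult_jump)
qed

lemma row3_poly:
  "\<exists>r. degree r \<le> n2 \<and> (\<forall>z\<in>slit_plane. (\<Sum>l\<in>UNIV. adj3 (Y z) $ 3 $ l * v l) = poly r z) \<and>
     (\<forall>x>0. (\<Sum>l\<in>UNIV. adj3 (bdry_plus Y x) $ 3 $ l * v l) = poly r (of_real x))"
proof (rule slit_fun_polynomial[OF _ row_origin row3_inf])
  show "slit_fun (\<lambda>z. \<Sum>l\<in>UNIV. adj3 (Y z) $ 3 $ l * v l) (\<lambda>x. \<Sum>l\<in>UNIV. adj3 (bdry_plus Y x) $ 3 $ l * v l)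
      (\<lambda>x. \<Sum>l\<in>UNIV. adj3 (bdry_plus Y x) $ 3 $ l * v l)"
    by (rule slit_fun_cong[OF slit_row]) (auto simp: rhp_facts(6) adj3_mult_jump)
qed

section \<open>Identification of the correlation kernel\<close>

definition scale :: real where "scale = real n / (t * (1 - t))"

definition shift :: real where "shift = real n * (a * (1 - t) / t)"

lemma scale_pos: "scale > 0"
  unfolding scale_def using t n by simp

abbreviation w1 :: "real \<Rightarrow> complex" where "w1 y \<equiv> of_real (weight1 a \<alpha> t n y)"

abbreviation w2 :: "real \<Rightarrow> complex" where "w2 y \<equiv> of_real (weight2 a \<alpha> t n y)"

lemma integrable_weights:
  "integrable pos_lborel (\<lambda>y. w1 y * poly S (of_real y))" "integrable pos_lborel (\<lambda>y. w2 y * poly S (of_real y))"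
proof -
  note W = weights_eq[OF a \<alpha> t n, folded scale_def shift_def]
  have sp: "y \<in> space pos_lborel \<Longrightarrow> y > 0" for y by (simp add: space_restrict_space)
  show "integrable pos_lborel (\<lambda>y. w1 y * poly S (of_real y))"
    using integrable_weight_poly[OF \<alpha> scale_pos, of "(sqrt a * (1 - t)) powr \<alpha>" 0 shift S]
    by (subst Bochner_Integration.integrable_cong[OF refl, OF arg_cong2[where f = "(*)", OF arg_cong[where f = of_real, OF W(1)[OF sp]] refl]])
  show "integrable pos_lborel (\<lambda>y. w2 y * poly S (of_real y))"
    using integrable_weight_poly[OF \<alpha> scale_pos, of "(sqrt a * (1 - t)) powr (\<alpha> + 1)" 1 shift S]
    by (subst Bochner_Integration.integrable_cong[OF refl, OF arg_cong2[where f = "(*)", OF arg_cong[where f = of_real, OF W(2)[OF sp]] refl]])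
qed

text \<open>Since the determinant is 1, this is row \<open>j\<close> of the inverse boundary matrix
  applied to \<open>v\<close>. The vector is left free, to be the first column of \<open>Y\<close>
  at a negative point or of its boundary value at a positive one.\<close>

definition row :: "3 \<Rightarrow> (3 \<Rightarrow> complex) \<Rightarrow> real \<Rightarrow> complex" where
  "row j v y = (\<Sum>l\<in>UNIV. adj3 (bdry_plus Y y) $ j $ l * v l)"

text \<open>
  The function \<open>h\<close> is the \<open>(1,1)\<close> entry of \<open>Y\<^sup>-\<^sup>1(z) Y(x)\<close>. The reproducing property comes from the
  jump of \<open>(h(z) q(z) - q(x)) / (z - x)\<close>, which has no pole at \<open>x\<close> because \<open>h(x) = 1\<close>.
\<close>

lemma reproducing:
  assumes x: "x < 0" and q: "degree q < n"
    and K: "\<And>y. y > 0 \<Longrightarrow> w1 y * row 2 (\<lambda>l. Y (of_real x) $ l $ 1) y + w2 y * row 3 (\<lambda>l. Y (of_real x) $ l $ 1) y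
        = (of_real x - of_real y) * (w1 y * poly S2 (of_real y) + w2 y * poly S3 (of_real y))"
  shows "(\<integral>y. (w1 y * poly S2 (of_real y) + w2 y * poly S3 (of_real y)) * poly q (of_real y) \<partial>pos_lborel)
    = 2 * pi * \<i> * poly q (of_real x)"
proof -
  let ?x = "complex_of_real x"
  let ?v = "\<lambda>l. Y ?x $ l $ 1"
  have xD: "?x \<in> slit_plane" using x by (simp add: complex_nonneg_Reals_iff)
  define h where "h = (\<lambda>z. \<Sum>l\<in>UNIV. adj3 (Y z) $ 1 $ l * ?v l)"
  define hp where "hp = (\<lambda>y. \<Sum>l\<in>UNIV. adj3 (bdry_plus Y y) $ 1 $ l * ?v l)"
  define hm where "hm = (\<lambda>y. \<Sum>l\<in>UNIV. adj3 (bdry_minus Y y) $ 1 $ l * ?v l)"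
  define k where "k = (\<lambda>y. w1 y * poly S2 (of_real y) + w2 y * poly S3 (of_real y))"
  have slit_h: "slit_fun h hp hm"
    unfolding h_def hp_def hm_def by (rule slit_row)
  have jump: "hp y - hm y = - ((of_real x - of_real y) * k y)" if "y > 0" for y
  proof -
    have "hp y - hm y = - (w1 y * (\<Sum>l\<in>UNIV. adj3 (bdry_minus Y y) $ 2 $ l * ?v l)
        + w2 y * (\<Sum>l\<in>UNIV. adj3 (bdry_minus Y y) $ 3 $ l * ?v l))"
      unfolding hp_def hm_def rhp_facts(6)[OF that] adj3_mult_jump sum_3 by (simp add: algebra_simps)
    also have "\<dots> = - (w1 y * row 2 ?v y + w2 y * row 3 ?v y)"
      unfolding row_def rhp_facts(6)[OF that] adj3_mult_jump ..
    finally show ?thesis unfolding K[OF that] k_def .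
  qed
  have hx: "h ?x = 1"
    unfolding h_def using det_expand[of "Y ?x"] det_eq_1(1)[OF xD] by simp
  define N where "N = (\<lambda>z. h z * poly q z - poly q ?x)"
  have slit_N: "slit_fun N (\<lambda>y. hp y * poly q (of_real y) - poly q ?x) (\<lambda>y. hm y * poly q (of_real y) - poly q ?x)"
    unfolding N_def
    by (intro slit_fun_diff slit_fun_mult slit_fun_const slit_h slit_fun_holomorphic[where U = UNIV])
      (auto intro!: holomorphic_intros)
  \<comment> \<open>The numerator \<open>N\<close> vanishes at \<open>x\<close>, so the derivative
    fills in a removable singularity.\<close>
  define f where "f = (\<lambda>z. if z = ?x then deriv N ?x else N z / (z - ?x))"
  define p where "p = (\<lambda>y. (hp y * poly q (of_real y) - poly q ?x) / (of_real y - ?x))"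
  define m where "m = (\<lambda>y. (hm y * poly q (of_real y) - poly q ?x) / (of_real y - ?x))"
  have ne: "complex_of_real y \<noteq> ?x" if "y > 0" for y using that x by auto
  have "slit_fun f p m"
    unfolding slit_fun_def
  proof (intro conjI allI impI)
    show "f holomorphic_on slit_plane"
    proof (rule pole_theorem_open_0[where g = N and a = ?x])
      show "N holomorphic_on slit_plane" using slit_N by (simp add: slit_fun_def)
      show "N ?x = 0" by (simp add: N_def hx)
    qed (auto simp: f_def open_slit_plane)
    have ev: "eventually (\<lambda>z. N z / (z - ?x) = f z) (at (complex_of_real y) within S)" if "y > 0" for y S
    proof -
      have "eventually (\<lambda>z. Re z > 0) (nhds (complex_of_real y))"
        using that by (intro eventually_nhds_in_open[of "{z. Re z > 0}", simplified] open_halfspace_Re_gt) auto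
      then show ?thesis
        unfolding eventually_at_filter by eventually_elim (use x in \<open>auto simp: f_def\<close>)
    qed
    fix y :: real assume y: "y > 0"
    have "((\<lambda>z. N z / (z - ?x)) \<longlongrightarrow> p y) (at_upper y)"
      unfolding p_def using slit_N y ne[OF y]
      by (intro tendsto_divide tendsto_diff tendsto_ident_at tendsto_const) (auto simp: slit_fun_def)
    then show "(f \<longlongrightarrow> p y) (at_upper y)"
      by (rule Lim_transform_eventually) (rule ev[OF y])
    have "((\<lambda>z. N z / (z - ?x)) \<longlongrightarrow> m y) (at_lower y)"
      unfolding m_def using slit_N y ne[OF y]
      by (intro tendsto_divide tendsto_diff tendsto_ident_at tendsto_const) (auto simp: slit_fun_def)
    then show "(f \<longlongrightarrow> m y) (at_lower y)"
      by (rule Lim_transform_eventually) (rule ev[OF y])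
  next
    show "continuous_on {0<..} p" "continuous_on {0<..} m"
      unfolding p_def m_def using slit_N ne by (auto simp: slit_fun_def intro!: continuous_intros)
  qed
  moreover have "((\<lambda>z. z * f z) \<longlongrightarrow> 0) at_origin"
  proof -
    have zh: "((\<lambda>z. z * h z) \<longlongrightarrow> 0) at_origin"
      unfolding h_def by (rule row_origin)
    have "((\<lambda>z. ((z * h z) * poly q z - z * poly q ?x) / (z - ?x)) \<longlongrightarrow> (0 * poly q 0 - 0 * poly q ?x) / (0 - ?x)) at_origin"
      using x by (intro tendsto_divide tendsto_diff tendsto_mult zh tendsto_ident_at tendsto_const tendsto_poly) auto
    then have "((\<lambda>z. ((z * h z) * poly q z - z * poly q ?x) / (z - ?x)) \<longlongrightarrow> 0) at_origin" by simp
    moreover have "eventually (\<lambda>z. ((z * h z) * poly q z - z * poly q ?x) / (z - ?x) = z * f z) at_origin"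
    proof -
      have "eventually (\<lambda>z. z \<noteq> ?x) (nhds 0)"
        using x by (intro t1_space_nhds) auto
      then show ?thesis
        unfolding eventually_at_filter by eventually_elim (auto simp: f_def N_def algebra_simps)
    qed
    ultimately show ?thesis by (rule Lim_transform_eventually)
  qed
  moreover have "((\<lambda>z. z * f z) \<longlongrightarrow> - poly q ?x) at_inf"
  proof -
    \<comment> \<open>Here \<open>degree q < n\<close> meets the decay \<open>1 / z ^ n\<close> of
      the first row. Only \<open>- poly q x\<close> survives in the limit of \<open>z * f z\<close>,
      and this becomes the reproduced value.\<close>
    have "(\<lambda>z. h z * poly q z) \<in> o[at_inf](\<lambda>_. 1)"
    proof -
      have "((\<lambda>z. poly q z / z ^ n) \<longlongrightarrow> 0) at_inf"
        by (rule tendsto_mono[OF inf_le1 poly_div_power_tendsto_0[OF q]])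
      moreover have "eventually (\<lambda>z. z ^ n \<noteq> (0 :: complex)) at_inf"
        using nonzero_at_inf by eventually_elim auto
      ultimately have "poly q \<in> o[at_inf](\<lambda>z. z ^ n)"
        by (rule smalloI_tendsto)
      then have *: "(\<lambda>z. h z * poly q z) \<in> o[at_inf](\<lambda>z. 1 / z ^ n * z ^ n)"
        unfolding h_def by (intro landau_o.big_small_mult row1_inf)
      have ev: "eventually (\<lambda>z. 1 / z ^ n * z ^ n = (1 :: complex)) at_inf"
        using nonzero_at_inf by eventually_elim auto
      show ?thesis using * unfolding landau_o.small.cong[OF ev] .
    qed
    then have hq: "((\<lambda>z. h z * poly q z) \<longlongrightarrow> 0) at_inf"
      using smalloD_tendsto by fastforce
    have "((\<lambda>z. inverse (1 - ?x * (1 / z)) * (h z * poly q z - poly q ?x)) \<longlongrightarrow> inverse (1 - ?x * 0) * (0 - poly q ?x)) at_inf"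
      by (intro tendsto_mult tendsto_inverse tendsto_diff tendsto_const hq tendsto_inverse_at_inf) auto
    then have "((\<lambda>z. inverse (1 - ?x * (1 / z)) * N z) \<longlongrightarrow> - poly q ?x) at_inf"
      by (simp add: N_def)
    moreover have "eventually (\<lambda>z. inverse (1 - ?x * (1 / z)) * N z = z * f z) at_inf"
    proof -
      have "eventually (\<lambda>z :: complex. cmod z \<ge> cmod ?x + 1) at_inf"
        by (rule filter_leD[OF inf_le1]) (auto simp: eventually_at_infinity)
      with nonzero_at_inf show ?thesis
      proof eventually_elim
        case (elim z)
        then have "z \<noteq> ?x" "z \<noteq> 0" by auto
        then have "1 - ?x * (1 / z) = (z - ?x) / z" by (simp add: field_simps)
        then show ?case using \<open>z \<noteq> ?x\<close> \<open>z \<noteq> 0\<close> by (simp add: f_def)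
      qed
    qed
    ultimately show ?thesis by (rule Lim_transform_eventually)
  qed
  \<comment> \<open>The factor \<open>x - y\<close> in the jump of \<open>h\<close> cancels against
    the denominator \<open>y - x\<close>, including the sign.\<close>
  moreover have pm: "p y - m y = k y * poly q (of_real y)" if "y > 0" for y
  proof -
    have "p y - m y = (hp y - hm y) * poly q (of_real y) / (of_real y - ?x)"
      unfolding p_def m_def by (simp add: diff_divide_distrib[symmetric] algebra_simps)
    also have "\<dots> = k y * poly q (of_real y)"
      unfolding jump[OF that] using ne[OF that] by (simp add: field_simps)
    finally show ?thesis .
  qed
  moreover have sp: "y \<in> space pos_lborel \<Longrightarrow> y > 0" for y by (simp add: space_restrict_space)
  moreover have "integrable pos_lborel (\<lambda>y. p y - m y)"
  proof -
    have I: "integrable pos_lborel (\<lambda>y. w1 y * poly (S2 * q) (of_real y) + w2 y * poly (S3 * q) (of_real y))"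
      by (intro Bochner_Integration.integrable_add integrable_weights)
    have "w1 y * poly (S2 * q) (of_real y) + w2 y * poly (S3 * q) (of_real y) = p y - m y" if "y \<in> space pos_lborel" for y
      unfolding pm[OF sp[OF that]] k_def by (simp add: algebra_simps)
    from Bochner_Integration.integrable_cong[OF refl this, THEN iffD1, OF _ I] show ?thesis .
  qed
  ultimately have "(\<integral>y. p y - m y \<partial>pos_lborel) = - 2 * pi * \<i> * (- poly q ?x)"
    by (intro slit_fun_jump_integral)
  moreover have "(\<integral>y. p y - m y \<partial>pos_lborel) = (\<integral>y. k y * poly q (of_real y) \<partial>pos_lborel)"
    by (intro Bochner_Integration.integral_cong refl pm sp)
  ultimately show ?thesis unfolding k_def by simp
qed

text \<open>Rows 2 and 3 of the inverse, applied to the first column at \<open>x\<close>, are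
  polynomials vanishing at \<open>x\<close>. Dividing out \<open>x - y\<close> lowers their degrees
  below \<open>n1\<close> and \<open>n2\<close>, which places the quotient in the span; together
  with \<open>reproducing\<close> this meets the hypotheses of
  \<open>dual_kernel_unique\<close>.\<close>

lemma kernel_negative:
  assumes x: "x < 0" and y: "y > 0"
  shows "w1 y * row 2 (\<lambda>l. Y (of_real x) $ l $ 1) y + w2 y * row 3 (\<lambda>l. Y (of_real x) $ l $ 1) y
    = 2 * pi * \<i> * of_real ((x - y) * (scale * dual_kernel \<alpha> shift n (scale * x) (scale * y)))"
proof -
  let ?x = "complex_of_real x"
  let ?v = "\<lambda>l. Y ?x $ l $ 1"
  have xD: "?x \<in> slit_plane" using x by (simp add: complex_nonneg_Reals_iff)
  \<comment> \<open>Off-diagonal entries of the inverse times the matrix itself.\<close>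
  have zero: "(\<Sum>l\<in>UNIV. adj3 (Y ?x) $ j $ l * ?v l) = 0" if "j \<noteq> 1" for j
  proof -
    have "(adj3 (Y ?x) ** Y ?x) $ j $ 1 = 0" using that by (simp add: adj3_mult_left mat_def)
    then show ?thesis by (simp add: matrix_matrix_mult_def)
  qed
  obtain r2 where r2: "degree r2 \<le> n1" "\<And>z. z \<in> slit_plane \<Longrightarrow> (\<Sum>l\<in>UNIV. adj3 (Y z) $ 2 $ l * ?v l) = poly r2 z"
    "\<And>y. y > 0 \<Longrightarrow> row 2 ?v y = poly r2 (of_real y)"
    using row2_poly[of ?v] unfolding row_def by blast
  obtain r3 where r3: "degree r3 \<le> n2" "\<And>z. z \<in> slit_plane \<Longrightarrow> (\<Sum>l\<in>UNIV. adj3 (Y z) $ 3 $ l * ?v l) = poly r3 z"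
    "\<And>y. y > 0 \<Longrightarrow> row 3 ?v y = poly r3 (of_real y)"
    using row3_poly[of ?v] unfolding row_def by blast
  have "poly r2 ?x = 0" using r2(2)[OF xD] zero[of 2] by simp
  from poly_root_factor[OF this r2(1)] obtain S2 where S2: "S2 = 0 \<or> degree S2 < n1" "\<And>y. poly r2 y = (?x - y) * poly S2 y"
    by blast
  have "poly r3 ?x = 0" using r3(2)[OF xD] zero[of 3] by simp
  from poly_root_factor[OF this r3(1)] obtain S3 where S3: "S3 = 0 \<or> degree S3 < n2" "\<And>y. poly r3 y = (?x - y) * poly S3 y"
    by blast
  define k where "k = (\<lambda>y. w1 y * poly S2 (of_real y) + w2 y * poly S3 (of_real y))"
  have K: "w1 y * row 2 ?v y + w2 y * row 3 ?v y = (?x - of_real y) * k y" if "y > 0" for y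
    unfolding r2(3)[OF that] r3(3)[OF that] S2(2) S3(2) k_def by (simp add: algebra_simps)
  let ?\<kappa>1 = "complex_of_real ((sqrt a * (1 - t)) powr \<alpha>)" and ?\<kappa>2 = "complex_of_real ((sqrt a * (1 - t)) powr (\<alpha> + 1))"
  \<comment> \<open>The quotient \<open>k\<close> in the variable \<open>Z = scale * y\<close>,
    without the factor \<open>Z powr \<alpha> * exp (- Z)\<close>.\<close>
  let ?u = "\<lambda>Z. ?\<kappa>1 * (poly S2 (of_real (1 / scale * Z)) * of_real (Z ^ 0 * bessel_F \<alpha> 0 (shift * Z)))
      + ?\<kappa>2 * (poly S3 (of_real (1 / scale * Z)) * of_real (Z ^ 1 * bessel_F \<alpha> 1 (shift * Z)))"
  have "bessel_span \<alpha> shift n ?u"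
    using S2(1) S3(1) n1_le n2_le
    by (intro bessel_span_add bessel_span_cmult bessel_span_poly \<alpha>) auto
  then obtain c where c: "\<And>Z. Z > 0 \<Longrightarrow> ?u Z
      = (\<Sum>j<n. c j * of_real (Z ^ j * bessel_F \<alpha> j (shift * Z)))"
    unfolding bessel_span_def by blast
  have "k y / (2 * pi * \<i>) = of_real (scale * (\<Sum>k<n. dual_P \<alpha> shift k (scale * x) * dual_Q \<alpha> shift k (scale * y)))"
  proof (rule dual_kernel_unique[OF \<alpha> scale_pos _ _ y, where c = "\<lambda>j. c j / (2 * pi * \<i>)"])
    fix y :: real assume y: "y > 0"
    let ?Z = "scale * y"
    let ?\<omega> = "?Z powr \<alpha> * exp (- ?Z)"
    have Z: "?Z > 0" using y scale_pos by simp
    have yZ: "complex_of_real y = of_real (1 / scale * ?Z)" using scale_pos by simp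
    note W = weights_eq[OF a \<alpha> t n y, folded scale_def shift_def]
    have "k y = of_real ?\<omega> * (?u ?Z)"
      unfolding k_def W yZ[symmetric] of_real_mult[of "_ powr _" "_ * (_ * _)"] of_real_mult[of ?\<omega>]
      by (simp only: distrib_left mult_ac)
    also have "\<dots> = (\<Sum>j<n. of_real ?\<omega> * (c j * of_real (?Z ^ j * bessel_F \<alpha> j (shift * ?Z))))"
      unfolding c[OF Z] by (simp only: sum_distrib_left)
    finally have "k y / (2 * pi * \<i>) = (\<Sum>j<n. of_real ?\<omega> * (c j * of_real (?Z ^ j * bessel_F \<alpha> j (shift * ?Z))) / (2 * pi * \<i>))"
      by (simp only: sum_divide_distrib)
    also have "\<dots> = (\<Sum>j<n. c j / (2 * pi * \<i>) * of_real (?\<omega> * (?Z ^ j * bessel_F \<alpha> j (shift * ?Z))))"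
      unfolding of_real_mult[of ?\<omega>] by (intro sum.cong refl) (simp only: divide_inverse mult_ac)
    finally show "k y / (2 * pi * \<i>) = (\<Sum>j<n. c j / (2 * pi * \<i>) * of_real (?\<omega> * (?Z ^ j * bessel_F \<alpha> j (shift * ?Z))))" .
  next
    fix i assume i: "i < n"
    obtain q where q: "degree q \<le> i" "\<And>y. poly q (of_real y) = complex_of_real (dual_P \<alpha> shift i (scale * y))"
      using dual_P_poly by blast
    have "(\<integral>y. k y * poly q (of_real y) \<partial>pos_lborel) = 2 * pi * \<i> * poly q ?x"
      unfolding k_def by (rule reproducing[OF x]) (use q i K in \<open>auto simp: k_def\<close>)
    then have "(\<integral>y. k y * of_real (dual_P \<alpha> shift i (scale * y)) \<partial>pos_lborel) / (2 * pi * \<i>) = of_real (dual_P \<alpha> shift i (scale * x))"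
      by (simp add: q(2))
    then show "(\<integral>y. k y / (2 * pi * \<i>) * of_real (dual_P \<alpha> shift i (scale * y)) \<partial>pos_lborel) = of_real (dual_P \<alpha> shift i (scale * x))"
      by (subst (asm) integral_divide_zero[symmetric]) (simp add: mult_ac)
  qed
  then have "k y = 2 * pi * \<i> * of_real (scale * dual_kernel \<alpha> shift n (scale * x) (scale * y))"
    unfolding dual_kernel_def by (simp add: field_simps)
  then show ?thesis unfolding K[OF y] by (simp add: mult_ac)
qed

text \<open>For fixed \<open>y\<close> both sides are polynomials in \<open>x\<close>, the left one
  because the first column is polynomial. They agree at all negative \<open>x\<close>, which are
  infinitely many.\<close>

lemma kernel_positive:
  assumes x: "x > 0" and y: "y > 0"
  shows "w1 y * row 2 (\<lambda>l. bdry_plus Y x $ l $ 1) y + w2 y * row 3 (\<lambda>l. bdry_plus Y x $ l $ 1) y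
    = 2 * pi * \<i> * of_real ((x - y) * (scale * dual_kernel \<alpha> shift n (scale * x) (scale * y)))"
proof -
  have "\<forall>l. \<exists>p. (\<forall>z\<in>slit_plane. Y z $ l $ 1 = poly p z) \<and> (\<forall>x>0. bdry_plus Y x $ l $ 1 = poly p (of_real x))"
    using column1_poly by blast
  then obtain P where P: "\<And>l z. z \<in> slit_plane \<Longrightarrow> Y z $ l $ 1 = poly (P l) z"
    "\<And>l x. x > 0 \<Longrightarrow> bdry_plus Y x $ l $ 1 = poly (P l) (of_real x)"
    by metis
  obtain Q where Q: "\<And>k x. poly (Q k) (of_real x) = complex_of_real (dual_P \<alpha> shift k (scale * x))"
    using dual_P_poly[of _ \<alpha> shift scale] by metis
  define L where "L = (\<Sum>l\<in>UNIV. smult (w1 y * adj3 (bdry_plus Y y) $ 2 $ l + w2 y * adj3 (bdry_plus Y y) $ 3 $ l) (P l))"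
  define R where "R = smult (2 * pi * \<i> * of_real scale) ([:- of_real y, 1:] * (\<Sum>k<n. smult (of_real (dual_Q \<alpha> shift k (scale * y))) (Q k)))"
  have L: "poly L z = w1 y * row 2 (\<lambda>l. poly (P l) z) y + w2 y * row 3 (\<lambda>l. poly (P l) z) y" for z
    unfolding L_def row_def by (simp add: poly_sum sum_distrib_left algebra_simps sum.distrib)
  have R: "poly R (of_real x) = 2 * pi * \<i> * of_real ((x - y) * (scale * dual_kernel \<alpha> shift n (scale * x) (scale * y)))" for x
  proof -
    have "poly (\<Sum>k<n. smult (of_real (dual_Q \<alpha> shift k (scale * y))) (Q k)) (of_real x) = of_real (dual_kernel \<alpha> shift n (scale * x) (scale * y))"
      unfolding dual_kernel_def by (simp add: poly_sum Q mult.commute)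
    then show ?thesis unfolding R_def poly_smult poly_mult by (simp add: mult_ac)
  qed
  have "poly (L - R) (complex_of_real x) = 0" if "x < 0" for x
  proof -
    have "complex_of_real x \<in> slit_plane" using that by (simp add: complex_nonneg_Reals_iff)
    from kernel_negative[OF that y] show ?thesis unfolding P(1)[OF \<open>_ \<in> slit_plane\<close>] by (simp add: L R)
  qed
  then have "complex_of_real ` {..<0} \<subseteq> {z. poly (L - R) z = 0}" by auto
  moreover have "infinite (complex_of_real ` {..<0})"
    using infinite_Iio[of "0 :: real"] by (simp add: finite_image_iff inj_on_def)
  ultimately have "L - R = 0" using poly_roots_finite finite_subset by blast
  then have "poly L (of_real x) = poly R (of_real x)" by simp
  then show ?thesis unfolding L R P(2)[OF x] .
qed

text \<open>Off the diagonal the factor \<open>2 * pi * \<i> * (x - y)\<close> cancels. The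
  resulting expression is continuous in both variables, which settles the diagonal.\<close>

lemma corr_kernel_eq:
  assumes "x > 0" "y > 0"
  shows "corr_kernel a \<alpha> t n Y x y = of_real (scale * dual_kernel \<alpha> shift n (scale * x) (scale * y))"
  unfolding corr_kernel_def
proof (rule diag_extend_eq[OF _ _ assms])
  fix u v :: real assume u: "0 < u" and v: "0 < v" and "u \<noteq> v"
  have "(\<Sum>k\<in>UNIV. (vector [0, w1 v, w2 v] v* (matrix_inv (bdry_plus Y v) ** bdry_plus Y u)) $ k * (vector [1, 0, 0] :: complex^3) $ k)
     = w1 v * row 2 (\<lambda>l. bdry_plus Y u $ l $ 1) v + w2 v * row 3 (\<lambda>l. bdry_plus Y u $ l $ 1) v"
    unfolding matrix_inv_eq_adj3[OF det_eq_1(2)[OF v]] row_def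
    by (simp add: sum_3 vector_matrix_mult_def matrix_matrix_mult_def mult_ac)
  also have "\<dots> = 2 * pi * \<i> * of_real ((u - v) * (scale * dual_kernel \<alpha> shift n (scale * u) (scale * v)))"
    by (rule kernel_positive[OF u v])
  finally show "1 / (2 * of_real pi * \<i> * of_real (u - v)) *
     (\<Sum>k\<in>UNIV. (vector [0, w1 v, w2 v] v* (matrix_inv (bdry_plus Y v) ** bdry_plus Y u)) $ k * (vector [1, 0, 0] :: complex^3) $ k)
     = of_real (scale * dual_kernel \<alpha> shift n (scale * u) (scale * v))"
    using \<open>u \<noteq> v\<close> by simp
next
  show "continuous_on ({0<..} \<times> {0<..}) (\<lambda>(u, v). complex_of_real (scale * dual_kernel \<alpha> shift n (scale * u) (scale * v)))"
    unfolding dual_kernel_def dual_P_def laguerre_q_def dual_Q_def split_beta using scale_pos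
    by (intro continuous_intros \<alpha>) auto
qed

end

theorem theorem2p9:
  fixes a \<alpha> t :: real
  assumes "a > 0" and "\<alpha> > -1" and "0 < t" and "t < 1" and "t > a / (a + 1)"
  shows "\<exists>c>0. \<forall>Y :: nat \<Rightarrow> complex \<Rightarrow> complex^3^3.
    (\<forall>n\<ge>1. rhp_solution a \<alpha> t n (Y n)) \<longrightarrow>
    (\<forall>x>0. \<forall>y>0.
      (\<lambda>n. 1 / of_real (c * (real n)\<^sup>2) *
             corr_kernel a \<alpha> t n (Y n) (x / (c * (real n)\<^sup>2)) (y / (c * (real n)\<^sup>2)))
        \<longlonglongrightarrow> of_real (bessel_limit_kernel \<alpha> x y))"
proof -
  define \<tau> where "\<tau> = a * (1 - t) / t"
  have \<tau>: "0 < \<tau>" using assms by (simp add: \<tau>_def)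
  \<comment> \<open>The assumption on \<open>t\<close>, cleared of its denominator, is
    \<open>a * (1 - t) < t\<close>.\<close>
  have "a < t * (a + 1)" using assms by (simp add: pos_divide_less_eq)
  then have "a * (1 - t) < t" by (simp add: algebra_simps)
  then have \<tau>1: "\<tau> < 1" using assms by (simp add: \<tau>_def)
  \<comment> \<open>Chosen so that \<open>scale * (x / (c * n\<^sup>2))\<close> is
    \<open>x / (4 * (1 - \<tau>)) / n\<close>, the argument at which the limit is known. It depends
    on \<open>a\<close> and \<open>t\<close> only.\<close>
  define c where "c = 4 * (1 - \<tau>) / (t * (1 - t))"
  have c: "c > 0" using assms \<tau>1 by (simp add: c_def)
  show ?thesis
  proof (intro exI[of _ c] conjI allI impI c)
    fix Y :: "nat \<Rightarrow> complex \<Rightarrow> complex^3^3" and x y :: real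
    assume Y: "\<forall>n\<ge>1. rhp_solution a \<alpha> t n (Y n)" and x: "x > 0" and y: "y > 0"
    let ?k = "\<lambda>n. dual_kernel \<alpha> (real n * \<tau>) n (x / (4 * (1 - \<tau>)) / real n) (y / (4 * (1 - \<tau>)) / real n) / (4 * (1 - \<tau>) * real n)"
    have "(\<lambda>n. complex_of_real (?k n)) \<longlonglongrightarrow> of_real (bessel_limit_kernel \<alpha> x y)"
      by (intro tendsto_of_real dual_kernel_tendsto_bessel assms \<tau> \<tau>1 x y)
    moreover have "eventually (\<lambda>n. complex_of_real (?k n) = 1 / of_real (c * (real n)\<^sup>2) *
             corr_kernel a \<alpha> t n (Y n) (x / (c * (real n)\<^sup>2)) (y / (c * (real n)\<^sup>2))) sequentially"
      using eventually_gt_at_top[of 0]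
    proof eventually_elim
      case (elim n)
      interpret bessel_rhp a \<alpha> t n "Y n"
        using assms elim Y by unfold_locales auto
      have s: "scale * (z / (c * (real n)\<^sup>2)) = z / (4 * (1 - \<tau>)) / real n" for z
        unfolding scale_def c_def using assms elim by (simp add: power2_eq_square)
      have sh: "shift = real n * \<tau>" by (simp add: shift_def \<tau>_def)
      have pos: "x / (c * (real n)\<^sup>2) > 0" "y / (c * (real n)\<^sup>2) > 0" using x y c elim by auto
      have sc: "scale / (c * (real n)\<^sup>2) = 1 / (4 * (1 - \<tau>) * real n)"
        using s[of 1] by simp
      have "1 / complex_of_real (c * (real n)\<^sup>2) * of_real (scale * d) = of_real (d / (4 * (1 - \<tau>) * real n))" for d
      proof -
        have "scale * d / (c * (real n)\<^sup>2) = d * (scale / (c * (real n)\<^sup>2))" by simp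
        then have "scale * d / (c * (real n)\<^sup>2) = d / (4 * (1 - \<tau>) * real n)" unfolding sc by simp
        moreover have "1 / complex_of_real (c * (real n)\<^sup>2) * of_real (scale * d) = of_real (scale * d / (c * (real n)\<^sup>2))"
          by simp
        ultimately show ?thesis by (simp only:)
      qed
      then show ?case unfolding corr_kernel_eq[OF pos] s sh by (simp only:)
    qed
    ultimately show "(\<lambda>n. 1 / of_real (c * (real n)\<^sup>2) *
             corr_kernel a \<alpha> t n (Y n) (x / (c * (real n)\<^sup>2)) (y / (c * (real n)\<^sup>2)))
        \<longlonglongrightarrow> of_real (bessel_limit_kernel \<alpha> x y)"
      by (rule Lim_transform_eventually)
  qed
qed

end
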